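(* Let $n\ge3$ and $\phi\in\mathcal C(X_n)$. For $g\in G$ and an $\mathfrak h$-compatible minimal parabolic subgroup $P$ of $G$ consider the equation $$(\ast)\qquad \int_{N_P/(N_P\cap H)}\phi(gn)\,dn=0 .$$ The following four conditions are equivalent. (i) $(\ast)$ holds for every $g\in G$ and every $\mathfrak h$-compatible minimal parabolic subgroup $P$. (ii) $(\ast)$ holds for every $g\in G$ and every $P\in\mathcal P_{\mathfrak h}$. (iii) $(\ast)$ holds for every $g\in G$ and every $P\in\mathcal P_{\mathfrak h}\cap\mathcal P_*$. (iv) In each $H$-conjugacy class in $\mathcal P_{\mathfrak h}\cap\mathcal P_*$ there exists a $P$ such that $(\ast)$ holds for every $g\in G$.
   Context: Let $n\ge3$, $G=\mathrm{SL}(n,\mathbb R)$, $\mathfrak g=\mathfrak{sl}(n,\mathbb R)$. Let $S$ be the $n\times n$ matrix defined by $Se_1=-e_n$, $Se_n=-e_1$, $Se_j=e_j$ for $2\le j\le n-1$ (standard basis vectors), $\sigma(g)=SgS^{-1}$ (also its differential on $\mathfrak g$), and $H=G^\sigma$. Put $X_n=G/H$; write $\mathfrak g=\mathfrak h\oplus\mathfrak q$ for the $\pm1$ eigenspaces of $\sigma$. Let $K=\mathrm{SO}(n)$ and $a_t=\mathrm{diag}(e^t,1,\dots,1,e^{-t})$. Every point of $X_n$ has the form $ka_t\cdot H$ with $k\in K$, $t\in\mathbb R$. Functions on $X_n$ are identified with right $H$-invariant functions on $G$. Schwartz space: $\mathcal C(X_n)$ is the space of smooth $\phi:X_n\to\mathbb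 C$ such that for all $u\in U(\mathfrak g)$ (acting by the left regular action) and $m\ge0$, $\sup_{k\in K,t\in\mathbb R}\cosh^{n-1}(t)(1+|t|)^m|(u\phi)(ka_t\cdot H)|<\infty$. A split component of a minimal parabolic subgroup $P$ (unipotent radical $N_P$) is a maximal connected split subgroup of the center of a Levi subgroup of $P$. Every minimal parabolic $P$ has a $\sigma$-stable split component $A$, unique up to conjugation by $N_P\cap H$; let $\mathfrak a$ be its Lie algebra. The $\sigma$-parabolic rank of $P$ is $\dim(A/(A\cap H))\in\{0,1\}$. $\mathcal P$ (resp. $\mathcal Q$) is the set of minimal parabolic subgroups of $\sigma$-parabolic rank $1$ (resp. $0$). $\Sigma(\mathfrak a)$ is the root system of $\mathfrak a$ in $\mathfrak g$, $\Sigma(\mathfrak a;P)$ is the set of roots $\alpha$ with $\mathfrak g_\alpha\subseteq\mathrm{Lie}(N_P)$, $\Sigma_{\mathfrak h}(\mathfrak a)=\{\alpha\in\Sigma(\mathfrak a):\mathfrak g_\alpha\cap\mathfrak h\ne\{0\}\}$, and $\rho_{P,\mathfrak h}=\frac12\sum_{\alpha\in\Sigma(\mathfrak a;P)\cap\Sigma_{\mathfrak h}(\mathfrak a)}\alpha$. Let $\langle\cdot,\cdot\rangle$ be the inner product on $\mathfrak a^*$ dual to the restriction of $(X,Y)\mapsto\mathrm{tr}(XY)$ to $\mathfrak a$. $P$ is called $\mathfrak h$-compatible if either (a) $P\in\mathcal P$ and $\langle\alpha,\rho_{P,\mathfrak h}\rangle\ge0$ for all $\alpha\in\Sigma(\mathfrak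 a;P)$, or (b) $P\in\mathcal Q$ and $\langle\alpha,\rho_{P,\mathfrak h}\rangle>0$ for all $\alpha\in\Sigma(\mathfrak a;P)$. $\mathcal P_{\mathfrak h}$ is the set of $\mathfrak h$-compatible $P\in\mathcal P$, and $\mathcal P_*=\{P\in\mathcal P:\dim(N_P\cap H)=\max_{Q\in\mathcal P}\dim(N_Q\cap H)\}$. The sets $\mathcal P_{\mathfrak h}$ and $\mathcal P_*$ are stable under conjugation by $H$. $dn$ denotes a non-zero $N_P$-invariant Radon measure on $N_P/(N_P\cap H)$. For $\mathfrak h$-compatible $P$ the integrals in $(\ast)$ converge absolutely for all $\phi\in\mathcal C(X_n)$ and $g\in G$. *)

theory Defs
  imports "HOL-Analysis.Analysis" "HOL-Algebra.Left_Coset"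
begin

text \<open>
  The index type \<open>'n\<close> is an arbitrary finite linear order with \<open>n\<close> elements, so that the first and
  the last standard basis vector and upper triangular matrices make sense. Beware that \<open>(*)\<close>, \<open>1\<close> and
  \<open>(^)\<close> on \<^typ>\<open>real^'n^'n\<close> are not the matrix operations.
\<close>

type_synonym 'n mat = "real^'n^'n"

section \<open>Matrices and the groups involved\<close>

definition mpow :: "'n::finite mat \<Rightarrow> nat \<Rightarrow> 'n mat" where
  "mpow X k = ((\<lambda>Y. X ** Y) ^^ k) (mat 1)"

definition mexp :: "'n::finite mat \<Rightarrow> 'n mat" where
  "mexp X = (\<Sum>k. mpow X k /\<^sub>R fact k)"

definition conj_by :: "'n::finite mat \<Rightarrow> 'n mat \<Rightarrow> 'n mat" where
  "conj_by g x = g ** x ** matrix_inv g"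

definition first_ix :: "'n::{finite,linorder}" where "first_ix = Min UNIV"
definition last_ix :: "'n::{finite,linorder}" where "last_ix = Max UNIV"

text \<open>\<open>S e\<^sub>1 = - e\<^sub>n\<close>, \<open>S e\<^sub>n = - e\<^sub>1\<close> and \<open>S e\<^sub>j = e\<^sub>j\<close> otherwise, given by its columns.\<close>

definition Smat :: "'n::{finite,linorder} mat" where
  "Smat = (\<chi> i j. (if j = first_ix then - axis last_ix 1
                   else if j = last_ix then - axis first_ix 1
                   else axis j 1) $ i)"

definition sigma :: "'n::{finite,linorder} mat \<Rightarrow> 'n mat" where
  "sigma x = Smat ** x ** matrix_inv Smat"

definition SLn :: "'n::finite mat monoid" where
  "SLn = \<lparr>carrier = {g. det g = 1}, mult = (**), one = mat 1\<rparr>"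

abbreviation GG :: "'n::finite mat set" where "GG \<equiv> carrier SLn"

definition HH :: "'n::{finite,linorder} mat set" where
  "HH = {g \<in> GG. sigma g = g}"

definition KK :: "'n::finite mat set" where
  "KK = {k. rotation_matrix k}"

definition a_mat :: "real \<Rightarrow> 'n::{finite,linorder} mat" where
  "a_mat t = (\<chi> i j. if i \<noteq> j then 0
                      else if i = first_ix then exp t
                      else if i = last_ix then exp (- t)
                      else 1)"

lemma group_SLn: "group (SLn :: 'n::finite mat monoid)"
proof (rule groupI)
  fix x :: "'n mat" assume "x \<in> GG"
  then have "det x = 1" by (simp add: SLn_def)
  then have "invertible x" by (simp add: invertible_det_nz)
  then obtain y where y: "y ** x = mat 1" by (auto simp: invertible_def)
  have "det y * det x = 1" by (metis y det_mul det_I)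
  with \<open>det x = 1\<close> y show "\<exists>y\<in>carrier SLn. y \<otimes>\<^bsub>SLn\<^esub> x = \<one>\<^bsub>SLn\<^esub>"
    by (intro bexI[of _ y]) (simp_all add: SLn_def)
qed (auto simp: SLn_def det_mul matrix_mul_assoc)

section \<open>Lie algebras\<close>

definition sl :: "'n::finite mat set" where
  "sl = {X. trace X = 0}"

definition hh :: "'n::{finite,linorder} mat set" where
  "hh = {X \<in> sl. sigma X = X}"

text \<open>The Lie algebra and the dimension (as a Lie group) of a closed subgroup; both are used for closed
  subgroups only.\<close>

definition lie :: "'n::finite mat set \<Rightarrow> 'n mat set" where
  "lie L = {X. \<forall>t::real. mexp (t *\<^sub>R X) \<in> L}"

definition Dim :: "'n::finite mat set \<Rightarrow> nat" where
  "Dim L = dim (lie L)"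

section \<open>The Schwartz space of \<open>G/H\<close>\<close>

text \<open>Functions on \<open>G/H\<close> are right \<open>H\<close>-invariant functions on \<open>G\<close>; values of
  a \<^typ>\<open>'n mat \<Rightarrow> complex\<close> outside \<open>G\<close> are irrelevant throughout.\<close>

primrec Ck_on :: "nat \<Rightarrow> ('a::euclidean_space \<Rightarrow> 'b::real_normed_vector) \<Rightarrow> 'a set \<Rightarrow> bool" where
  "Ck_on 0 f U \<longleftrightarrow> continuous_on U f"
| "Ck_on (Suc k) f U \<longleftrightarrow> (\<forall>x\<in>U. f differentiable (at x)) \<and>
     (\<forall>v. Ck_on k (\<lambda>x. frechet_derivative f (at x) v) U)"

text \<open>Smoothness on the embedded submanifold \<open>G\<close> of the space of all matrices. For right
  \<open>H\<close>-invariant functions it is the same as smoothness on \<open>G/H\<close>, as \<open>G \<rightarrow> G/H\<close> is a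
  surjective submersion.\<close>

definition smooth_on_G :: "('n::finite mat \<Rightarrow> complex) \<Rightarrow> bool" where
  "smooth_on_G \<phi> \<longleftrightarrow> (\<forall>x\<in>GG. \<exists>U F. open U \<and> x \<in> U \<and> (\<forall>k. Ck_on k F U) \<and>
     (\<forall>y\<in>U \<inter> GG. F y = \<phi> y))"

definition left_deriv :: "'n::finite mat \<Rightarrow> ('n mat \<Rightarrow> complex) \<Rightarrow> ('n mat \<Rightarrow> complex)" where
  "left_deriv X \<phi> = (\<lambda>g. vector_derivative (\<lambda>t::real. \<phi> (mexp (- t *\<^sub>R X) ** g)) (at 0))"

text \<open>The operators by which the elements of \<open>U(\<gg>)\<close> act: the image of \<open>U(\<gg>)\<close> under the left regular
  representation is the unital algebra of operators generated by the \<open>left_deriv X\<close>, \<open>X \<in> \<gg>\<close>.\<close>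

inductive_set U_operators :: "(('n::finite mat \<Rightarrow> complex) \<Rightarrow> ('n mat \<Rightarrow> complex)) set" where
  one: "(\<lambda>\<phi>. \<phi>) \<in> U_operators"
| gen: "X \<in> sl \<Longrightarrow> left_deriv X \<in> U_operators"
| mult: "u \<in> U_operators \<Longrightarrow> v \<in> U_operators \<Longrightarrow> (\<lambda>\<phi>. u (v \<phi>)) \<in> U_operators"
| add: "u \<in> U_operators \<Longrightarrow> v \<in> U_operators \<Longrightarrow> (\<lambda>\<phi> g. u \<phi> g + v \<phi> g) \<in> U_operators"
| scale: "u \<in> U_operators \<Longrightarrow> (\<lambda>\<phi> g. c * u \<phi> g) \<in> U_operators"

definition Schwartz :: "('n::{finite,linorder} mat \<Rightarrow> complex) set" where
  "Schwartz = {\<phi>.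
     (\<forall>g\<in>GG. \<forall>h\<in>HH. \<phi> (g ** h) = \<phi> g) \<and> smooth_on_G \<phi> \<and>
     (\<forall>u\<in>U_operators. \<forall>m::nat. \<exists>C. \<forall>k\<in>KK. \<forall>t::real.
        cosh t ^ (CARD('n) - 1) * (1 + \<bar>t\<bar>) ^ m * norm (u \<phi> (k ** a_mat t)) \<le> C)}"

section \<open>Minimal parabolic subgroups\<close>

text \<open>Conjugates of \<open>MAN\<close>, where \<open>G = KAN\<close> is the Iwasawa decomposition with \<open>A\<close> the positive
  diagonal and \<open>N\<close> the upper triangular unipotent matrices, and \<open>M = Z\<^sub>K(A)\<close>. Here \<open>MAN\<close> is
  the group of all upper triangular matrices in \<open>G\<close>.\<close>

definition minimal_parabolic :: "'n::{finite,linorder} mat set \<Rightarrow> bool" where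
  "minimal_parabolic P \<longleftrightarrow>
     (\<exists>g\<in>GG. P = conj_by g ` {b \<in> GG. \<forall>i j. j < i \<longrightarrow> b $ i $ j = 0})"

definition unipotent :: "'n::finite mat \<Rightarrow> bool" where
  "unipotent u \<longleftrightarrow> (\<exists>k. mpow (u - mat 1) k = 0)"

text \<open>For minimal parabolic \<open>P\<close> the union is itself a connected normal unipotent subgroup, hence
  the largest one.\<close>

definition unip_radical :: "'n::finite mat set \<Rightarrow> 'n mat set" where
  "unip_radical P = \<Union>{U. U \<lhd> (SLn\<lparr>carrier := P\<rparr>) \<and> connected U \<and> (\<forall>u\<in>U. unipotent u)}"

text \<open>A closed complement of the unipotent radical; it is automatically reductive,
  being isomorphic to \<open>P/N\<^sub>P\<close>.\<close>

definition Levi_subgroup :: "'n::finite mat set \<Rightarrow> 'n mat set \<Rightarrow> bool" where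
  "Levi_subgroup P L \<longleftrightarrow> subgroup L SLn \<and> L \<subseteq> P \<and> closed L \<and>
     L \<inter> unip_radical P = {mat 1} \<and> L <#>\<^bsub>SLn\<^esub> unip_radical P = P"

definition center :: "'n::finite mat set \<Rightarrow> 'n mat set" where
  "center L = {z \<in> L. \<forall>l\<in>L. z ** l = l ** z}"

definition connected_split_subgroup :: "'n::finite mat set \<Rightarrow> bool" where
  "connected_split_subgroup A \<longleftrightarrow> subgroup A SLn \<and> connected A \<and>
     (\<exists>g. invertible g \<and> (\<forall>a\<in>A. \<forall>i j. i \<noteq> j \<longrightarrow> conj_by g a $ i $ j = 0))"

definition split_component :: "'n::finite mat set \<Rightarrow> 'n mat set \<Rightarrow> bool" where
  "split_component P A \<longleftrightarrow> (\<exists>L. Levi_subgroup P L \<and>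
     A \<subseteq> center L \<and> connected_split_subgroup A \<and>
     (\<forall>A'. A' \<subseteq> center L \<and> connected_split_subgroup A' \<and> A \<subseteq> A' \<longrightarrow> A' = A))"

definition stable_split_component :: "'n::{finite,linorder} mat set \<Rightarrow> 'n mat set \<Rightarrow> bool" where
  "stable_split_component P A \<longleftrightarrow> split_component P A \<and> sigma ` A = A"

text \<open>The \<open>\<sigma>\<close>-stable split component is unique up to conjugation by \<open>N\<^sub>P \<inter> H\<close>, so the
  rank and all notions below do not depend on its choice.\<close>

definition has_parabolic_rank :: "'n::{finite,linorder} mat set \<Rightarrow> nat \<Rightarrow> bool" where
  "has_parabolic_rank P r \<longleftrightarrow> (\<exists>A. stable_split_component P A \<and> r = Dim A - Dim (A \<inter> HH))"

definition parab_P :: "'n::{finite,linorder} mat set set" where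
  "parab_P = {P. minimal_parabolic P \<and> has_parabolic_rank P 1}"

definition parab_Q :: "'n::{finite,linorder} mat set set" where
  "parab_Q = {P. minimal_parabolic P \<and> has_parabolic_rank P 0}"

section \<open>Roots and \<open>\<hh>\<close>-compatibility\<close>

text \<open>Elements of the dual of \<open>\<aa>\<close> are represented by functions on all matrices that are linear
  on \<open>\<aa>\<close> and vanish outside \<open>\<aa>\<close>; this makes the representation unique, which matters for the
  sum over roots in \<open>rho_h\<close>.\<close>

definition dual_space :: "'n::finite mat set \<Rightarrow> ('n mat \<Rightarrow> real) set" where
  "dual_space \<aa> = {\<alpha>. (\<forall>X\<in>\<aa>. \<forall>Y\<in>\<aa>. \<forall>c d. \<alpha> (c *\<^sub>R X + d *\<^sub>R Y) = c * \<alpha> X + d * \<alpha> Y) \<and>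
                       (\<forall>X. X \<notin> \<aa> \<longrightarrow> \<alpha> X = 0)}"

definition root_space :: "'n::finite mat set \<Rightarrow> ('n mat \<Rightarrow> real) \<Rightarrow> 'n mat set" where
  "root_space \<aa> \<alpha> = {X \<in> sl. \<forall>Z\<in>\<aa>. Z ** X - X ** Z = \<alpha> Z *\<^sub>R X}"

definition roots :: "'n::finite mat set \<Rightarrow> ('n mat \<Rightarrow> real) set" where
  "roots \<aa> = {\<alpha> \<in> dual_space \<aa>. \<alpha> \<noteq> (\<lambda>_. 0) \<and> root_space \<aa> \<alpha> \<noteq> {0}}"

definition roots_of :: "'n::finite mat set \<Rightarrow> 'n mat set \<Rightarrow> ('n mat \<Rightarrow> real) set" where
  "roots_of \<aa> P = {\<alpha> \<in> roots \<aa>. root_space \<aa> \<alpha> \<subseteq> lie (unip_radical P)}"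

definition roots_h :: "'n::{finite,linorder} mat set \<Rightarrow> ('n mat \<Rightarrow> real) set" where
  "roots_h \<aa> = {\<alpha> \<in> roots \<aa>. root_space \<aa> \<alpha> \<inter> hh \<noteq> {0}}"

definition rho_h :: "'n::{finite,linorder} mat set \<Rightarrow> 'n mat set \<Rightarrow> 'n mat \<Rightarrow> real" where
  "rho_h \<aa> P = (\<lambda>X. (1 / 2) * (\<Sum>\<alpha> \<in> roots_of \<aa> P \<inter> roots_h \<aa>. \<alpha> X))"

definition dual_vec :: "'n::finite mat set \<Rightarrow> ('n mat \<Rightarrow> real) \<Rightarrow> 'n mat" where
  "dual_vec \<aa> \<alpha> = (THE T. T \<in> \<aa> \<and> (\<forall>X\<in>\<aa>. \<alpha> X = trace (T ** X)))"

definition dual_inner :: "'n::finite mat set \<Rightarrow> ('n mat \<Rightarrow> real) \<Rightarrow> ('n mat \<Rightarrow> real) \<Rightarrow> real" where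
  "dual_inner \<aa> \<alpha> \<beta> = trace (dual_vec \<aa> \<alpha> ** dual_vec \<aa> \<beta>)"

definition h_compatible :: "'n::{finite,linorder} mat set \<Rightarrow> bool" where
  "h_compatible P \<longleftrightarrow> (\<exists>A. stable_split_component P A \<and>
     (P \<in> parab_P \<and> (\<forall>\<alpha>\<in>roots_of (lie A) P. dual_inner (lie A) \<alpha> (rho_h (lie A) P) \<ge> 0) \<or>
      P \<in> parab_Q \<and> (\<forall>\<alpha>\<in>roots_of (lie A) P. dual_inner (lie A) \<alpha> (rho_h (lie A) P) > 0)))"

definition parab_P_h :: "'n::{finite,linorder} mat set set" where
  "parab_P_h = {P \<in> parab_P. h_compatible P}"

definition parab_P_star :: "'n::{finite,linorder} mat set set" where
  "parab_P_star = {P \<in> parab_P. Dim (unip_radical P \<inter> HH) =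
     Max {Dim (unip_radical Q \<inter> HH) | Q :: 'n mat set. Q \<in> parab_P}}"

definition H_class :: "'n::{finite,linorder} mat set \<Rightarrow> 'n mat set set" where
  "H_class P = {conj_by h ` P | h. h \<in> HH}"

section \<open>Integration over \<open>N\<^sub>P/(N\<^sub>P \<inter> H)\<close>\<close>

definition coset_topology :: "'n::finite mat set \<Rightarrow> 'n mat set \<Rightarrow> 'n mat set topology" where
  "coset_topology N M = topology (\<lambda>U. U \<subseteq> lcosets\<^bsub>SLn\<lparr>carrier := N\<rparr>\<^esub> M \<and>
     openin (top_of_set N) {n \<in> N. n <#\<^bsub>SLn\<^esub> M \<in> U})"

lemma openin_coset_topology:
  "openin (coset_topology N M) U \<longleftrightarrow> U \<subseteq> lcosets\<^bsub>SLn\<lparr>carrier := N\<rparr>\<^esub> M \<and>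
     openin (top_of_set N) {n \<in> N. n <#\<^bsub>SLn\<^esub> M \<in> U}"
proof -
  let ?R = "\<lambda>U. U \<subseteq> lcosets\<^bsub>SLn\<lparr>carrier := N\<rparr>\<^esub> M \<and>
     openin (top_of_set N) {n \<in> N. n <#\<^bsub>SLn\<^esub> M \<in> U}"
  have "istopology ?R"
    unfolding istopology_def
  proof (intro conjI allI impI)
    fix S T assume S: "?R S" and T: "?R T"
    have "{n \<in> N. n <#\<^bsub>SLn\<^esub> M \<in> S \<inter> T}
        = {n \<in> N. n <#\<^bsub>SLn\<^esub> M \<in> S} \<inter> {n \<in> N. n <#\<^bsub>SLn\<^esub> M \<in> T}" by auto
    then show "openin (top_of_set N) {n \<in> N. n <#\<^bsub>SLn\<^esub> M \<in> S \<inter> T}"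
      using S T by auto
    show "S \<inter> T \<subseteq> lcosets\<^bsub>SLn\<lparr>carrier := N\<rparr>\<^esub> M" using S by auto
  next
    fix \<K> assume K: "\<forall>S\<in>\<K>. ?R S"
    have "{n \<in> N. n <#\<^bsub>SLn\<^esub> M \<in> \<Union>\<K>} = (\<Union>S\<in>\<K>. {n \<in> N. n <#\<^bsub>SLn\<^esub> M \<in> S})" by auto
    then show "openin (top_of_set N) {n \<in> N. n <#\<^bsub>SLn\<^esub> M \<in> \<Union>\<K>}"
      using K by auto
    show "\<Union>\<K> \<subseteq> lcosets\<^bsub>SLn\<lparr>carrier := N\<rparr>\<^esub> M" using K by auto
  qed
  then show ?thesis by (simp add: coset_topology_def)
qed

definition Radon_measure :: "'a topology \<Rightarrow> 'a measure \<Rightarrow> bool" where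
  "Radon_measure X \<mu> \<longleftrightarrow>
     space \<mu> = topspace X \<and> sets \<mu> = sigma_sets (topspace X) {U. openin X U} \<and>
     (\<forall>K. compactin X K \<longrightarrow> emeasure \<mu> K < \<infinity>) \<and>
     (\<forall>B\<in>sets \<mu>. emeasure \<mu> B = (INF U\<in>{U. openin X U \<and> B \<subseteq> U}. emeasure \<mu> U)) \<and>
     (\<forall>U. openin X U \<longrightarrow> emeasure \<mu> U = (SUP K\<in>{K. compactin X K \<and> K \<subseteq> U}. emeasure \<mu> K))"

definition invariant_measure :: "'n::{finite,linorder} mat set \<Rightarrow> 'n mat set measure \<Rightarrow> bool" where
  "invariant_measure P \<mu> \<longleftrightarrow>
     Radon_measure (coset_topology (unip_radical P) (unip_radical P \<inter> HH)) \<mu> \<and>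
     emeasure \<mu> (space \<mu>) \<noteq> 0 \<and>
     (\<forall>n\<in>unip_radical P. \<forall>B\<in>sets \<mu>. emeasure \<mu> ((\<lambda>C. n <#\<^bsub>SLn\<^esub> C) ` B) = emeasure \<mu> B)"

text \<open>For right \<open>H\<close>-invariant \<open>\<phi>\<close> the function \<open>n \<mapsto> \<phi> (g n)\<close> is constant on each coset \<open>C\<close>, so
  the image below is a singleton. For \<open>\<hh>\<close>-compatible \<open>P\<close> and \<open>\<phi>\<close> in the Schwartz space the integral
  converges absolutely, so no default value of a divergent integral is involved.\<close>

definition horo_integral ::
    "'n::{finite,linorder} mat set measure \<Rightarrow> ('n mat \<Rightarrow> complex) \<Rightarrow> 'n mat \<Rightarrow> complex" where
  "horo_integral \<mu> \<phi> g = (\<integral>C. the_elem ((\<lambda>n. \<phi> (g ** n)) ` C) \<partial>\<mu>)"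

end

theory Submission
  imports Defs
begin

text \<open>
  Sending \<open>g H\<close> to \<open>g S g\<^sup>-\<^sup>1\<close> identifies \<open>G/H\<close> with the set of reflections, that is of pairs \<open>(v, l)\<close> with
  \<open>v \<bullet> l = 1\<close> up to scaling. Relative to the flag of a minimal parabolic \<open>P\<close> and a \<open>\<sigma>\<close>-stable split
  component, \<open>S\<close> either interchanges two eigenlines, with indices \<open>l < k\<close>, or is diagonal with one sign
  \<open>-1\<close> at \<open>k\<close>. In terms of these indices \<open>P\<close> is \<open>h\<close>-compatible iff the entries of a certain vector decrease.
  This leaves adjacent pairs \<open>l, k\<close> near the middle and, for odd \<open>n\<close> with middle index \<open>m\<close>, the pair
  \<open>m - 1, m + 1\<close> and the rank zero type \<open>k = m\<close>. The adjacent pairs belong to \<open>\<P>\<^sub>*\<close>, and there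
  condition (iv) applies directly, as (\<open>*\<close>) for all \<open>g\<close> is invariant under conjugation by \<open>H\<close>.

  The orbits of \<open>N\<^sub>P\<close> carry global coordinates in which an invariant measure is Lebesgue measure,
  because it is invariant under translations. For the pair \<open>m - 1, m + 1\<close> all but one of these
  translations are available; fixing the remaining coordinate leaves, after a change of basis, an
  integral of adjacent type, and Fubini's theorem applies. Convergence need not be considered here,
  because the Bochner integral of a non-integrable function is \<open>0\<close>.

  The rank zero orbit is the limit \<open>\<epsilon> \<rightarrow> 0\<close> of orbits of adjacent type for the reflections
  \<open>(e\<^sub>k, e\<^sub>k + \<epsilon> e\<^sub>l)\<close>. Here \<open>norm v * norm l = cosh (2 t)\<close> in the decomposition \<open>G = K A H\<close>, and the decay of
  Schwartz functions allows one to pass to the limit under the integral sign.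
\<close>

section \<open>Conjugation and reflections\<close>

text \<open>The Schwartz decay is borderline. With n = 2 d + 1 and r = norm v * norm l, the factor
  cosh(t)^(n-1) is comparable to r^d, while the rank zero orbit has 2 d coordinates, d of them
  bounded by norm v and d by norm l. This leaves one power of 1/|s| for each coordinate, and only
  the logarithmic factors make the dominating function integrable. The equal number of indices on
  both sides of the middle one is what lets the powers be shared out. A second obstacle is that for
  small e the entry 1 - e z_l nearly vanishes around z_l = 1/e, a region that moves off to infinity
  and could carry mass away. Scaling the coordinates below k by 1/e and those above by e preserves
  volume, again because there are d of each kind, and shows that this contribution dies out.
  Vanishing for all g at once is used throughout: base points, elements of H and changes of basis
  depending on a fixed coordinate are all absorbed into g.\<close>

lemma GG_iff: "g \<in> GG \<longleftrightarrow> det g = 1"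
  by (simp add: SLn_def)

lemma matrix_inv_unique:
  fixes A :: "real^'n^'n"
  assumes "A ** B = mat 1"
  shows "matrix_inv A = B"
proof -
  have BA: "B ** A = mat 1" using assms by (simp add: matrix_left_right_inverse)
  have "A ** matrix_inv A = mat 1 \<and> matrix_inv A ** A = mat 1"
    unfolding matrix_inv_def by (rule someI[of _ B]) (simp add: assms BA)
  then have "B = B ** (A ** matrix_inv A)" by simp
  also have "\<dots> = matrix_inv A" by (simp add: matrix_mul_assoc BA)
  finally show ?thesis by simp
qed

lemma GG_inverse:
  fixes g :: "real^'n^'n"
  assumes "g \<in> GG"
  shows "g ** matrix_inv g = mat 1" "matrix_inv g ** g = mat 1" "matrix_inv g \<in> GG"
proof -
  have "invertible g" using assms by (simp add: GG_iff invertible_det_nz)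
  then obtain B where "g ** B = mat 1" by (auto simp: invertible_def)
  with matrix_inv_unique show 1: "g ** matrix_inv g = mat 1" by metis
  then show "matrix_inv g ** g = mat 1" by (simp add: matrix_left_right_inverse)
  have "det g * det (matrix_inv g) = 1" by (metis 1 det_mul det_I)
  then show "matrix_inv g \<in> GG" using assms by (simp add: GG_iff)
qed

lemma GG_cancel:
  fixes g :: "real^'n^'n"
  assumes "g \<in> GG"
  shows "g ** (matrix_inv g ** x) = x" "matrix_inv g ** (g ** x) = x"
    "y ** g ** matrix_inv g = y" "y ** matrix_inv g ** g = y"
    "g *v (matrix_inv g *v u) = u" "matrix_inv g *v (g *v u) = u"
  using GG_inverse[OF assms]
  by (simp_all add: matrix_mul_assoc matrix_vector_mul_assoc)
    (simp_all add: matrix_mul_assoc[symmetric])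

lemma mat1_in_GG: "mat 1 \<in> GG"
  and mult_in_GG: "g \<in> GG \<Longrightarrow> h \<in> GG \<Longrightarrow> g ** h \<in> GG"
  by (auto simp: GG_iff det_mul)

lemma matrix_inv_mult:
  fixes g h :: "real^'n^'n"
  assumes "g \<in> GG" "h \<in> GG"
  shows "matrix_inv (g ** h) = matrix_inv h ** matrix_inv g"
proof (rule matrix_inv_unique)
  have "g ** h ** (matrix_inv h ** matrix_inv g) = g ** (h ** matrix_inv h) ** matrix_inv g"
    by (simp add: matrix_mul_assoc)
  then show "g ** h ** (matrix_inv h ** matrix_inv g) = mat 1"
    by (simp add: GG_inverse assms)
qed

lemma matrix_inv_GG_inv:
  fixes g :: "real^'n^'n"
  shows "g \<in> GG \<Longrightarrow> matrix_inv (matrix_inv g) = g"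
  by (rule matrix_inv_unique) (rule GG_inverse)

lemma matrix_inv_mat1 [simp]: "matrix_inv (mat 1 :: real^'n^'n) = mat 1"
  by (rule matrix_inv_unique) simp

lemma conj_by_mult:
  "g \<in> GG \<Longrightarrow> conj_by g (x ** y) = conj_by g x ** conj_by g y"
  by (simp add: conj_by_def matrix_mul_assoc GG_cancel)

lemma conj_by_conj_by:
  "g \<in> GG \<Longrightarrow> h \<in> GG \<Longrightarrow> conj_by g (conj_by h x) = conj_by (g ** h) x"
  by (simp add: conj_by_def matrix_inv_mult matrix_mul_assoc)

lemma conj_by_mat1 [simp]: "conj_by (mat 1) x = x"
  by (simp add: conj_by_def)

lemma conj_by_one: "g \<in> GG \<Longrightarrow> conj_by g (mat 1) = mat 1"
  by (simp add: conj_by_def GG_inverse)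

lemma conj_by_inverse:
  assumes "g \<in> GG"
  shows "conj_by g (conj_by (matrix_inv g) x) = x" "conj_by (matrix_inv g) (conj_by g x) = x"
  using assms by (simp_all add: conj_by_conj_by GG_inverse)

lemma conj_by_eq_iff: "g \<in> GG \<Longrightarrow> conj_by g x = conj_by g y \<longleftrightarrow> x = y"
  by (metis conj_by_inverse(2))

lemma conj_by_in_image_iff: "g \<in> GG \<Longrightarrow> conj_by g x \<in> conj_by g ` A \<longleftrightarrow> x \<in> A"
  by (auto simp: conj_by_eq_iff)

lemma mem_conj_by_image: "g \<in> GG \<Longrightarrow> y \<in> conj_by g ` A \<longleftrightarrow> conj_by (matrix_inv g) y \<in> A"
  by (metis conj_by_in_image_iff conj_by_inverse(1))

lemma det_conj_by: "g \<in> GG \<Longrightarrow> det (conj_by g x) = det x"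
  by (simp add: conj_by_def det_mul GG_iff) (metis GG_iff GG_inverse(3) mult_1)

lemma conj_by_in_GG_iff: "g \<in> GG \<Longrightarrow> conj_by g x \<in> GG \<longleftrightarrow> x \<in> GG"
  by (simp add: GG_iff[of "conj_by g x"] GG_iff[of x] det_conj_by)

lemma linear_matrix_mult_left: "linear (\<lambda>X::real^'n^'n. A ** X)"
  by (rule linearI) (simp_all add: vec_eq_iff matrix_matrix_mult_def sum_distrib_left sum.distrib algebra_simps)

lemma linear_matrix_mult_right: "linear (\<lambda>X::real^'n^'n. X ** A)"
  by (rule linearI) (simp_all add: vec_eq_iff matrix_matrix_mult_def sum_distrib_left sum.distrib algebra_simps)

lemma linear_conj_by: "linear (conj_by g :: real^'n^'n \<Rightarrow> _)"
  unfolding conj_by_def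
  using linear_compose[OF linear_matrix_mult_left[of g] linear_matrix_mult_right[of "matrix_inv g"]]
  by (simp add: o_def)

lemma trace_conj_by: "g \<in> GG \<Longrightarrow> trace (conj_by g x) = trace x"
  by (metis conj_by_def GG_inverse(2) trace_mul_sym matrix_mul_assoc matrix_mul_lid)

lemma continuous_on_matrix_mult [continuous_intros]:
  fixes f g :: "'a::topological_space \<Rightarrow> real^'n^'n"
  assumes "continuous_on A f" "continuous_on A g"
  shows "continuous_on A (\<lambda>x. f x ** g x)"
  unfolding matrix_matrix_mult_def
  by (intro continuous_on_vec_lambda continuous_on_sum continuous_on_mult
      continuous_on_component assms)

lemma continuous_on_conj_by: "continuous_on A (conj_by g :: real^'n^'n \<Rightarrow> _)"
  by (intro linear_continuous_on) (metis linear_conj_by linear_conv_bounded_linear)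

section \<open>Rank one matrices and reflections\<close>

definition outer :: "real^'n \<Rightarrow> real^'n \<Rightarrow> real^'n^'n" where
  "outer v l = (\<chi> i j. v $ i * l $ j)"

text \<open>For \<open>v \<bullet> l = 1\<close> this is the reflection with \<open>-1\<close>-eigenvector \<open>v\<close> and fixed hyperplane
  \<open>l = 0\<close>; the conjugates of \<^const>\<open>Smat\<close> are such matrices, so that \<open>G/H\<close> becomes the set of pairs
  \<open>(v, l)\<close> modulo \<open>(v, l) \<mapsto> (c v, l / c)\<close>.\<close>
definition reflection :: "real^'n \<Rightarrow> real^'n \<Rightarrow> real^'n^'n" where
  "reflection v l = mat 1 - 2 *\<^sub>R outer v l"

lemma outer_component: "outer v l $ i $ j = v $ i * l $ j"
  by (simp add: outer_def)

lemma refl_component: "reflection v l $ i $ j = (if i = j then 1 else 0) - 2 * (v $ i * l $ j)"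
  by (simp add: reflection_def outer_component mat_def)

lemma mult_outer: "A ** outer v l = outer (A *v v) l"
  by (simp add: vec_eq_iff outer_def matrix_matrix_mult_def matrix_vector_mult_def sum_distrib_left sum_distrib_right mult_ac)

lemma outer_mult: "outer v l ** A = outer v (l v* A)"
  by (simp add: vec_eq_iff outer_def matrix_matrix_mult_def vector_matrix_mult_def sum_distrib_left sum_distrib_right mult_ac)

lemma outer_mult_vec: "outer v l *v x = (l \<bullet> x) *\<^sub>R v"
  by (simp add: vec_eq_iff outer_def matrix_vector_mult_def inner_vec_def sum_distrib_left sum_distrib_right mult_ac)

lemma vec_mult_outer: "x v* outer v l = (x \<bullet> v) *\<^sub>R l"
  by (simp add: vec_eq_iff outer_def vector_matrix_mult_def inner_vec_def sum_distrib_right sum_distrib_left mult_ac)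

lemma outer_scale: "c *\<^sub>R outer v l = outer (c *\<^sub>R v) l" "c *\<^sub>R outer v l = outer v (c *\<^sub>R l)"
  by (simp_all add: vec_eq_iff outer_def)

lemma refl_scale: "c \<noteq> 0 \<Longrightarrow> reflection (c *\<^sub>R v) l = reflection v (c *\<^sub>R l)"
  by (simp add: reflection_def outer_scale[symmetric])

lemma refl_eq_iff: "reflection v l = reflection v' l' \<longleftrightarrow> outer v l = outer v' l'"
  by (simp add: reflection_def)

lemma inner_vec_mult: "(l v* A) \<bullet> v = l \<bullet> (A *v v)" for A :: "real^'n^'n"
proof -
  have "(l v* A) \<bullet> v = (\<Sum>i\<in>UNIV. \<Sum>j\<in>UNIV. A $ j $ i * l $ j * v $ i)"
    by (simp add: inner_vec_def vector_matrix_mult_def sum_distrib_right sum_distrib_left mult_ac)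
  also have "\<dots> = (\<Sum>j\<in>UNIV. \<Sum>i\<in>UNIV. A $ j $ i * l $ j * v $ i)" by (rule sum.swap)
  also have "\<dots> = l \<bullet> (A *v v)"
    by (simp add: inner_vec_def matrix_vector_mult_def sum_distrib_left mult_ac)
  finally show ?thesis .
qed

lemma vec_mult_assoc: "l v* A v* B = l v* (A ** B)" for A B :: "real^'n^'n"
proof -
  have "(l v* A v* B) \<bullet> x = (l v* (A ** B)) \<bullet> x" for x
    by (simp only: inner_vec_mult matrix_vector_mul_assoc)
  then show ?thesis by (metis vector_eq_ldot inner_commute)
qed

lemma vec_mult_mat1 [simp]: "l v* mat 1 = (l :: real^'n)"
  by (simp add: vec_eq_iff vector_matrix_mult_def mat_def if_distrib[of "\<lambda>x. _ * x"] cong: if_cong)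

lemma conj_by_outer: "conj_by g (outer v l) = outer (g *v v) (l v* matrix_inv g)"
  by (simp add: conj_by_def mult_outer outer_mult)

lemma conj_by_refl: "g \<in> GG \<Longrightarrow> conj_by g (reflection v l) = reflection (g *v v) (l v* matrix_inv g)"
  unfolding reflection_def
  by (simp add: linear_diff[OF linear_conj_by] linear_scale[OF linear_conj_by] conj_by_one conj_by_outer)

lemma inner_dual_pairing:
  "g \<in> GG \<Longrightarrow> (l v* matrix_inv g) \<bullet> (g *v v) = l \<bullet> v"
  by (simp add: inner_vec_mult GG_cancel)

text \<open>A rank one matrix determines its pair up to \<open>(c v, l / c)\<close>; normalising one
  entry of \<open>v\<close> removes the scalar.\<close>

lemma outer_eq_outerD:
  assumes "outer v l = outer v' l'" "v $ k = 1" "v' $ k = 1"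
  shows "l = l'" "l \<noteq> 0 \<Longrightarrow> v = v'"
proof -
  have *: "v $ i * l $ j = v' $ i * l' $ j" for i j
    using assms(1) by (metis outer_component)
  show "l = l'" using *[of k] assms by (simp add: vec_eq_iff)
  assume "l \<noteq> 0"
  then obtain j where "l $ j \<noteq> 0" by (auto simp: vec_eq_iff)
  with * \<open>l = l'\<close> show "v = v'" by (metis mult_right_cancel vec_eq_iff)
qed

lemma refl_mult_refl: "l \<bullet> v = 1 \<Longrightarrow> reflection v l ** reflection v l = mat 1"
  unfolding reflection_def
  by (simp add: linear_diff[OF linear_matrix_mult_left] linear_diff[OF linear_matrix_mult_right]
      linear_scale[OF linear_matrix_mult_left] linear_scale[OF linear_matrix_mult_right]
      mult_outer outer_mult_vec matrix_vector_mult_diff_rdistrib scaleR_matrix_vector_assoc[symmetric])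
    (simp add: scaleR_2 vec_eq_iff outer_component)

section \<open>The base point as a reflection and H as its stabiliser\<close>

lemma first_less_last:
  assumes "CARD('n::{finite,linorder}) \<ge> 2"
  shows "(first_ix :: 'n) < last_ix"
proof -
  have "\<not> is_singleton (UNIV :: 'n set)" using assms by (simp add: is_singleton_altdef)
  then obtain a b :: 'n where "a \<noteq> b" by (metis UNIV_I empty_not_UNIV is_singletonI')
  moreover have "first_ix \<le> a" "first_ix \<le> b" "a \<le> last_ix" "b \<le> last_ix"
    by (simp_all add: first_ix_def last_ix_def)
  ultimately show ?thesis by (metis order.strict_trans1 order.strict_trans2 linorder_neqE not_less order.antisym)
qed

text \<open>\<open>Smat\<close> negates e_1 + e_n and fixes e_1 - e_n and the other basis vectors.
  The factor 1/2 makes the pairing of the two entries equal to 1.\<close>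

lemma Smat_eq_refl:
  assumes "CARD('n::{finite,linorder}) \<ge> 2"
  shows "(Smat :: 'n mat) = reflection (axis first_ix 1 + axis last_ix 1) ((1/2) *\<^sub>R (axis first_ix 1 + axis last_ix 1))"
  using first_less_last[OF assms]
  by (auto simp: vec_eq_iff Smat_def refl_component axis_def)

lemma inner_axis_axis_real: "axis i (a::real) \<bullet> axis j b = (if i = j then a * b else 0)"
  by (simp add: inner_axis_axis)

lemma Smat_square:
  assumes "CARD('n::{finite,linorder}) \<ge> 2"
  shows "(Smat :: 'n mat) ** Smat = mat 1"
  unfolding Smat_eq_refl[OF assms]
  using first_less_last[OF assms]
  by (intro refl_mult_refl) (simp add: inner_add_left inner_add_right inner_axis_axis_real)

lemma sigma_eq_iff:
  assumes "CARD('n::{finite,linorder}) \<ge> 2"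
  shows "sigma x = (y :: 'n mat) \<longleftrightarrow> Smat ** x = y ** Smat"
proof -
  have inv: "matrix_inv (Smat :: 'n mat) = Smat" by (rule matrix_inv_unique) (rule Smat_square[OF assms])
  show ?thesis
    unfolding sigma_def inv by (metis Smat_square[OF assms] matrix_mul_assoc matrix_mul_rid)
qed

text \<open>This identifies G/H with the conjugacy class of \<open>Smat\<close>.\<close>

lemma HH_iff:
  assumes "CARD('n::{finite,linorder}) \<ge> 2"
  shows "h \<in> HH \<longleftrightarrow> h \<in> GG \<and> conj_by h (Smat :: 'n mat) = Smat"
proof -
  have "Smat ** h = h ** Smat \<longleftrightarrow> conj_by h Smat = Smat" if "h \<in> GG"
    unfolding conj_by_def using GG_cancel[OF that] by metis
  then show ?thesis by (auto simp: HH_def sigma_eq_iff[OF assms])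
qed

lemma KK_subset_GG: "k \<in> KK \<Longrightarrow> k \<in> GG"
  by (simp add: KK_def rotation_matrix_def GG_iff)

section \<open>Elementary transvections\<close>

definition trv :: "'n \<Rightarrow> 'n \<Rightarrow> real \<Rightarrow> real^'n^'n::finite" where
  "trv i j a = mat 1 + outer (axis i a) (axis j 1)"

lemma trv_component: "trv i j a $ x $ y = (if x = y then 1 else 0) + (if x = i \<and> y = j then a else 0)"
  by (auto simp: trv_def outer_component mat_def axis_def)

lemma trv_mult_vec: "trv i j a *v x = x + axis i (a * x $ j)"
  by (simp add: trv_def matrix_vector_mult_add_rdistrib outer_mult_vec inner_axis' vec_eq_iff) (simp add: axis_def)

lemma vec_mult_trv: "x v* trv i j a = x + axis j (a * x $ i)"
  unfolding trv_def
  by (simp add: vec_eq_iff vector_matrix_mult_def outer_component mat_def axis_def sum.distrib algebra_simps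
      if_distrib[of "\<lambda>x. _ * x"] cong: if_cong)

lemma trv_mult_trv: "i \<noteq> j \<Longrightarrow> trv i j a ** trv i j b = trv i j (a + b)"
  unfolding trv_def
  by (simp add: matrix_add_ldistrib mult_outer outer_mult_vec matrix_vector_mult_add_rdistrib inner_axis_axis_real)
    (simp add: vec_eq_iff outer_component axis_def algebra_simps)

lemma trv_0 [simp]: "trv i j 0 = mat 1"
  by (simp add: trv_def outer_def vec_eq_iff axis_def)

lemma trv_in_GG: assumes "i \<noteq> j" shows "trv i j a \<in> GG"
proof -
  let ?A = "mat 1 :: real^'n^'n"
  have "trv i j a = (\<chi> k. if k = i then row i ?A + a *s row j ?A else row k ?A)"
    by (auto simp: vec_eq_iff trv_component row_def mat_def)
  then show ?thesis using det_row_operation[OF assms, of ?A a] by (simp add: GG_iff)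
qed

lemma matrix_inv_trv: "i \<noteq> j \<Longrightarrow> matrix_inv (trv i j a) = trv i j (- a)"
  by (rule matrix_inv_unique) (simp add: trv_mult_trv)

section \<open>Triangular matrices\<close>

definition BB :: "'n::{finite,linorder} mat set" where
  "BB = {b \<in> GG. \<forall>i j. j < i \<longrightarrow> b $ i $ j = 0}"

definition UU :: "'n::{finite,linorder} mat set" where
  "UU = {u. (\<forall>i. u $ i $ i = 1) \<and> (\<forall>i j. j < i \<longrightarrow> u $ i $ j = 0)}"

text \<open>If nothing decreased, the largest moved point would be sent to a larger one, hence to a
  fixed point, against injectivity.\<close>

lemma permutes_nontrivial_decreases:
  fixes p :: "'n::{finite,linorder} \<Rightarrow> 'n"
  assumes p: "p permutes UNIV" "p \<noteq> id"
  shows "\<exists>i. p i < i"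
proof (rule ccontr)
  assume "\<not> ?thesis"
  then have ge: "i \<le> p i" for i by (simp add: not_less)
  let ?M = "{i. p i \<noteq> i}"
  have "?M \<noteq> {}" using p(2) by (auto simp: fun_eq_iff)
  then have m: "Max ?M \<in> ?M" by (intro Max_in) auto
  with ge have "Max ?M < p (Max ?M)" by (metis (mono_tags, lifting) mem_Collect_eq order_le_less)
  then have "p (Max ?M) \<notin> ?M" by (metis Max_ge finite not_less)
  then have "p (p (Max ?M)) = p (Max ?M)" by simp
  then have "p (Max ?M) = Max ?M" using permutes_inj[OF p(1)] by (simp add: inj_eq)
  with m show False by simp
qed

lemma det_upper_triangular:
  fixes A :: "'n::{finite,linorder} mat"
  assumes "\<And>i j. j < i \<Longrightarrow> A $ i $ j = 0"
  shows "det A = (\<Prod>i\<in>UNIV. A $ i $ i)"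
proof -
  let ?PU = "{p. p permutes (UNIV :: 'n set)}"
  let ?pp = "\<lambda>p. of_int (sign p) * (\<Prod>i\<in>UNIV. A $ i $ p i)"
  have "?pp p = 0" if "p \<in> ?PU - {id}" for p
  proof -
    from that obtain i where "p i < i" using permutes_nontrivial_decreases[of p] by auto
    then have "(\<Prod>i\<in>UNIV. A $ i $ p i) = 0" using assms by (intro prod_zero) auto
    then show ?thesis by simp
  qed
  then have "sum ?pp ?PU = sum ?pp {id}"
    by (intro sum.mono_neutral_right) (auto simp: permutes_id)
  then show ?thesis by (simp add: det_def sign_id)
qed

lemma upper_mult_component:
  fixes A B :: "'n::{finite,linorder} mat"
  assumes "\<And>i j. j < i \<Longrightarrow> A $ i $ j = 0" "\<And>i j. j < i \<Longrightarrow> B $ i $ j = 0"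
  shows "j < i \<Longrightarrow> (A ** B) $ i $ j = 0" "(A ** B) $ i $ i = A $ i $ i * B $ i $ i"
proof -
  show "(A ** B) $ i $ j = 0" if "j < i"
    unfolding matrix_matrix_mult_def using that assms
    by (auto intro!: sum.neutral) (metis linorder_cases order.strict_trans)
  have "(\<Sum>k\<in>UNIV. A $ i $ k * B $ k $ i) = (\<Sum>k\<in>{i}. A $ i $ k * B $ k $ i)"
    using assms by (intro sum.mono_neutral_right) (auto, metis linorder_neqE)
  then show "(A ** B) $ i $ i = A $ i $ i * B $ i $ i"
    by (simp add: matrix_matrix_mult_def)
qed

lemma BB_subset_GG: "b \<in> BB \<Longrightarrow> b \<in> GG"
  by (simp add: BB_def)

lemma BB_mult: "a \<in> BB \<Longrightarrow> b \<in> BB \<Longrightarrow> a ** b \<in> BB"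
  by (simp add: BB_def mult_in_GG upper_mult_component)

text \<open>Upper triangular means preserving the coordinate flag. An injective map that sends a
  member of the flag into itself sends it onto itself by dimension, so the inverse preserves it
  too.\<close>

lemma BB_inverse:
  assumes b: "b \<in> (BB :: 'n::{finite,linorder} mat set)"
  shows "matrix_inv b \<in> BB"
proof -
  have g: "b \<in> GG" and up: "\<And>i j. j < i \<Longrightarrow> b $ i $ j = 0" using b by (auto simp: BB_def)
  have "matrix_inv b $ i $ j = 0" if ij: "j < i" for i j
  proof -
    let ?F = "{x::(real, 'n) vec. \<forall>i>j. x $ i = 0}"
    have sF: "subspace ?F" by (auto simp: subspace_def)
    have sub: "(*v) b ` ?F \<subseteq> ?F"
    proof safe
      fix x :: "(real, 'n) vec" and a assume x: "\<forall>i>j. x $ i = 0" and a: "j < a"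
      have "b $ a $ k * x $ k = 0" for k
        using x a up by (cases "k \<le> j") auto
      then show "(b *v x) $ a = 0" by (simp add: matrix_vector_mult_def sum.neutral del: mult_eq_0_iff)
    qed
    have inj: "inj ((*v) b)" by (metis GG_cancel(6)[OF g] injI)
    have "dim ((*v) b ` ?F) = dim ?F"
      by (rule dim_image_eq) (use inj in \<open>auto intro: inj_on_subset\<close>)
    then have "(*v) b ` ?F = ?F"
      using sub sF by (metis (no_types, lifting) linear_subspace_image matrix_vector_mul_linear order_refl subspace_dim_equal)
    moreover have "axis j 1 \<in> ?F" by (auto simp: axis_def)
    ultimately obtain x where x: "x \<in> ?F" "axis j 1 = b *v x" by blast
    then have "matrix_inv b *v axis j 1 = x" by (simp add: GG_cancel[OF g])
    then have "x $ i = matrix_inv b $ i $ j" by (auto simp: matrix_vector_mul_component inner_axis)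
    with x ij show ?thesis by simp
  qed
  then show ?thesis using GG_inverse[OF g] by (simp add: BB_def)
qed

lemma BB_diag_inverse:
  assumes "b \<in> BB"
  shows "b $ i $ i * matrix_inv b $ i $ i = 1" "b $ i $ i \<noteq> 0"
proof -
  have "(b ** matrix_inv b) $ i $ i = b $ i $ i * matrix_inv b $ i $ i"
    using assms BB_inverse[OF assms] by (intro upper_mult_component) (auto simp: BB_def)
  then show "b $ i $ i * matrix_inv b $ i $ i = 1"
    using GG_inverse[OF BB_subset_GG[OF assms]] by (simp add: mat_def)
  then show "b $ i $ i \<noteq> 0" by auto
qed

lemma UU_iff_BB: "u \<in> UU \<longleftrightarrow> u \<in> BB \<and> (\<forall>i. u $ i $ i = 1)"
  by (auto simp: UU_def BB_def GG_iff det_upper_triangular)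

lemma UU_subset_BB: "u \<in> UU \<Longrightarrow> u \<in> BB"
  and UU_subset_GG: "u \<in> UU \<Longrightarrow> u \<in> GG"
  by (auto simp: UU_iff_BB BB_def)

lemma UU_mult: "u \<in> UU \<Longrightarrow> v \<in> UU \<Longrightarrow> u ** v \<in> UU"
  by (simp add: UU_def upper_mult_component)

lemma UU_inverse: "u \<in> UU \<Longrightarrow> matrix_inv u \<in> UU"
  unfolding UU_iff_BB by (metis BB_diag_inverse(1) BB_inverse mult_1)

lemma mat1_in_UU: "mat 1 \<in> UU" and mat1_in_BB: "mat 1 \<in> BB"
  by (auto simp: UU_def BB_def mat1_in_GG) (simp_all add: mat_def)

lemma trv_in_UU: "i < j \<Longrightarrow> trv i j a \<in> UU"
  by (auto simp: UU_def trv_component)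

lemma UU_normal_in_BB:
  assumes "b \<in> BB" "u \<in> UU"
  shows "conj_by b u \<in> UU"
proof -
  have bu: "b ** u \<in> BB" using assms by (simp add: BB_mult UU_subset_BB)
  have "(b ** u) $ i $ i = b $ i $ i" for i
    using assms by (subst upper_mult_component) (auto simp: BB_def UU_def)
  then have "(b ** u ** matrix_inv b) $ i $ i = 1" for i
    using bu BB_inverse[OF assms(1)] BB_diag_inverse(1)[OF assms(1)]
    by (subst upper_mult_component) (auto simp: BB_def)
  then show ?thesis
    using bu BB_inverse[OF assms(1)] by (simp add: UU_iff_BB conj_by_def BB_mult)
qed

lemma conj_by_BB: "b \<in> BB \<Longrightarrow> conj_by b ` BB = BB"
proof -
  assume b: "b \<in> BB"
  then have "conj_by b x \<in> BB" "conj_by (matrix_inv b) x \<in> BB" if "x \<in> BB" for x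
    using that by (auto simp: conj_by_def BB_mult BB_inverse)
  then show ?thesis
    using b by (auto simp: mem_conj_by_image BB_subset_GG)
qed

lemma conj_by_image_comp: "g \<in> GG \<Longrightarrow> h \<in> GG \<Longrightarrow> conj_by g ` conj_by h ` A = conj_by (g ** h) ` A"
  by (simp add: image_image conj_by_conj_by)

section \<open>Unipotent elements and the unipotent radical\<close>

lemma mpow_0 [simp]: "mpow X 0 = mat 1" and mpow_Suc: "mpow X (Suc k) = X ** mpow X k"
  by (simp_all add: mpow_def)

lemma conj_by_mpow: "g \<in> GG \<Longrightarrow> mpow (conj_by g X) k = conj_by g (mpow X k)"
  by (induction k) (simp_all add: mpow_Suc conj_by_one conj_by_mult)

lemma unipotent_conj_by: "g \<in> GG \<Longrightarrow> unipotent (conj_by g u) \<longleftrightarrow> unipotent u"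
proof -
  assume g: "g \<in> GG"
  have "conj_by g u - mat 1 = conj_by g (u - mat 1)"
    by (simp add: linear_diff[OF linear_conj_by] conj_by_one[OF g])
  moreover have "conj_by g x = 0 \<longleftrightarrow> x = 0" for x
    using conj_by_eq_iff[OF g, of x 0] linear_0[OF linear_conj_by[of g]] by simp
  ultimately show ?thesis by (simp add: unipotent_def conj_by_mpow[OF g])
qed

lemma mpow_upper:
  fixes X :: "'n::{finite,linorder} mat"
  assumes "\<And>i j. j < i \<Longrightarrow> X $ i $ j = 0"
  shows "(\<forall>i j. j < i \<longrightarrow> mpow X k $ i $ j = 0) \<and> (\<forall>i. mpow X k $ i $ i = (X $ i $ i) ^ k)"
  by (induction k) (auto simp: mpow_Suc mat_def assms upper_mult_component)

lemma unipotent_BB_iff: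
  assumes "b \<in> BB"
  shows "unipotent b \<longleftrightarrow> b \<in> UU"
proof
  assume "unipotent b"
  then obtain k where k: "mpow (b - mat 1) k = 0" by (auto simp: unipotent_def)
  have "\<And>i j. j < i \<Longrightarrow> (b - mat 1) $ i $ j = 0" using assms by (auto simp: BB_def mat_def)
  from mpow_upper[OF this, of k] have "((b - mat 1) $ i $ i) ^ k = 0" for i using k by (metis zero_index)
  then show "b \<in> UU" using assms by (auto simp: UU_iff_BB mat_def)
next
  assume u: "b \<in> UU"
  define X where "X = b - mat 1"
  have X: "X $ i $ j \<noteq> 0 \<Longrightarrow> i < j" for i j
    using u by (cases i j rule: linorder_cases) (auto simp: X_def UU_def mat_def split: if_splits)
  \<comment> \<open>A nonzero entry at (i, j) of the k-th power requires a strictly increasing chain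
    of k steps from i to j.\<close>
  have "mpow X k $ i $ j \<noteq> 0 \<Longrightarrow> i \<le> j \<and> k \<le> card {i..<j}" for k i j
  proof (induction k arbitrary: i)
    case 0 then show ?case by (auto simp: mat_def split: if_splits)
  next
    case (Suc k)
    then obtain a where a: "X $ i $ a * mpow X k $ a $ j \<noteq> 0"
      unfolding mpow_Suc matrix_matrix_mult_def by (auto elim: sum.not_neutral_contains_not_neutral)
    then have "i < a" "a \<le> j" "k \<le> card {a..<j}" using X Suc.IH by auto
    moreover have "insert i {a..<j} \<subseteq> {i..<j}" using calculation by auto
    then have "card (insert i {a..<j}) \<le> card {i..<j}" by (intro card_mono) auto
    moreover have "a \<le> i \<longleftrightarrow> False" using calculation by auto
    ultimately show ?case by (simp add: card_insert_if)
  qed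
  moreover have "card {i..<j} < CARD('a)" for i j :: 'a
    by (intro psubset_card_mono) auto
  ultimately have "mpow X CARD('a) = 0" by (auto simp: vec_eq_iff) (metis not_less)
  then show "unipotent b" by (auto simp: unipotent_def X_def)
qed

lemma SLn_mult [simp]: "x \<otimes>\<^bsub>SLn\<^esub> y = x ** y" and SLn_one [simp]: "\<one>\<^bsub>SLn\<^esub> = mat 1"
  by (simp_all add: SLn_def)

lemma SLn_inv: "x \<in> GG \<Longrightarrow> inv\<^bsub>SLn\<^esub> x = matrix_inv x"
  by (rule group.inv_equality[OF group_SLn]) (simp_all add: GG_inverse)

lemma subgroup_SLn_iff:
  "subgroup L SLn \<longleftrightarrow> L \<subseteq> GG \<and> mat 1 \<in> L \<and> (\<forall>x\<in>L. \<forall>y\<in>L. x ** y \<in> L) \<and> (\<forall>x\<in>L. matrix_inv x \<in> L)"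
  unfolding subgroup_def by (auto simp: SLn_inv subset_iff)

lemma subgroup_conj_by:
  assumes "g \<in> GG" "subgroup L SLn"
  shows "subgroup (conj_by g ` L) SLn"
proof -
  have L: "L \<subseteq> GG" "mat 1 \<in> L" "\<And>x y. x \<in> L \<Longrightarrow> y \<in> L \<Longrightarrow> x ** y \<in> L" "\<And>x. x \<in> L \<Longrightarrow> matrix_inv x \<in> L"
    using assms(2) by (auto simp: subgroup_SLn_iff)
  have "matrix_inv (conj_by g x) = conj_by g (matrix_inv x)" if "x \<in> L" for x
    by (rule matrix_inv_unique)
      (use that L(1) assms in \<open>auto simp: conj_by_mult[symmetric] GG_inverse conj_by_one\<close>)
  moreover have "conj_by g x \<in> GG" if "x \<in> L" for x using conj_by_in_GG_iff[OF assms(1)] L(1) that by auto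
  ultimately show ?thesis
    using L assms by (auto simp: subgroup_SLn_iff conj_by_mult[symmetric] intro!: image_eqI[of "mat 1" _ "mat 1"] simp: conj_by_one)
qed

lemma subgroup_BB: "subgroup BB SLn" and subgroup_UU: "subgroup UU SLn"
  by (auto simp: subgroup_SLn_iff BB_mult BB_inverse mat1_in_BB BB_subset_GG
      UU_mult UU_inverse mat1_in_UU UU_subset_GG)

lemma minimal_parabolic_iff: "minimal_parabolic P \<longleftrightarrow> (\<exists>g\<in>GG. P = conj_by g ` BB)"
  by (simp add: minimal_parabolic_def BB_def)

lemma normal_UU:
  assumes g: "g \<in> GG"
  shows "conj_by g ` UU \<lhd> (SLn\<lparr>carrier := conj_by g ` BB\<rparr>)"
proof -
  let ?P = "conj_by g ` BB" and ?N = "conj_by g ` UU"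
  have sP: "subgroup ?P SLn" by (rule subgroup_conj_by[OF g subgroup_BB])
  have sN: "subgroup ?N SLn" by (rule subgroup_conj_by[OF g subgroup_UU])
  have NP: "?N \<subseteq> ?P" using UU_subset_BB by auto
  have grp: "group (SLn\<lparr>carrier := ?P\<rparr>)" by (rule group.subgroup_imp_group[OF group_SLn sP])
  have sub: "subgroup ?N (SLn\<lparr>carrier := ?P\<rparr>)"
    by (rule group.subgroup_incl[OF group_SLn sN sP NP])
  have "x ** h ** inv\<^bsub>SLn\<lparr>carrier := ?P\<rparr>\<^esub> x \<in> ?N" if x: "x \<in> ?P" and h: "h \<in> ?N" for x h
  proof -
    have "inv\<^bsub>SLn\<lparr>carrier := ?P\<rparr>\<^esub> x = matrix_inv x"
      using group.m_inv_consistent[OF group_SLn sP x] x sP by (auto simp: SLn_inv subgroup_SLn_iff)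
    then have "x ** h ** inv\<^bsub>SLn\<lparr>carrier := ?P\<rparr>\<^esub> x = conj_by x h" by (simp add: conj_by_def)
    moreover obtain b u where bu: "b \<in> BB" "x = conj_by g b" "u \<in> UU" "h = conj_by g u" using x h by auto
    moreover have "conj_by (conj_by g b) (conj_by g u) = conj_by g (conj_by b u)"
    proof -
      have b: "b \<in> GG" using bu BB_subset_GG by auto
      have "conj_by g b ** g = g ** b" by (simp add: conj_by_def GG_cancel[OF g])
      then show ?thesis
        using g b by (simp add: conj_by_conj_by conj_by_in_GG_iff)
    qed
    ultimately show ?thesis using UU_normal_in_BB[of b u] by auto
  qed
  then show ?thesis
    unfolding group.normal_inv_iff[OF grp] using sub by simp
qed

lemma connected_UU: "connected (UU :: 'n::{finite,linorder} mat set)"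
proof -
  have "convex (UU :: 'n mat set)"
    by (auto simp: convex_def UU_def)
  then show ?thesis by (rule convex_connected)
qed

text \<open>A unipotent upper triangular matrix has unit diagonal, so every subgroup in the union
  lies in the conjugate of \<open>UU\<close>; and that conjugate is itself a member of the
  union.\<close>

lemma unip_radical_conj_BB:
  assumes g: "g \<in> GG"
  shows "unip_radical (conj_by g ` BB) = conj_by g ` UU"
proof
  show "unip_radical (conj_by g ` BB) \<subseteq> conj_by g ` UU"
  proof
    fix u assume "u \<in> unip_radical (conj_by g ` BB)"
    then obtain U where U: "U \<lhd> (SLn\<lparr>carrier := conj_by g ` BB\<rparr>)" "u \<in> U" "unipotent u"
      by (auto simp: unip_radical_def)
    then have "U \<subseteq> conj_by g ` BB" using subgroup.subset[OF normal_imp_subgroup] by fastforce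
    with U obtain b where "b \<in> BB" "u = conj_by g b" by auto
    with U g show "u \<in> conj_by g ` UU" by (auto simp: unipotent_conj_by unipotent_BB_iff)
  qed
  have "connected (conj_by g ` UU)"
    by (intro connected_continuous_image continuous_on_conj_by connected_UU)
  moreover have "unipotent u" if "u \<in> conj_by g ` UU" for u
    using that g by (auto simp: unipotent_conj_by unipotent_BB_iff UU_subset_BB)
  ultimately show "conj_by g ` UU \<subseteq> unip_radical (conj_by g ` BB)"
    using normal_UU[OF g] by (auto simp: unip_radical_def)
qed

section \<open>Matrix exponential and Lie algebras\<close>

lemma matrix_mult_norm_bound:
  obtains C where "C > 0" "\<And>(A::real^'n^'n) (B::real^'n^'n). norm (A ** B) \<le> C * norm A * norm B"
proof -
  have "bilinear ((**) :: real^'n^'n \<Rightarrow> real^'n^'n \<Rightarrow> real^'n^'n)"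
    unfolding bilinear_def by (auto intro: linear_matrix_mult_left linear_matrix_mult_right)
  from bilinear_bounded_pos[OF this] show ?thesis using that by blast
qed

lemma summable_mexp:
  "summable (\<lambda>k. mpow X k /\<^sub>R fact k)" for X :: "real^'n^'n"
proof -
  obtain C where C: "C > 0" "\<And>(A::real^'n^'n) (B::real^'n^'n). norm (A ** B) \<le> C * norm A * norm B"
    using matrix_mult_norm_bound by blast
  have bound: "norm (mpow X k) \<le> norm (mat 1 :: real^'n^'n) * (C * norm X) ^ k" for k
  proof (induction k)
    case (Suc k)
    have "norm (mpow X (Suc k)) \<le> C * norm X * norm (mpow X k)" unfolding mpow_Suc by (rule C(2))
    also have "\<dots> \<le> C * norm X * (norm (mat 1 :: real^'n^'n) * (C * norm X) ^ k)"
      using C Suc by (intro mult_left_mono) auto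
    finally show ?case by (simp add: mult_ac)
  qed simp
  have "summable (\<lambda>k. norm (mat 1 :: real^'n^'n) * (inverse (fact k) * (C * norm X) ^ k))"
    by (intro summable_mult summable_exp)
  then show ?thesis
  proof (rule summable_comparison_test'[where N = 0], goal_cases)
    case (1 k)
    have "norm (mpow X k /\<^sub>R fact k) = inverse (fact k) * norm (mpow X k)" by simp
    also have "\<dots> \<le> inverse (fact k) * (norm (mat 1 :: real^'n^'n) * (C * norm X) ^ k)"
      by (intro mult_left_mono bound) simp
    finally show ?case by (simp add: mult_ac)
  qed
qed

lemma linear_mexp_sums:
  fixes f :: "real^'n^'n \<Rightarrow> 'b::real_normed_vector"
  assumes "linear f"
  shows "(\<lambda>k. f (mpow X k) /\<^sub>R fact k) sums f (mexp X)"
proof -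
  have bl: "bounded_linear f" using assms linear_conv_bounded_linear by blast
  have "(\<lambda>k. f (mpow X k /\<^sub>R fact k)) sums f (mexp X)"
    unfolding mexp_def by (intro bounded_linear.sums[OF bl] summable_sums summable_mexp)
  then show ?thesis by (simp add: linear_scale[OF assms])
qed

lemma linear_mexp_zero:
  fixes f :: "real^'n^'n \<Rightarrow> 'b::real_normed_vector"
  assumes "linear f" "\<And>k. f (mpow X k) = 0"
  shows "f (mexp X) = 0"
proof -
  have "(\<lambda>k. 0) sums f (mexp X)" using linear_mexp_sums[OF assms(1), of X] by (simp add: assms(2))
  then show ?thesis by (rule sums_unique2) (rule sums_zero)
qed

lemma linear_component: "linear (\<lambda>X::real^'n^'m. X $ i $ j)"
  by (rule linearI) simp_all

lemma mpow_scale: "mpow (t *\<^sub>R X) k = t ^ k *\<^sub>R mpow X k" for X :: "real^'n^'n"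
  by (induction k) (simp_all add: mpow_Suc linear_scale[OF linear_matrix_mult_left] linear_scale[OF linear_matrix_mult_right])

lemma mexp_conj_by: "g \<in> GG \<Longrightarrow> mexp (conj_by g X) = conj_by g (mexp X)"
proof -
  assume g: "g \<in> GG"
  have "(\<lambda>k. conj_by g (mpow X k) /\<^sub>R fact k) sums conj_by g (mexp X)"
    by (rule linear_mexp_sums[OF linear_conj_by])
  then show ?thesis unfolding mexp_def conj_by_mpow[OF g] by (rule sums_unique[symmetric])
qed

text \<open>The first order coefficient in t is f X. The constant is arbitrary so that conditions
  such as a diagonal entry being 1 on the group turn into linear conditions on the Lie
  algebra.\<close>

lemma mexp_constant_imp_zero:
  fixes f :: "real^'n^'n \<Rightarrow> real"
  assumes f: "linear f" and c: "\<And>t. f (mexp (t *\<^sub>R X)) = c"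
  shows "f X = 0"
proof -
  define a where "a k = f (mpow X k) / fact k" for k
  have sums: "(\<lambda>k. a k * t ^ k) sums c" for t
    using linear_mexp_sums[OF f, of "t *\<^sub>R X"] unfolding mpow_scale linear_scale[OF f] c a_def
    by (simp add: field_simps)
  have "((\<lambda>x. \<Sum>k. a k * x ^ k) has_field_derivative (\<Sum>k. diffs a k * 0 ^ k)) (at 0)"
    by (rule termdiffs_strong_converges_everywhere) (use sums in \<open>auto simp: sums_iff\<close>)
  moreover have "(\<lambda>x. \<Sum>k. a k * x ^ k) = (\<lambda>x. c)" using sums by (auto simp: sums_iff)
  ultimately have "((\<lambda>x. c) has_field_derivative diffs a 0) (at 0)" by (simp only: powser_zero)
  then have "diffs a 0 = 0" by (rule DERIV_unique[OF _ DERIV_const])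
  then show ?thesis by (simp add: diffs_def a_def mpow_Suc)
qed

lemma lie_conj_by: "g \<in> GG \<Longrightarrow> lie (conj_by g ` L) = conj_by g ` lie L"
proof -
  assume g: "g \<in> GG"
  have "conj_by (matrix_inv g) (mexp (t *\<^sub>R X)) = mexp (t *\<^sub>R conj_by (matrix_inv g) X)" for X t
    by (simp only: mexp_conj_by[OF GG_inverse(3)[OF g], symmetric] linear_scale[OF linear_conj_by])
  then have "X \<in> lie (conj_by g ` L) \<longleftrightarrow> conj_by (matrix_inv g) X \<in> lie L" for X
    by (simp only: lie_def mem_conj_by_image[OF g] mem_Collect_eq)
  then show ?thesis by (simp only: set_eq_iff mem_conj_by_image[OF g] simp_thms)
qed

lemma lie_Int: "lie (A \<inter> B) = lie A \<inter> lie B"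
  by (auto simp: lie_def)

definition commutant :: "real^'n^'n \<Rightarrow> (real^'n^'n) set" where
  "commutant R = {X. X ** R = R ** X}"

text \<open>Commuting with \<open>R\<close> is a linear condition that passes from X to all its
  powers, hence to the exponential series.\<close>

lemma lie_commutant: "lie (commutant R) = commutant R"
proof -
  let ?f = "\<lambda>X. X ** R - R ** X"
  have lin: "linear ?f" by (intro linear_compose_sub linear_matrix_mult_left linear_matrix_mult_right)
  have "?f X = 0" if "X \<in> lie (commutant R)" for X
  proof -
    have "?f X $ i $ j = 0" for i j
    proof (rule mexp_constant_imp_zero[of "\<lambda>X. ?f X $ i $ j" X 0])
      show "linear (\<lambda>X. ?f X $ i $ j)"
        using linear_compose[OF lin linear_component[of i j]] by (simp add: o_def)
    qed (use that in \<open>simp add: lie_def commutant_def\<close>)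
    then show ?thesis by (simp add: vec_eq_iff)
  qed
  moreover have "?f (mexp (t *\<^sub>R X)) = 0" if "X \<in> commutant R" for X t
  proof (rule linear_mexp_zero[OF lin])
    have "mpow X k ** R = R ** mpow X k" for k
    proof (induction k)
      case (Suc k)
      have "X ** mpow X k ** R = X ** R ** mpow X k"
        by (simp only: matrix_mul_assoc[symmetric] Suc)
      then show ?case using that by (simp add: mpow_Suc commutant_def matrix_mul_assoc)
    qed simp
    then show "?f (mpow (t *\<^sub>R X) k) = 0" for k
      by (simp add: mpow_scale linear_scale[OF linear_matrix_mult_left] linear_scale[OF linear_matrix_mult_right])
  qed
  ultimately show ?thesis
    unfolding lie_def commutant_def right_minus_eq by blast
qed

definition NN :: "'n::{finite,linorder} mat set" where
  "NN = {X. \<forall>i j. j \<le> i \<longrightarrow> X $ i $ j = 0}"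

lemma lie_UU: "lie (UU :: 'n::{finite,linorder} mat set) = NN"
proof -
  have "X $ i $ j = 0" if X: "X \<in> lie UU" and ij: "j \<le> i" for X :: "'n mat" and i j
    by (rule mexp_constant_imp_zero[OF linear_component, of X i j "if i = j then 1 else 0"])
      (use X ij in \<open>auto simp: lie_def UU_def\<close>)
  moreover have "mexp (t *\<^sub>R X) \<in> UU" if X: "X \<in> NN" for X :: "'n mat" and t
  proof -
    have "\<And>i j. j < i \<Longrightarrow> X $ i $ j = 0" "\<And>i. X $ i $ i = 0" using X by (auto simp: NN_def)
    note m = mpow_upper[OF this(1)] this(2)
    have "mexp (t *\<^sub>R X) $ i $ j = 0" if "j < i" for i j
      by (rule linear_mexp_zero[OF linear_component]) (use m that in \<open>simp add: mpow_scale\<close>)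
    moreover have "mexp (t *\<^sub>R X) $ i $ i = 1" for i
    proof -
      have "(\<lambda>k. (0::real) ^ k /\<^sub>R fact k) sums mexp (t *\<^sub>R X) $ i $ i"
        using linear_mexp_sums[OF linear_component, of "t *\<^sub>R X" i i] m
        by (simp add: mpow_scale power_mult_distrib[symmetric])
      then show ?thesis using exp_converges[of "0::real"] by (metis exp_zero sums_unique2)
    qed
    ultimately show ?thesis by (simp add: UU_def)
  qed
  ultimately show ?thesis by (auto simp: NN_def lie_def)
qed

section \<open>Diagonal matrices and the group A\<close>

definition diag :: "real^'n \<Rightarrow> real^'n^'n" where
  "diag x = (\<chi> i j. if i = j then x $ i else 0)"

lemma diag_component: "diag x $ i $ j = (if i = j then x $ i else 0)"
  by (simp add: diag_def)

lemma diag_mult: "(diag x ** A) $ i $ j = x $ i * A $ i $ j" "(A ** diag x) $ i $ j = A $ i $ j * x $ j"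
  by (simp_all add: matrix_matrix_mult_def diag_def if_distrib[of "\<lambda>z. z * _"] if_distrib[of "\<lambda>z. _ * z"] cong: if_cong)

lemma diag_mult_diag: "diag x ** diag y = diag (\<chi> i. x $ i * y $ i)"
  by (simp add: vec_eq_iff diag_mult) (simp add: diag_component)

lemma mpow_diag: "mpow (diag x) k = diag (\<chi> i. x $ i ^ k)"
  by (induction k) (simp_all add: mpow_Suc diag_mult_diag, simp add: diag_def mat_def vec_eq_iff)

lemma mexp_diag: "mexp (diag x) = diag (\<chi> i. exp (x $ i))"
proof -
  have "mexp (diag x) $ i $ j = diag (\<chi> i. exp (x $ i)) $ i $ j" for i j
  proof (cases "i = j")
    case True
    have "(\<lambda>k. x $ i ^ k /\<^sub>R fact k) sums mexp (diag x) $ i $ j"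
      using linear_mexp_sums[OF linear_component, of "diag x" i j] True by (simp add: mpow_diag diag_component)
    then show ?thesis using exp_converges[of "x $ i"] True by (simp add: diag_component sums_unique2)
  next
    case False
    then show ?thesis
      using linear_mexp_zero[OF linear_component, of "diag x" i j] by (simp add: mpow_diag diag_component)
  qed
  then show ?thesis by (simp add: vec_eq_iff)
qed

lemma diag_eq_iff: "diag x = diag y \<longleftrightarrow> x = y"
  by (auto simp: diag_def vec_eq_iff)

lemma linear_diag: "linear diag"
  by (rule linearI) (simp_all add: diag_def vec_eq_iff)

lemma det_diag: "det (diag x) = (\<Prod>i\<in>UNIV. x $ i)"
  by (subst det_diagonal) (simp_all add: diag_component)

lemma diagI: "(\<And>i j. i \<noteq> j \<Longrightarrow> A $ i $ j = 0) \<Longrightarrow> A = diag (\<chi> i. A $ i $ i)"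
  by (simp add: vec_eq_iff diag_component)

text \<open>The Iwasawa group A, written as the image of its Lie algebra \<open>aa\<close> under the
  exponential map, from which connectedness can be read off.\<close>

definition DP :: "(real^'n^'n) set" where
  "DP = {diag (\<chi> i. exp (x $ i)) | x. sum (($) x) UNIV = 0}"

definition aa :: "(real^'n^'n) set" where
  "aa = {diag x | x. sum (($) x) UNIV = 0}"

lemma lie_DP: "lie (DP :: (real^'n^'n) set) = aa"
proof -
  have "X \<in> aa" if X: "X \<in> lie DP" for X :: "real^'n^'n"
  proof -
    have "mexp (t *\<^sub>R X) $ i $ j = 0" if "i \<noteq> j" for i j t
    proof -
      have "mexp (t *\<^sub>R X) \<in> DP" using X by (simp add: lie_def)
      then show ?thesis using that by (auto simp: DP_def diag_component)
    qed
    then have "X $ i $ j = 0" if "i \<noteq> j" for i j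
      by (rule mexp_constant_imp_zero[OF linear_component, of X i j 0])
        (use that in simp)
    then obtain x where x: "X = diag x" using diagI by blast
    have "mexp X \<in> DP" using X by (auto simp: lie_def dest: spec[of _ 1])
    then obtain y where "diag (\<chi> i. exp (x $ i)) = diag (\<chi> i. exp (y $ i))" "sum (($) y) UNIV = 0"
      by (auto simp: DP_def x mexp_diag)
    then have "x = y" unfolding diag_eq_iff by (simp add: vec_eq_iff)
    then show ?thesis using x \<open>sum (($) y) UNIV = 0\<close> by (auto simp: aa_def)
  qed
  moreover have "mexp (t *\<^sub>R X) \<in> DP" if "X \<in> aa" for X :: "real^'n^'n" and t
  proof -
    obtain x where x: "X = diag x" "sum (($) x) UNIV = 0" using \<open>X \<in> aa\<close> by (auto simp: aa_def)
    then have "sum (($) (t *\<^sub>R x)) UNIV = 0" by (simp add: sum_distrib_left[symmetric])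
    moreover have "mexp (t *\<^sub>R X) = diag (\<chi> i. exp ((t *\<^sub>R x) $ i))"
      unfolding x linear_scale[OF linear_diag, symmetric] mexp_diag ..
    ultimately show ?thesis unfolding DP_def by blast
  qed
  ultimately show ?thesis by (auto simp: lie_def)
qed

section \<open>Levi subgroups and split components\<close>

text \<open>The standard Levi subgroup MA. In contrast to \<open>DP\<close> it contains sign
  changes.\<close>

definition DD :: "(real^'n^'n) set" where
  "DD = {d \<in> GG. \<forall>i j. i \<noteq> j \<longrightarrow> d $ i $ j = 0}"

lemma DD_eq_diag: "d \<in> DD \<Longrightarrow> d = diag (\<chi> i. d $ i $ i)"
  by (rule diagI) (simp add: DD_def)

lemma DD_subset_BB: "d \<in> DD \<Longrightarrow> d \<in> BB"
  by (auto simp: DD_def BB_def)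

lemma DD_subset_GG: "d \<in> DD \<Longrightarrow> d \<in> GG"
  by (simp add: DD_def)

lemma diag_commute: "diag x ** diag y = diag y ** diag x"
  by (simp add: diag_mult_diag mult.commute)

lemma subgroup_DD: "subgroup (DD :: (real^'n^'n) set) SLn"
proof -
  have "x ** y \<in> DD" if xy: "x \<in> DD" "y \<in> DD" for x y :: "real^'n^'n"
  proof -
    obtain p q where pq: "x = diag p" "y = diag q" using DD_eq_diag[OF xy(1)] DD_eq_diag[OF xy(2)] by blast
    have "(x ** y) $ i $ j = 0" if "i \<noteq> j" for i j
      unfolding pq diag_mult(1) using that by (simp add: diag_component)
    then show ?thesis using xy by (simp add: DD_def mult_in_GG)
  qed
  moreover have "matrix_inv x \<in> DD" if x: "x \<in> DD" for x :: "real^'n^'n"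
  proof -
    have g: "x \<in> GG" using x by (simp add: DD_def)
    obtain p where p: "x = diag p" using DD_eq_diag[OF x] by blast
    have pm: "p $ i * matrix_inv x $ i $ j = (if i = j then 1 else 0)" for i j
    proof -
      have "(diag p ** matrix_inv x) $ i $ j = (if i = j then 1 else 0)"
        using GG_inverse(1)[OF g] by (simp add: p[symmetric] mat_def)
      then show ?thesis by (simp add: diag_mult)
    qed
    have "p $ i \<noteq> 0" for i using pm[of i i] by auto
    then have "matrix_inv x $ i $ j = 0" if "i \<noteq> j" for i j
      using that pm[of i j] by simp
    then show ?thesis using g by (simp add: DD_def GG_inverse)
  qed
  ultimately show ?thesis
    by (auto simp: subgroup_SLn_iff DD_subset_GG) (simp add: DD_def mat1_in_GG, simp add: mat_def)
qed

lemma DP_iff: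
  "d \<in> DP \<longleftrightarrow> d \<in> DD \<and> (\<forall>i. d $ i $ i > 0)"
proof
  assume "d \<in> DP"
  then obtain x where x: "d = diag (\<chi> i. exp (x $ i))" "sum (($) x) UNIV = 0" by (auto simp: DP_def)
  then have "det d = 1" by (simp add: det_diag exp_sum[symmetric])
  with x show "d \<in> DD \<and> (\<forall>i. d $ i $ i > 0)" by (auto simp: DD_def GG_iff diag_component)
next
  assume d: "d \<in> DD \<and> (\<forall>i. d $ i $ i > 0)"
  define x where "x = (\<chi> i. ln (d $ i $ i))"
  have dx: "d = diag (\<chi> i. exp (x $ i))" using d DD_eq_diag[of d] by (simp add: x_def)
  have "exp (sum (($) x) UNIV) = det d" unfolding dx by (simp add: det_diag exp_sum)
  then have "sum (($) x) UNIV = 0" using d by (simp add: DD_def GG_iff)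
  with dx show "d \<in> DP" by (auto simp: DP_def)
qed

lemma subgroup_DP: "subgroup (DP :: (real^'n^'n) set) SLn"
proof -
  have s: "subgroup (DD :: (real^'n^'n) set) SLn" by (rule subgroup_DD)
  have "x ** y \<in> DP" if "x \<in> DP" "y \<in> DP" for x y :: "real^'n^'n"
  proof -
    have "(x ** y) $ i $ i = x $ i $ i * y $ i $ i" for i
      using that DD_eq_diag[of x] diag_mult(1)[of "\<chi> i. x $ i $ i" y i i] by (simp add: DP_iff)
    then show ?thesis using that s by (auto simp: DP_iff subgroup_SLn_iff)
  qed
  moreover have "matrix_inv x \<in> DP" if "x \<in> DP" for x :: "real^'n^'n"
  proof -
    have "(x ** matrix_inv x) $ i $ i = x $ i $ i * matrix_inv x $ i $ i" for i
      using that DD_eq_diag[of x] diag_mult(1)[of "\<chi> i. x $ i $ i" "matrix_inv x" i i] by (simp add: DP_iff)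
    moreover have "x ** matrix_inv x = mat 1" using that by (simp add: DP_iff DD_def GG_inverse)
    ultimately have "x $ i $ i * matrix_inv x $ i $ i > 0" for i by (simp add: mat_def)
    then show ?thesis using that s by (auto simp: DP_iff subgroup_SLn_iff zero_less_mult_iff) 
        (metis less_asym)
  qed
  ultimately show ?thesis
    using s by (auto simp: subgroup_SLn_iff DP_iff) (simp add: mat_def)
qed

lemma connected_DP: "connected (DP :: (real^'n^'n) set)"
proof -
  let ?V = "{x::real^'n. sum (($) x) UNIV = 0}"
  have "convex ?V"
    by (auto simp: convex_def sum.distrib sum_distrib_left[symmetric])
  moreover have "continuous_on ?V (\<lambda>x. diag (\<chi> i. exp (x $ i)))"
    by (intro continuous_on_compose2[OF linear_continuous_on[OF linear_diag[unfolded linear_conv_bounded_linear], of UNIV]])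
      (auto intro!: continuous_intros)
  moreover have "DP = (\<lambda>x. diag (\<chi> i. exp (x $ i))) ` ?V" by (auto simp: DP_def)
  ultimately show ?thesis by (metis connected_continuous_image convex_connected)
qed

section \<open>Regular diagonal elements and complements of the unipotent radical\<close>

lemma regular_element:
  obtains d :: "'n::{finite,linorder} mat" where "d \<in> DP" "\<And>i j. d $ i $ i = d $ j $ j \<Longrightarrow> i = j"
proof -
  \<comment> \<open>Strictly increasing exponents, shifted by their mean to have sum 0. Distinct
    eigenvalues force every matrix commuting with the element to be diagonal.\<close>
  define c where "c i = real (card {j. j < i})" for i :: 'n
  define x where "x = (\<chi> i. c i - sum c UNIV / CARD('n))"
  have "sum (($) x) UNIV = 0" by (simp add: x_def sum_subtractf)
  then have "diag (\<chi> i. exp (x $ i)) \<in> DP" by (auto simp: DP_def)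
  moreover have "c i < c j" if "i < j" for i j :: 'n
    unfolding c_def using that by (auto intro!: psubset_card_mono)
  then have "c i = c j \<Longrightarrow> i = j" for i j by (metis less_irrefl linorder_neqE)
  then have "diag (\<chi> i. exp (x $ i)) $ i $ i = diag (\<chi> i. exp (x $ i)) $ j $ j \<Longrightarrow> i = j" for i j
    by (auto simp: diag_component x_def)
  ultimately show ?thesis using that by blast
qed

text \<open>Take a kernel vector of b - b_ii. The row at its last nonzero index M gives (b_MM -
  b_ii) x_M = 0, and distinctness of the diagonal entries yields M = i.\<close>

lemma triangular_eigenvector:
  fixes b :: "'n::{finite,linorder} mat"
  assumes up: "\<And>i j. j < i \<Longrightarrow> b $ i $ j = 0" and dist: "\<And>i j. b $ i $ i = b $ j $ j \<Longrightarrow> i = j"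
  shows "\<exists>x. x $ i = 1 \<and> (\<forall>a>i. x $ a = 0) \<and> b *v x = b $ i $ i *\<^sub>R x"
proof -
  let ?A = "b - b $ i $ i *\<^sub>R mat 1"
  have upA: "\<And>k j. j < k \<Longrightarrow> ?A $ k $ j = 0" using up by (simp add: mat_def)
  have "det ?A = 0"
    using det_upper_triangular[of ?A] upA prod_zero[of UNIV "\<lambda>k. ?A $ k $ k"] by (auto simp: mat_def)
  then obtain x where x: "x \<noteq> 0" "?A *v x = 0"
    by (metis invertible_det_nz invertible_left_inverse matrix_left_invertible_ker)
  let ?M = "{a. x $ a \<noteq> 0}"
  have "?M \<noteq> {}" using x by (auto simp: vec_eq_iff)
  then have m: "Max ?M \<in> ?M" "\<And>a. x $ a \<noteq> 0 \<Longrightarrow> a \<le> Max ?M"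
    using Max_in[of ?M] by auto
  have "(?A *v x) $ Max ?M = (\<Sum>j\<in>UNIV. ?A $ Max ?M $ j * x $ j)" by (simp add: matrix_vector_mult_def)
  also have "\<dots> = (\<Sum>j\<in>{Max ?M}. ?A $ Max ?M $ j * x $ j)"
  proof (rule sum.mono_neutral_right)
    show "\<forall>j\<in>UNIV - {Max ?M}. ?A $ Max ?M $ j * x $ j = 0"
      using m(2) upA by (metis Diff_iff insertI1 mult_eq_0_iff order_le_imp_less_or_eq linorder_neqE not_less)
  qed auto
  finally have "(b $ Max ?M $ Max ?M - b $ i $ i) * x $ Max ?M = 0" using x(2) by (simp add: mat_def)
  then have mi: "Max ?M = i" using m(1) dist by auto
  have "b *v x = b $ i $ i *\<^sub>R x"
    using x(2) by (simp add: matrix_vector_mult_diff_rdistrib scaleR_matrix_vector_assoc[symmetric])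
  moreover have "x $ i \<noteq> 0" using m(1) mi by simp
  moreover have "x $ a = 0" if "a > i" for a using m(2)[of a] mi that by (metis leD)
  ultimately show ?thesis
    by (intro exI[of _ "(1 / x $ i) *\<^sub>R x"]) (simp add: matrix_vector_mult_scaleR)
qed

lemma triangular_diagonalizable:
  fixes b :: "'n::{finite,linorder} mat"
  assumes up: "\<And>i j. j < i \<Longrightarrow> b $ i $ j = 0" and dist: "\<And>i j. b $ i $ i = b $ j $ j \<Longrightarrow> i = j"
  shows "\<exists>u\<in>UU. b ** u = u ** diag (\<chi> i. b $ i $ i)"
proof -
  obtain x where x: "\<And>i. x i $ i = 1" "\<And>i a. a > i \<Longrightarrow> x i $ a = 0" "\<And>i. b *v x i = b $ i $ i *\<^sub>R x i"
    using triangular_eigenvector[OF assms] by metis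
  define u where "u = (\<chi> a i. x i $ a)"
  have "(b ** u) $ a $ i = (b *v x i) $ a" for a i
    by (simp add: u_def matrix_matrix_mult_def matrix_vector_mult_def)
  then have "b ** u = u ** diag (\<chi> i. b $ i $ i)"
    by (simp add: vec_eq_iff diag_mult x(3)) (simp add: u_def)
  moreover have "u \<in> UU" using x by (simp add: UU_def u_def)
  ultimately show ?thesis by blast
qed

lemma commutes_with_regular:
  assumes "y ** diag d = diag d ** y" "\<And>i j. d $ i = d $ j \<Longrightarrow> i = j" "i \<noteq> j"
  shows "y $ i $ j = 0"
proof -
  have "y $ i $ j * d $ j = d $ i * y $ i $ j" using assms(1) by (metis diag_mult)
  then show ?thesis using assms(2,3) by (metis mult.commute mult_left_cancel)
qed

text \<open>Two elements of \<open>L\<close> with the same diagonal differ by an element of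
  \<open>L \<inter> UU\<close>, so \<open>L\<close> embeds into the diagonal group and is
  commutative. The lift to \<open>L\<close> of a regular diagonal element is diagonalised by some
  \<open>w\<close> in \<open>UU\<close>; conjugation by the inverse of \<open>w\<close> makes all of
  \<open>L\<close> diagonal, since \<open>L\<close> commutes with the lift, and it fills
  \<open>DD\<close> because all diagonals occur.\<close>

lemma complement_of_UU:
  assumes L: "subgroup L SLn" "L \<subseteq> BB" "L \<inter> UU = {mat 1}"
    and BB: "\<And>b. b \<in> BB \<Longrightarrow> \<exists>l\<in>L. \<exists>u\<in>UU. b = l ** u"
  shows "\<exists>w\<in>UU. L = conj_by w ` DD"
proof -
  have sub: "L \<subseteq> GG" "\<And>x y. x \<in> L \<Longrightarrow> y \<in> L \<Longrightarrow> x ** y \<in> L" "\<And>x. x \<in> L \<Longrightarrow> matrix_inv x \<in> L"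
    using L(1) by (auto simp: subgroup_SLn_iff)
  have up: "\<And>i j. j < i \<Longrightarrow> x $ i $ j = 0" if "x \<in> BB" for x using that by (auto simp: BB_def)
  have inj: "x = y" if xy: "x \<in> L" "y \<in> L" "\<And>i. x $ i $ i = y $ i $ i" for x y
  proof -
    have B: "x \<in> BB" "y \<in> BB" "matrix_inv y \<in> BB" using xy L(2) BB_inverse by auto
    have "(matrix_inv y ** x) $ i $ i = matrix_inv y $ i $ i * x $ i $ i" for i
      by (rule upper_mult_component(2)) (use B up in blast)+
    also have "\<dots> i = 1" for i using BB_diag_inverse(1)[OF B(2), of i] xy(3)[of i] by (simp add: mult.commute)
    finally have "matrix_inv y ** x \<in> UU" using B by (simp add: UU_iff_BB BB_mult)
    then have "matrix_inv y ** x = mat 1" using L(3) sub xy by auto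
    then show "x = y" using GG_cancel(1)[of y x] xy(2) sub(1) by auto
  qed
  have comm: "x ** y = y ** x" if "x \<in> L" "y \<in> L" for x y
  proof (rule inj)
    show "(x ** y) $ i $ i = (y ** x) $ i $ i" for i
      using that L(2) by (simp add: upper_mult_component(2) up subset_iff)
  qed (use sub that in auto)
  obtain d0 :: "'a mat" where d0: "d0 \<in> DP" "\<And>i j. d0 $ i $ i = d0 $ j $ j \<Longrightarrow> i = j"
    using regular_element by blast
  have diagmult: "(l ** u) $ i $ i = l $ i $ i" if "l \<in> L" "u \<in> UU" for l u i
    using that L(2) by (subst upper_mult_component(2)) (auto simp: up UU_def subset_iff)
  have "d0 \<in> BB" using d0(1) by (simp add: DP_iff DD_subset_BB)
  then obtain l where l: "l \<in> L" "\<And>i. l $ i $ i = d0 $ i $ i" using BB diagmult by metis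
  have distl: "\<And>i j. l $ i $ i = l $ j $ j \<Longrightarrow> i = j" using d0(2) l(2) by simp
  have lB: "l \<in> BB" using l L(2) by auto
  from triangular_diagonalizable[OF up[OF lB] distl]
  obtain w where w: "w \<in> UU" "l ** w = w ** diag (\<chi> i. l $ i $ i)" by blast
  let ?c = "conj_by (matrix_inv w)"
  have wG: "w \<in> GG" "matrix_inv w \<in> GG" using w UU_subset_GG GG_inverse by auto
  have cl: "?c l = diag (\<chi> i. l $ i $ i)"
    using w(2) wG by (metis GG_cancel(2) conj_by_def matrix_inv_GG_inv matrix_mul_assoc)
  have cdiag: "?c x \<in> DD" if x: "x \<in> L" for x
  proof -
    have "?c x ** ?c l = ?c l ** ?c x" using comm[OF x l(1)] wG by (simp add: conj_by_mult[symmetric])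
    then have "?c x $ i $ j = 0" if "i \<noteq> j" for i j
      unfolding cl by (rule commutes_with_regular) (use that distl in auto)
    moreover have "?c x \<in> GG" using x sub wG by (auto simp: conj_by_in_GG_iff)
    ultimately show ?thesis by (simp add: DD_def)
  qed
  have cc: "(?c x) $ i $ i = x $ i $ i" if x: "x \<in> L" for x i
  proof -
    have xB: "x \<in> BB" using x L(2) by auto
    have wB: "w \<in> BB" "matrix_inv w \<in> BB" using w UU_subset_BB BB_inverse by auto
    have "(matrix_inv w ** x ** w) $ i $ i = (matrix_inv w ** x) $ i $ i * w $ i $ i"
      by (rule upper_mult_component(2)) (use wB xB BB_mult up in blast)+
    also have "(matrix_inv w ** x) $ i $ i = matrix_inv w $ i $ i * x $ i $ i"
      by (rule upper_mult_component(2)) (use wB xB BB_mult up in blast)+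
    finally show ?thesis
      using w(1) UU_inverse[OF w(1)] matrix_inv_GG_inv[OF wG(1)] by (simp add: conj_by_def UU_def)
  qed
  have "?c ` L = DD"
  proof
    show "DD \<subseteq> ?c ` L"
    proof
      fix d :: "'a mat" assume d: "d \<in> DD"
      then obtain x where x: "x \<in> L" "\<And>i. x $ i $ i = d $ i $ i" using BB[OF DD_subset_BB] diagmult by metis
      have "?c x = d"
        using DD_eq_diag[OF cdiag[OF x(1)]] DD_eq_diag[OF d] by (simp add: cc x)
      then show "d \<in> ?c ` L" using x by blast
    qed
  qed (use cdiag in auto)
  then have "conj_by w ` DD = conj_by w ` ?c ` L" by simp
  also have "\<dots> = L" using wG by (simp add: image_image conj_by_inverse)
  finally have "conj_by w ` DD = L" .
  then show ?thesis using w(1) by blast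
qed

lemma DD_diag_nonzero: "d \<in> DD \<Longrightarrow> d $ i $ i \<noteq> 0"
proof -
  assume d: "d \<in> DD"
  then obtain p where p: "d = diag p" using DD_eq_diag by blast
  have "(\<Prod>i\<in>UNIV. p $ i) = 1" using d by (simp add: p DD_def GG_iff det_diag)
  then show ?thesis using prod_zero[of UNIV "($) p"] by (auto simp: p diag_component)
qed

lemma Levi_subgroup_conj_BB:
  assumes g: "g \<in> GG" and L: "Levi_subgroup (conj_by g ` BB) L"
  shows "\<exists>h\<in>GG. conj_by h ` BB = conj_by g ` BB \<and> L = conj_by h ` DD"
proof -
  have L': "subgroup L SLn" "L \<subseteq> conj_by g ` BB" "L \<inter> conj_by g ` UU = {mat 1}"
      "L <#>\<^bsub>SLn\<^esub> conj_by g ` UU = conj_by g ` BB"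
    using L by (simp_all add: Levi_subgroup_def unip_radical_conj_BB[OF g])
  let ?c = "conj_by (matrix_inv g)"
  have g': "matrix_inv g \<in> GG" using g GG_inverse by auto
  have gc: "conj_by g ` ?c ` L = L" using g by (simp add: image_image conj_by_inverse)
  have "\<exists>w\<in>UU. ?c ` L = conj_by w ` DD"
  proof (rule complement_of_UU)
    show "subgroup (?c ` L) SLn" by (rule subgroup_conj_by[OF g' L'(1)])
    show "?c ` L \<subseteq> BB" using L'(2) mem_conj_by_image[OF g] by blast
    show "?c ` L \<inter> UU = {mat 1}"
    proof -
      have "x \<in> ?c ` L \<inter> UU \<longleftrightarrow> conj_by g x \<in> L \<inter> conj_by g ` UU" for x
        using g g' by (auto simp: mem_conj_by_image matrix_inv_GG_inv conj_by_inverse)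
      then have "x \<in> ?c ` L \<inter> UU \<longleftrightarrow> conj_by g x = conj_by g (mat 1)" for x
        using L'(3) by (simp add: conj_by_one[OF g])
      then show ?thesis by (auto simp: conj_by_eq_iff[OF g])
    qed
    show "\<exists>l\<in>?c ` L. \<exists>u\<in>UU. b = l ** u" if "b \<in> BB" for b
    proof -
      have "conj_by g b \<in> L <#>\<^bsub>SLn\<^esub> conj_by g ` UU" using that L'(4) by auto
      then obtain l u where lu: "l \<in> L" "u \<in> UU" "conj_by g b = l ** conj_by g u" by (auto simp: set_mult_def)
      then have "b = ?c (l ** conj_by g u)" using g by (metis conj_by_inverse(2))
      then have "b = ?c l ** u" using g g' by (simp add: conj_by_mult conj_by_inverse)
      then show ?thesis using lu by blast
    qed
  qed
  then obtain w where w: "w \<in> UU" "?c ` L = conj_by w ` DD" by blast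
  have wG: "w \<in> GG" using w UU_subset_GG by auto
  have "L = conj_by (g ** w) ` DD" using gc w(2) g wG by (simp add: conj_by_image_comp)
  moreover have "conj_by (g ** w) ` BB = conj_by g ` BB"
    using g wG conj_by_BB[OF UU_subset_BB[OF w(1)]] by (simp add: conj_by_image_comp[symmetric])
  ultimately show ?thesis using mult_in_GG[OF g wG] by blast
qed

lemma closed_DD: "closed (DD :: (real^'n^'n) set)"
proof -
  have "closed ({g::real^'n^'n. det g = 1} \<inter> (\<Inter>i. \<Inter>j\<in>-{i}. {g. g $ i $ j = 0}))"
    by (intro closed_Int closed_INT ballI closed_Collect_eq) (auto intro!: continuous_intros simp: det_def)
  moreover have "DD = {g::real^'n^'n. det g = 1} \<inter> (\<Inter>i. \<Inter>j\<in>-{i}. {g. g $ i $ j = 0})"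
    by (auto simp: DD_def GG_iff)
  ultimately show ?thesis by simp
qed

lemma Levi_subgroup_DD:
  fixes g :: "'n::{finite,linorder} mat"
  assumes g: "g \<in> GG"
  shows "Levi_subgroup (conj_by g ` BB) (conj_by g ` DD)"
proof -
  have "closed (conj_by g ` DD)"
  proof -
    have "conj_by g ` DD = conj_by (matrix_inv g) -` DD"
      by (simp add: set_eq_iff mem_conj_by_image[OF g])
    then show ?thesis
      using continuous_closed_vimage[OF closed_DD, of "conj_by (matrix_inv g)"] continuous_on_conj_by[of UNIV "matrix_inv g"]
      by (simp add: continuous_on_eq_continuous_at)
  qed
  moreover have "conj_by g ` DD \<inter> conj_by g ` UU = {mat 1}"
  proof -
    have "(DD :: 'n mat set) \<inter> UU = {mat 1}"
    proof -
      have "d = mat 1" if d: "d \<in> DD" "d \<in> UU" for d :: "'n mat"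
        using d by (simp add: UU_def DD_def vec_eq_iff mat_def)
      then show ?thesis using subgroup_DD subgroup_UU by (auto simp: subgroup_SLn_iff)
    qed
    then have "conj_by g ` (DD \<inter> UU) = {mat 1}" by (simp add: conj_by_one[OF g])
    then show ?thesis by (subst (asm) image_Int) (auto simp: inj_on_def conj_by_eq_iff[OF g])
  qed
  moreover have "conj_by g ` DD <#>\<^bsub>SLn\<^esub> conj_by g ` UU = conj_by g ` BB"
  proof -
    have "\<exists>d\<in>DD. \<exists>u\<in>UU. b = d ** u" if b: "b \<in> BB" for b :: "'n mat"
    proof -
      let ?d = "diag (\<chi> i. b $ i $ i)"
      have up: "\<And>i j. j < i \<Longrightarrow> b $ i $ j = 0" using b by (simp add: BB_def)
      have "det ?d = det b" using det_upper_triangular[of b] up by (simp add: det_diag)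
      then have d: "?d \<in> DD" using b by (simp add: DD_def BB_def GG_iff diag_component)
      have dB: "?d \<in> BB" "matrix_inv ?d \<in> BB" using d DD_subset_BB BB_inverse by auto
      have m: "matrix_inv ?d ** b \<in> BB" using dB b BB_mult by auto
      have "(matrix_inv ?d ** b) $ i $ i = matrix_inv ?d $ i $ i * b $ i $ i" for i
        by (rule upper_mult_component(2)) (use dB(2) up in \<open>auto simp: BB_def\<close>)
      also have "\<dots> i = 1" for i
        using BB_diag_inverse(1)[OF dB(1), of i] by (simp add: diag_component mult.commute)
      finally have "matrix_inv ?d ** b \<in> UU" using m by (simp add: UU_iff_BB)
      moreover have "b = ?d ** (matrix_inv ?d ** b)" using d by (simp add: GG_cancel DD_def)
      ultimately show ?thesis using d by blast
    qed
    moreover have "d ** u \<in> BB" if "d \<in> DD" "u \<in> UU" for d u :: "'n mat"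
      using that by (simp add: BB_mult DD_subset_BB UU_subset_BB)
    ultimately have BBeq: "BB = (\<Union>d\<in>DD. \<Union>u\<in>UU. {d ** u :: 'n mat})" by blast
    show ?thesis
      unfolding BBeq by (simp add: set_mult_def image_UN conj_by_mult[OF g])
  qed
  moreover have "conj_by g ` DD \<subseteq> conj_by g ` BB" using DD_subset_BB by auto
  ultimately show ?thesis
    using subgroup_conj_by[OF g subgroup_DD] by (simp add: Levi_subgroup_def unip_radical_conj_BB[OF g])
qed

lemma center_conj_DD:
  assumes g: "g \<in> GG"
  shows "center (conj_by g ` DD) = conj_by g ` DD"
proof -
  have "x ** y = y ** x" if "x \<in> DD" "y \<in> DD" for x y :: "real^'a^'a"
    using DD_eq_diag[OF that(1)] DD_eq_diag[OF that(2)] diag_commute by metis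
  then show ?thesis by (auto simp: center_def conj_by_mult[OF g, symmetric])
qed

lemma connected_split_subgroup_conj_DP:
  fixes g :: "real^'n^'n"
  assumes g: "g \<in> GG"
  shows "connected_split_subgroup (conj_by g ` DP)"
  unfolding connected_split_subgroup_def
proof (intro conjI exI[of _ "matrix_inv g"] ballI allI impI)
  show "invertible (matrix_inv g)" using GG_inverse[OF g] by (auto simp: invertible_def)
  show "connected (conj_by g ` DP)"
    by (intro connected_continuous_image continuous_on_conj_by connected_DP)
  show "subgroup (conj_by g ` DP) SLn" by (rule subgroup_conj_by[OF g subgroup_DP])
  show "conj_by (matrix_inv g) a $ i $ j = 0" if "a \<in> conj_by g ` DP" "i \<noteq> j" for a i j
    using that g by (auto simp: mem_conj_by_image DP_iff DD_def)
qed

text \<open>The diagonal entries are continuous, never 0, and equal to 1 at the identity, so on a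
  connected group they stay positive.\<close>

lemma connected_split_subset_DP:
  fixes g :: "real^'n^'n"
  assumes g: "g \<in> GG" and A: "connected_split_subgroup A" "A \<subseteq> conj_by g ` DD"
  shows "A \<subseteq> conj_by g ` DP"
proof
  fix x assume x: "x \<in> A"
  let ?f = "\<lambda>i x. conj_by (matrix_inv g) x $ i $ i"
  have one: "mat 1 \<in> A" and con: "connected A" using A by (auto simp: connected_split_subgroup_def subgroup_SLn_iff)
  have "?f i x > 0" for i
  proof (rule ccontr)
    assume "\<not> ?f i x > 0"
    moreover have "?f i (mat 1) = 1" using conj_by_one[OF GG_inverse(3)[OF g]] by (simp add: mat_def)
    moreover have "connected (?f i ` A)"
      by (intro connected_continuous_image con continuous_on_component continuous_on_conj_by)
    ultimately have "0 \<in> ?f i ` A"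
      using connectedD_interval[of "?f i ` A" "?f i x" "?f i (mat 1)" 0] x one by auto
    then obtain y where y: "y \<in> A" "?f i y = 0" by auto
    with A(2) have "conj_by (matrix_inv g) y \<in> DD" using mem_conj_by_image[OF g] by blast
    then show False using DD_diag_nonzero y(2) by blast
  qed
  then show "x \<in> conj_by g ` DP" using x A(2) unfolding mem_conj_by_image[OF g] DP_iff
    using mem_conj_by_image[OF g] by blast
qed

lemma conj_DP_subset_DD: "conj_by g ` DP \<subseteq> conj_by g ` DD"
  by (auto simp: DP_iff)

text \<open>The component sits in the positive part of the center of its Levi subgroup, and that
  positive part is itself connected and split, so maximality gives equality. Hence every split
  component is \<open>DP\<close> in a suitable basis adapted to the same parabolic.\<close>

lemma split_component_conj_BB:
  assumes g: "g \<in> GG" and A: "split_component (conj_by g ` BB) A"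
  shows "\<exists>h\<in>GG. conj_by h ` BB = conj_by g ` BB \<and> A = conj_by h ` DP"
proof -
  obtain L where L: "Levi_subgroup (conj_by g ` BB) L" "A \<subseteq> center L" "connected_split_subgroup A"
     "\<And>A'. A' \<subseteq> center L \<Longrightarrow> connected_split_subgroup A' \<Longrightarrow> A \<subseteq> A' \<Longrightarrow> A' = A"
    using A by (auto simp: split_component_def)
  from Levi_subgroup_conj_BB[OF g L(1)] obtain h where h: "h \<in> GG" "conj_by h ` BB = conj_by g ` BB" "L = conj_by h ` DD" by auto
  have "A \<subseteq> conj_by h ` DP"
    using connected_split_subset_DP[OF h(1) L(3)] L(2) by (simp add: h(3) center_conj_DD[OF h(1)])
  moreover have "conj_by h ` DP \<subseteq> center L"
    using h by (simp add: center_conj_DD conj_DP_subset_DD)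
  ultimately have "conj_by h ` DP = A" using L(4) connected_split_subgroup_conj_DP[OF h(1)] by blast
  then show ?thesis using h by blast
qed

lemma split_component_conj_DP:
  fixes g :: "'n::{finite,linorder} mat"
  assumes g: "g \<in> GG"
  shows "split_component (conj_by g ` BB) (conj_by g ` DP)"
  unfolding split_component_def
proof (intro exI[of _ "conj_by g ` DD"] conjI allI impI)
  show "A' = conj_by g ` DP" if "A' \<subseteq> center (conj_by g ` DD) \<and> connected_split_subgroup A' \<and> conj_by g ` DP \<subseteq> A'" for A'
    using that connected_split_subset_DP[OF g, of A'] by (auto simp: center_conj_DD[OF g])
qed (simp_all add: Levi_subgroup_DD center_conj_DD g conj_DP_subset_DD connected_split_subgroup_conj_DP)

section \<open>The two types of minimal parabolic subgroups\<close>

text \<open>Coordinates of the reflection \<open>S\<close> in a basis of joint eigenvectors of a \<open>\<sigma>\<close>-stable split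
  component: \<open>S\<close> either interchanges two eigenlines (rank one) or preserves all of them (rank zero).\<close>

definition swap_type :: "'n::{finite,linorder} \<Rightarrow> 'n \<Rightarrow> (real, 'n) vec \<Rightarrow> (real, 'n) vec \<Rightarrow> bool" where
  "swap_type a b v l \<longleftrightarrow> a < b \<and> v $ a * l $ a = 1/2 \<and> v $ b * l $ b = 1/2 \<and>
     (\<forall>c. c \<noteq> a \<longrightarrow> c \<noteq> b \<longrightarrow> v $ c = 0 \<and> l $ c = 0)"

definition sign_type :: "'n::finite \<Rightarrow> (real, 'n) vec \<Rightarrow> (real, 'n) vec \<Rightarrow> bool" where
  "sign_type k v l \<longleftrightarrow> v $ k * l $ k = 1 \<and> (\<forall>c. c \<noteq> k \<longrightarrow> v $ c = 0 \<and> l $ c = 0)"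

lemma swap_type_inner:
  assumes "swap_type a b v l" shows "l \<bullet> v = 1"
proof -
  have "l \<bullet> v = (\<Sum>c\<in>{a, b}. l $ c * v $ c)"
    unfolding inner_vec_def using assms
    by (intro sum.mono_neutral_cong_right) (auto simp: swap_type_def)
  then show ?thesis using assms by (auto simp: swap_type_def mult.commute)
qed

lemma sign_type_inner:
  assumes "sign_type k v l" shows "l \<bullet> v = 1"
proof -
  have "l \<bullet> v = (\<Sum>c\<in>{k}. l $ c * v $ c)"
    unfolding inner_vec_def using assms
    by (intro sum.mono_neutral_cong_right) (auto simp: sign_type_def)
  then show ?thesis using assms by (auto simp: sign_type_def mult.commute)
qed

text \<open>An off-diagonal nonzero entry at (i, j) forces the diagonal entries 1 - 2 v_i l_i and 1
  - 2 v_j l_j to vanish, which is the origin of the products 1/2, and kills all other entries of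
  \<open>v\<close> and \<open>l\<close>. Without such an entry only one index survives.\<close>

lemma monomial_reflection_cases:
  fixes v l :: "real^'n::{finite,linorder}"
  assumes vl: "l \<bullet> v = 1"
    and row: "\<And>i j j'. reflection v l $ i $ j \<noteq> 0 \<Longrightarrow> reflection v l $ i $ j' \<noteq> 0 \<Longrightarrow> j = j'"
    and col: "\<And>i i' j. reflection v l $ i $ j \<noteq> 0 \<Longrightarrow> reflection v l $ i' $ j \<noteq> 0 \<Longrightarrow> i = i'"
  shows "(\<exists>a b. swap_type a b v l) \<or> (\<exists>k. sign_type k v l)"
proof (cases "\<exists>i j. i \<noteq> j \<and> v $ i * l $ j \<noteq> 0")
  case True
  then obtain i j where ij: "i \<noteq> j" "v $ i * l $ j \<noteq> 0" by blast
  then have T: "reflection v l $ i $ j \<noteq> 0" by (simp add: refl_component)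
  have "v $ i * l $ i = 1/2" "v $ j * l $ j = 1/2"
    using row[OF T, of i] col[OF T, of j] ij(1) by (simp_all add: refl_component field_simps split: if_splits) metis+
  moreover have "v $ c = 0 \<and> l $ c = 0" if "c \<noteq> i" "c \<noteq> j" for c
    using row[OF T, of c] col[OF T, of c] that ij by (auto simp: refl_component)
  ultimately have "swap_type (min i j) (max i j) v l"
    using ij(1) by (auto simp: swap_type_def min_def max_def)
  then show ?thesis by blast
next
  case False
  have "\<exists>k. l $ k * v $ k \<noteq> 0"
  proof (rule ccontr)
    assume "\<not> ?thesis"
    then have "\<forall>k. l $ k * v $ k = 0" by blast
    then have "l \<bullet> v = 0" by (simp add: inner_vec_def sum.neutral del: mult_eq_0_iff)
    with vl show False by simp
  qed
  then obtain k where k: "l $ k * v $ k \<noteq> 0" by blast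
  with False have z: "v $ c = 0 \<and> l $ c = 0" if "c \<noteq> k" for c
    using that by (metis mult_eq_0_iff)
  have "l \<bullet> v = (\<Sum>c\<in>{k}. l $ c * v $ c)"
    unfolding inner_vec_def using z by (intro sum.mono_neutral_cong_right) auto
  then have "sign_type k v l" using vl z by (simp add: sign_type_def mult.commute)
  then show ?thesis by blast
qed

lemma Smat_coordinates:
  fixes g :: "'n::{finite,linorder} mat"
  assumes n: "CARD('n) \<ge> 2" and g: "g \<in> GG"
  obtains v l where "l \<bullet> v = 1" "conj_by g (reflection v l) = Smat"
proof
  let ?w = "axis first_ix 1 + axis last_ix 1 :: (real, 'n) vec"
  let ?v = "matrix_inv g *v ?w" and ?l = "((1/2) *\<^sub>R ?w) v* g"
  have "conj_by (matrix_inv g) Smat = reflection ?v ?l"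
    using g by (simp add: Smat_eq_refl[OF n] conj_by_refl GG_inverse matrix_inv_GG_inv)
  then show "conj_by g (reflection ?v ?l) = Smat" using g by (metis conj_by_inverse(1))
  have "?l \<bullet> ?v = ((1/2) *\<^sub>R ?w) \<bullet> ?w" by (simp add: inner_vec_mult GG_cancel[OF g])
  then show "?l \<bullet> ?v = 1"
    using first_less_last[OF n] by (simp add: inner_add_left inner_add_right inner_axis_axis_real)
qed

lemma sigma_conj_by_iff:
  fixes g :: "'n::{finite,linorder} mat"
  assumes n: "CARD('n) \<ge> 2" and g: "g \<in> GG" and R: "conj_by g R = Smat"
  shows "sigma (conj_by g x) = conj_by g y \<longleftrightarrow> R ** x = y ** R"
  unfolding sigma_eq_iff[OF n] R[symmetric]
  by (simp add: conj_by_mult[OF g, symmetric] conj_by_eq_iff[OF g])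

text \<open>Let \<open>R\<close> be the reflection in the eigenbasis and \<open>d0\<close> a regular
  element. Stability gives diagonal matrices with \<open>R ** d0 = d1 ** R\<close> and
  \<open>R ** d2 = d0 ** R\<close>. Comparing entries, a nonzero entry of \<open>R\<close> at (i, j)
  ties j to i through the distinct entries of \<open>d0\<close>, so \<open>R\<close> has at most one
  nonzero entry in each row and column.\<close>

lemma stable_split_component_cases:
  fixes P :: "'n::{finite,linorder} mat set"
  assumes n: "CARD('n) \<ge> 2" and P: "minimal_parabolic P" and A: "stable_split_component P A"
  obtains g v l where "g \<in> GG" "P = conj_by g ` BB" "A = conj_by g ` DP" "conj_by g (reflection v l) = Smat"
    "(\<exists>a b. swap_type a b v l) \<or> (\<exists>k. sign_type k v l)"
proof -
  obtain g0 where g0: "g0 \<in> GG" "P = conj_by g0 ` BB" using P by (auto simp: minimal_parabolic_iff)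
  obtain g where g: "g \<in> GG" "P = conj_by g ` BB" "A = conj_by g ` DP"
    using split_component_conj_BB[OF g0(1), of A] A g0(2) by (auto simp: stable_split_component_def)
  obtain v l where vl: "l \<bullet> v = 1" "conj_by g (reflection v l) = Smat" using Smat_coordinates[OF n g(1)] .
  let ?R = "reflection v l"
  obtain d0 :: "'n mat" where d0: "d0 \<in> DP" "\<And>i j. d0 $ i $ i = d0 $ j $ j \<Longrightarrow> i = j"
    using regular_element by blast
  obtain p0 where p0: "d0 = diag p0" using d0(1) DD_eq_diag by (auto simp: DP_iff)
  have p0i: "p0 $ i = p0 $ j \<Longrightarrow> i = j" for i j using d0(2)[of i j] by (simp add: p0 diag_component)
  have st: "sigma ` (conj_by g ` DP) = conj_by g ` DP" using A g(3) by (simp add: stable_split_component_def)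
  have "sigma (conj_by g d0) \<in> conj_by g ` DP" using st d0(1) by blast
  then obtain d1 where d1: "d1 \<in> DP" "?R ** d0 = d1 ** ?R"
    using sigma_conj_by_iff[OF n g(1) vl(2)] by auto
  have "conj_by g d0 \<in> sigma ` (conj_by g ` DP)" using st d0(1) by blast
  then obtain d2 where "d2 \<in> DP" "sigma (conj_by g d2) = conj_by g d0" by auto
  then have d2: "d2 \<in> DP" "?R ** d2 = d0 ** ?R"
    using sigma_conj_by_iff[OF n g(1) vl(2)] by auto
  obtain p1 where p1: "d1 = diag p1" using d1(1) DD_eq_diag by (auto simp: DP_iff)
  obtain p2 where p2: "d2 = diag p2" using d2(1) DD_eq_diag by (auto simp: DP_iff)
  have e1: "?R $ i $ j * p0 $ j = p1 $ i * ?R $ i $ j" for i j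
    using arg_cong[OF d1(2), of "\<lambda>X. X $ i $ j"] by (simp add: p0 p1 diag_mult)
  have e2: "?R $ i $ j * p2 $ j = p0 $ i * ?R $ i $ j" for i j
    using arg_cong[OF d2(2), of "\<lambda>X. X $ i $ j"] by (simp add: p0 p2 diag_mult)
  have "(\<exists>a b. swap_type a b v l) \<or> (\<exists>k. sign_type k v l)"
  proof (rule monomial_reflection_cases[OF vl(1)])
    fix i j j' assume "?R $ i $ j \<noteq> 0" "?R $ i $ j' \<noteq> 0"
    then have "p0 $ j = p1 $ i" "p0 $ j' = p1 $ i" using e1[of i j] e1[of i j'] by auto
    then show "j = j'" using p0i by simp
  next
    fix i i' j assume "?R $ i $ j \<noteq> 0" "?R $ i' $ j \<noteq> 0"
    then have "p0 $ i = p2 $ j" "p0 $ i' = p2 $ j" using e2[of i j] e2[of i' j] by auto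
    then show "i = i'" using p0i by simp
  qed
  then show ?thesis using that[OF g vl(2)] by blast
qed

lemma swap_type_component:
  assumes "swap_type a b v l" "reflection v l $ i $ j \<noteq> 0"
  shows "(i = j \<and> i \<noteq> a \<and> i \<noteq> b) \<or> (i = a \<and> j = b) \<or> (i = b \<and> j = a)"
  using assms by (cases "i = a"; cases "i = b"; cases "j = a"; cases "j = b")
    (auto simp: swap_type_def refl_component split: if_splits)

lemma sign_type_component:
  assumes "sign_type k v l" "i \<noteq> j"
  shows "reflection v l $ i $ j = 0"
  using assms by (cases "i = k") (auto simp: sign_type_def refl_component)

text \<open>Passing the reflection across a diagonal matrix interchanges the entries at a and b, or
  changes nothing. So \<open>sigma\<close> maps the component into itself, and onto itself because
  it is an involution.\<close>

lemma stable_split_componentI: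
  fixes g :: "'n::{finite,linorder} mat"
  assumes n: "CARD('n) \<ge> 2" and g: "g \<in> GG" and R: "conj_by g (reflection v l) = Smat"
    and t: "(\<exists>a b. swap_type a b v l) \<or> (\<exists>k. sign_type k v l)"
  shows "stable_split_component (conj_by g ` BB) (conj_by g ` DP)"
proof -
  have lv: "l \<bullet> v = 1" using t swap_type_inner sign_type_inner by blast
  have "\<exists>e\<in>DP. reflection v l ** d = e ** reflection v l" if d: "d \<in> DP" for d
  proof -
    obtain x where x: "d = diag (\<chi> i. exp (x $ i))" "sum (($) x) UNIV = 0" using d by (auto simp: DP_def)
    from t show ?thesis
    proof
      assume "\<exists>a b. swap_type a b v l"
      then obtain a b where ab: "swap_type a b v l" by blast
      let ?p = "Transposition.transpose a b"
      let ?y = "\<chi> i. x $ ?p i"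
      have "sum (($) ?y) UNIV = sum (($) x) UNIV"
        using sum.reindex_bij_betw[of ?p UNIV UNIV "($) x"] by (simp add: bij_betw_def)
      then have "diag (\<chi> i. exp (?y $ i)) \<in> DP"
        unfolding DP_def using x(2) by (intro CollectI exI[of _ ?y]) simp
      moreover have "reflection v l $ i $ j * exp (x $ j) = exp (x $ ?p i) * reflection v l $ i $ j" for i j
        using swap_type_component[OF ab, of i j] by (cases "reflection v l $ i $ j = 0") auto
      then have "reflection v l ** d = diag (\<chi> i. exp (?y $ i)) ** reflection v l"
        by (simp add: x(1) vec_eq_iff diag_mult)
      ultimately show ?thesis by blast
    next
      assume "\<exists>k. sign_type k v l"
      then obtain k where k: "sign_type k v l" by blast
      have "reflection v l $ i $ j * exp (x $ j) = exp (x $ i) * reflection v l $ i $ j" for i j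
        using sign_type_component[OF k, of i j] by (cases "i = j") auto
      then have "reflection v l ** d = d ** reflection v l"
        by (simp add: x(1) vec_eq_iff diag_mult)
      then show ?thesis using d by blast
    qed
  qed
  then have "\<exists>e\<in>DP. sigma (conj_by g d) = conj_by g e" if "d \<in> DP" for d
    using that sigma_conj_by_iff[OF n g R] by blast
  then have sub: "sigma ` (conj_by g ` DP) \<subseteq> conj_by g ` DP" by blast
  have "sigma (sigma x) = x" for x :: "'n mat"
  proof -
    have "Smat ** (sigma x) = x ** Smat"
      using sigma_eq_iff[OF n, of x "sigma x"] Smat_square[OF n]
      by (metis matrix_mul_assoc matrix_mul_lid matrix_mul_rid)
    then show ?thesis by (simp add: sigma_eq_iff[OF n])
  qed
  with sub have "sigma ` (conj_by g ` DP) = conj_by g ` DP" by (metis (no_types, opaque_lifting) image_eqI image_subset_iff subsetI subset_antisym)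
  then show ?thesis using split_component_conj_DP[OF g] by (simp add: stable_split_component_def)
qed

lemma dim_conj_by: "g \<in> GG \<Longrightarrow> dim (conj_by g ` V) = dim V"
  by (rule dim_image_eq[OF linear_conj_by]) (auto simp: inj_on_def conj_by_eq_iff)

lemma HH_eq_commutant:
  fixes g :: "'n::{finite,linorder} mat"
  assumes n: "CARD('n) \<ge> 2" and g: "g \<in> GG" and R: "conj_by g R = Smat" and L: "L \<subseteq> GG"
  shows "conj_by g ` L \<inter> HH = conj_by g ` (L \<inter> commutant R)"
proof -
  have "conj_by g x \<in> HH \<longleftrightarrow> x \<in> commutant R" if "x \<in> L" for x
  proof -
    have "conj_by g x \<in> GG" using that L g by (auto simp: conj_by_in_GG_iff)
    then show ?thesis using sigma_conj_by_iff[OF n g R, of x x] by (auto simp: HH_def commutant_def)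
  qed
  then show ?thesis by auto
qed

lemma Dim_conj_Int_HH:
  fixes g :: "'n::{finite,linorder} mat"
  assumes n: "CARD('n) \<ge> 2" and g: "g \<in> GG" and R: "conj_by g R = Smat" and L: "L \<subseteq> GG"
  shows "Dim (conj_by g ` L \<inter> HH) = dim (lie L \<inter> commutant R)"
  unfolding Dim_def HH_eq_commutant[OF assms] lie_conj_by[OF g] dim_conj_by[OF g] lie_Int lie_commutant ..

lemma subspace_aa: "subspace (aa :: (real^'n^'n) set)"
proof -
  have "aa = diag ` {x::real^'n. sum (($) x) UNIV = 0}" by (auto simp: aa_def)
  moreover have "subspace {x::real^'n. sum (($) x) UNIV = 0}"
    by (auto simp: subspace_def sum.distrib sum_distrib_left[symmetric])
  ultimately show ?thesis using linear_subspace_image[OF linear_diag] by metis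
qed

text \<open>Diagonal matrices all commute with a diagonal reflection; they commute with one that
  swaps a and b exactly when their entries at a and b agree. The rank is the codimension of this
  condition.\<close>

lemma parabolic_rank_eq:
  fixes g :: "'n::{finite,linorder} mat"
  assumes n: "CARD('n) \<ge> 2" and g: "g \<in> GG" and R: "conj_by g (reflection v l) = Smat"
  shows "sign_type k v l \<Longrightarrow> Dim (conj_by g ` DP) - Dim (conj_by g ` DP \<inter> HH) = 0"
    and "swap_type a b v l \<Longrightarrow> Dim (conj_by g ` DP) - Dim (conj_by g ` DP \<inter> HH) = 1"
proof -
  have D: "Dim (conj_by g ` DP) = dim (aa :: 'n mat set)"
    by (simp add: Dim_def lie_conj_by[OF g] dim_conj_by[OF g] lie_DP)
  have DH: "Dim (conj_by g ` DP \<inter> HH) = dim (aa \<inter> commutant (reflection v l))"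
    using Dim_conj_Int_HH[OF n g R, of DP] by (auto simp: lie_DP DP_iff DD_subset_GG subset_iff)
  show "Dim (conj_by g ` DP) - Dim (conj_by g ` DP \<inter> HH) = 0" if k: "sign_type k v l"
  proof -
    have "diag x ** reflection v l = reflection v l ** diag x" for x
    proof -
      have "x $ i * reflection v l $ i $ j = reflection v l $ i $ j * x $ j" for i j
        using sign_type_component[OF k, of i j] by (cases "i = j") auto
      then show ?thesis by (simp add: vec_eq_iff diag_mult)
    qed
    then have "aa \<inter> commutant (reflection v l) = aa" by (auto simp: aa_def commutant_def)
    then show ?thesis by (simp add: D DH)
  qed
  show "Dim (conj_by g ` DP) - Dim (conj_by g ` DP \<inter> HH) = 1" if ab: "swap_type a b v l"
  proof -
    have c: "diag x ** reflection v l = reflection v l ** diag x \<longleftrightarrow> x $ a = x $ b" for x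
    proof
      assume *: "diag x ** reflection v l = reflection v l ** diag x"
      have "x $ a * reflection v l $ a $ b = reflection v l $ a $ b * x $ b"
        using arg_cong[OF *, of "\<lambda>X. X $ a $ b"] by (simp add: diag_mult)
      moreover have "reflection v l $ a $ b \<noteq> 0" using ab by (auto simp: swap_type_def refl_component)
      ultimately show "x $ a = x $ b" by simp
    next
      assume "x $ a = x $ b"
      then have "x $ i * reflection v l $ i $ j = reflection v l $ i $ j * x $ j" for i j
        using swap_type_component[OF ab, of i j] by (cases "reflection v l $ i $ j = 0") auto
      then show "diag x ** reflection v l = reflection v l ** diag x" by (simp add: vec_eq_iff diag_mult)
    qed
    have W: "X \<in> aa \<inter> commutant (reflection v l) \<longleftrightarrow> X \<in> aa \<and> X $ a $ a = X $ b $ b" for X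
    proof (cases "X \<in> aa")
      case True
      then obtain x where "X = diag x" by (auto simp: aa_def)
      with True c[of x] show ?thesis by (simp add: commutant_def diag_component)
    qed simp
    let ?W = "aa \<inter> commutant (reflection v l)"
    \<comment> \<open>It spans a complement of the hyperplane on which the entries at a and b
      agree.\<close>
    define Z where "Z = diag (axis a (1/2) - axis b (1/2) :: (real, 'n) vec)"
    have ne: "a \<noteq> b" using ab by (auto simp: swap_type_def)
    have Z: "Z \<in> aa" "Z $ a $ a - Z $ b $ b = 1"
      using ne by (auto simp: Z_def aa_def diag_component axis_def sum_subtractf)
    have sW: "subspace ?W"
    proof -
      have "subspace {X :: 'n mat. X $ a $ a = X $ b $ b}" by (auto simp: subspace_def)
      moreover have "?W = aa \<inter> {X. X $ a $ a = X $ b $ b}" using W by blast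
      ultimately show ?thesis using subspace_inter[OF subspace_aa] by simp
    qed
    have "aa = span (insert Z ?W)"
    proof
      show "span (insert Z ?W) \<subseteq> aa"
        by (rule span_minimal) (use Z subspace_aa in auto)
      show "aa \<subseteq> span (insert Z ?W)"
      proof
        fix X :: "'n mat" assume X: "X \<in> aa"
        let ?c = "X $ a $ a - X $ b $ b"
        have "X - ?c *\<^sub>R Z \<in> aa"
          using X Z(1) subspace_aa by (metis subspace_diff subspace_scale)
        moreover have "?c * (Z $ a $ a - Z $ b $ b) = ?c" by (simp add: Z(2))
        ultimately have "X - ?c *\<^sub>R Z \<in> ?W" unfolding W by (simp add: algebra_simps)
        then have "X - ?c *\<^sub>R Z \<in> span ?W" by (rule span_base)
        then show "X \<in> span (insert Z ?W)" unfolding span_insert by blast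
      qed
    qed
    moreover have "Z \<notin> span ?W" using sW W Z(2) by (simp add: span_eq_iff[THEN iffD2, OF sW])
    ultimately have "dim (aa :: 'n mat set) = dim ?W + 1"
      by (metis dim_insert dim_span Suc_eq_plus1)
    then show ?thesis by (simp add: D DH)
  qed
qed

text \<open>Preserving all eigenlines of a split component, \<open>S\<close> normalises \<open>P\<close>; interchanging two of them,
  it does not.\<close>

lemma swap_sign_exclusive:
  fixes g h :: "'n::{finite,linorder} mat"
  assumes n: "CARD('n) \<ge> 2" and g: "g \<in> GG" "conj_by g (reflection v l) = Smat" "sign_type k v l"
    and h: "h \<in> GG" "conj_by h (reflection v' l') = Smat" "swap_type a b v' l'"
  shows "conj_by g ` BB \<noteq> conj_by h ` BB"
proof
  assume eq: "conj_by g ` BB = conj_by h ` BB"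
  have ab: "a < b" using h(3) by (simp add: swap_type_def)
  let ?R = "reflection v l" and ?R' = "reflection v' l'"
  have RR: "?R ** ?R = mat 1" "?R' ** ?R' = mat 1"
    using refl_mult_refl sign_type_inner[OF g(3)] swap_type_inner[OF h(3)] by auto
  have R0: "?R $ i $ j = 0" if "j < i" for i j using sign_type_component[OF g(3), of i j] that by auto
  \<comment> \<open>The test element. Conjugation by \<open>?R'\<close> gives the transvection at
    (a, b) a nonzero entry at (b, a), whereas \<open>?R\<close> is diagonal and preserves upper
    triangular matrices.\<close>
  define t where "t = conj_by (matrix_inv g) (conj_by h (trv a b 1))"
  have "conj_by h (trv a b 1) \<in> conj_by g ` BB"
    unfolding eq using trv_in_UU[OF ab] UU_subset_BB by blast
  then have t: "t \<in> BB" "conj_by g t = conj_by h (trv a b 1)"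
    using g(1) by (auto simp: t_def conj_by_inverse mem_conj_by_image)
  have "?R ** t ** ?R \<in> BB"
  proof -
    have "det (?R ** t ** ?R) = det (?R ** ?R) * det t" by (simp add: det_mul)
    then have "?R ** t ** ?R \<in> GG" using t(1) RR by (simp add: BB_def GG_iff)
    moreover have "(?R ** t ** ?R) $ i $ j = 0" if "j < i" for i j
      using that t(1) R0 by (intro upper_mult_component(1)) (auto simp: BB_def upper_mult_component(1))
    ultimately show ?thesis by (simp add: BB_def)
  qed
  then have "conj_by g (?R ** t ** ?R) \<in> conj_by h ` BB" using eq by blast
  moreover have "conj_by g (?R ** t ** ?R) = conj_by h (?R' ** trv a b 1 ** ?R')"
    by (simp add: conj_by_mult[OF g(1)] conj_by_mult[OF h(1)] g(2) h(2) t(2))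
  ultimately have "?R' ** trv a b 1 ** ?R' \<in> BB" using conj_by_in_image_iff[OF h(1)] by metis
  then have "(?R' ** trv a b 1 ** ?R') $ b $ a = 0" using ab by (simp add: BB_def)
  moreover have "?R' ** trv a b 1 ** ?R' = mat 1 + outer (?R' *v axis a 1) (axis b 1 v* ?R')"
    by (simp add: trv_def matrix_add_ldistrib mult_outer outer_mult RR
        linear_add[OF linear_matrix_mult_right])
  moreover have "(?R' *v axis a 1) $ b = ?R' $ b $ a" "(axis b 1 v* ?R') $ a = ?R' $ b $ a"
    by (simp_all add: matrix_vector_mult_def vector_matrix_mult_def axis_def
        if_distrib[of "\<lambda>x. x * _"] if_distrib[of "\<lambda>x. _ * x"] cong: if_cong)
  moreover have "(mat 1 :: 'n mat) $ b $ a = 0" using ab by (auto simp: mat_def)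
  ultimately have "?R' $ b $ a * ?R' $ b $ a = 0" by (simp add: outer_component)
  moreover have "?R' $ b $ a \<noteq> 0" using h(3) ab by (auto simp: swap_type_def refl_component split: if_splits)
  ultimately show False by simp
qed

lemma parab_P_iff:
  fixes P :: "'n::{finite,linorder} mat set"
  assumes n: "CARD('n) \<ge> 2"
  shows "P \<in> parab_P \<longleftrightarrow> (\<exists>g\<in>GG. \<exists>v l a b. P = conj_by g ` BB \<and> conj_by g (reflection v l) = Smat \<and> swap_type a b v l)"
proof
  assume "P \<in> parab_P"
  then obtain A where A: "minimal_parabolic P" "stable_split_component P A" "1 = Dim A - Dim (A \<inter> HH)"
    by (auto simp: parab_P_def has_parabolic_rank_def)
  from stable_split_component_cases[OF n A(1,2)] show
    "\<exists>g\<in>GG. \<exists>v l a b. P = conj_by g ` BB \<and> conj_by g (reflection v l) = Smat \<and> swap_type a b v l"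
    using parabolic_rank_eq(1)[OF n] A(3) by (metis zero_neq_one)
next
  assume "\<exists>g\<in>GG. \<exists>v l a b. P = conj_by g ` BB \<and> conj_by g (reflection v l) = Smat \<and> swap_type a b v l"
  then obtain g v l a b where g: "g \<in> GG" "P = conj_by g ` BB" "conj_by g (reflection v l) = Smat" "swap_type a b v l"
    by blast
  then show "P \<in> parab_P"
    using stable_split_componentI[OF n g(1,3)] parabolic_rank_eq(2)[OF n g(1,3,4)]
    by (auto simp: parab_P_def has_parabolic_rank_def minimal_parabolic_iff intro!: exI[of _ "conj_by g ` DP"])
qed

lemma parab_Q_cases:
  fixes P :: "'n::{finite,linorder} mat set"
  assumes n: "CARD('n) \<ge> 2" and P: "P \<in> parab_Q"
  shows "\<exists>g\<in>GG. \<exists>v l k. P = conj_by g ` BB \<and> conj_by g (reflection v l) = Smat \<and> sign_type k v l"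
proof -
  obtain A where A: "minimal_parabolic P" "stable_split_component P A" "0 = Dim A - Dim (A \<inter> HH)"
    using P by (auto simp: parab_Q_def has_parabolic_rank_def)
  from stable_split_component_cases[OF n A(1,2)] show ?thesis
    using parabolic_rank_eq(2)[OF n] A(3) by (metis zero_neq_one)
qed

section \<open>Roots and compatibility\<close>

text \<open>The root e_i - e_j in the basis given by the columns of \<open>g\<close>, extended by 0
  as \<open>dual_space\<close> prescribes.\<close>

definition rt :: "'n::finite mat \<Rightarrow> 'n \<Rightarrow> 'n \<Rightarrow> 'n mat \<Rightarrow> real" where
  "rt g i j X = (if X \<in> conj_by g ` aa
     then conj_by (matrix_inv g) X $ i $ i - conj_by (matrix_inv g) X $ j $ j else 0)"

definition unit_mat :: "'n::finite \<Rightarrow> 'n \<Rightarrow> real \<Rightarrow> 'n mat" where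
  "unit_mat i j c = outer (axis i c) (axis j 1)"

lemma unit_mat_component: "unit_mat i j c $ a $ b = (if a = i \<and> b = j then c else 0)"
  by (simp add: unit_mat_def outer_component axis_def)

lemma rt_conj_diag:
  "g \<in> GG \<Longrightarrow> sum (($) x) UNIV = 0 \<Longrightarrow> rt g i j (conj_by g (diag x)) = x $ i - x $ j"
  by (auto simp: rt_def conj_by_inverse diag_component conj_by_in_image_iff aa_def)

lemma trace_diag: "trace (diag x) = sum (($) x) UNIV"
  by (simp add: trace_def diag_component)

text \<open>The coroot of e_i - e_j as a vector. It separates roots, and through the trace form it
  also represents the root itself.\<close>

definition axis_diff :: "'n::finite \<Rightarrow> 'n \<Rightarrow> (real, 'n) vec" where
  "axis_diff i j = axis i 1 - axis j 1"

lemma axis_diff_component: "axis_diff i j $ a = (if a = i then 1 else 0) - (if a = j then 1 else 0)"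
  by (simp add: axis_diff_def axis_def)

lemma sum_axis_diff: "sum (($) (axis_diff i j)) UNIV = 0"
  by (simp add: axis_diff_component sum_subtractf)

lemma commutator_conj_diag:
  assumes g: "g \<in> GG"
  shows "conj_by g (diag x) ** conj_by g Y - conj_by g Y ** conj_by g (diag x) = c *\<^sub>R conj_by g Y
     \<longleftrightarrow> (\<forall>a b. (x $ a - x $ b - c) * Y $ a $ b = 0)"
proof -
  have "conj_by g (diag x) ** conj_by g Y - conj_by g Y ** conj_by g (diag x) = c *\<^sub>R conj_by g Y
     \<longleftrightarrow> conj_by g (diag x ** Y - Y ** diag x) = conj_by g (c *\<^sub>R Y)"
    by (simp only: linear_diff[OF linear_conj_by] linear_scale[OF linear_conj_by] conj_by_mult[OF g])
  also have "\<dots> \<longleftrightarrow> diag x ** Y - Y ** diag x = c *\<^sub>R Y" by (rule conj_by_eq_iff[OF g])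
  also have "\<dots> \<longleftrightarrow> (\<forall>a b. (x $ a - x $ b - c) * Y $ a $ b = 0)"
  proof -
    have "(p * y - y * q = c * y) \<longleftrightarrow> (p - q - c) * y = 0" for p q y :: real
    proof -
      have "(p - q - c) * y = p * y - y * q - c * y" by (simp add: algebra_simps)
      then show ?thesis by (simp del: mult_eq_0_iff)
    qed
    then show ?thesis by (simp add: vec_eq_iff diag_mult del: mult_eq_0_iff)
  qed
  finally show ?thesis .
qed

lemma root_space_conj_iff:
  assumes g: "g \<in> GG"
  shows "conj_by g Y \<in> root_space (conj_by g ` aa) \<alpha> \<longleftrightarrow> trace Y = 0 \<and>
    (\<forall>x a b. sum (($) x) UNIV = 0 \<longrightarrow> (x $ a - x $ b - \<alpha> (conj_by g (diag x))) * Y $ a $ b = 0)"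
proof -
  have "conj_by g Y \<in> root_space (conj_by g ` aa) \<alpha> \<longleftrightarrow> trace Y = 0 \<and>
    (\<forall>x. sum (($) x) UNIV = 0 \<longrightarrow> conj_by g (diag x) ** conj_by g Y - conj_by g Y ** conj_by g (diag x)
       = \<alpha> (conj_by g (diag x)) *\<^sub>R conj_by g Y)"
    unfolding root_space_def by (auto simp: aa_def sl_def trace_conj_by[OF g])
  then show ?thesis unfolding commutator_conj_diag[OF g] by blast
qed

lemma root_space_rt:
  assumes g: "g \<in> GG" and ij: "i \<noteq> j"
  shows "root_space (conj_by g ` aa) (rt g i j) = conj_by g ` range (unit_mat i j)"
proof -
  have "conj_by g Y \<in> root_space (conj_by g ` aa) (rt g i j) \<longleftrightarrow> Y \<in> range (unit_mat i j)" for Y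
  proof
    assume Y: "conj_by g Y \<in> root_space (conj_by g ` aa) (rt g i j)"
    have "Y $ a $ b = 0" if "\<not> (a = i \<and> b = j)" for a b
    proof -
      \<comment> \<open>Among all differences of two entries of the coroot, only the one at (i, j)
        equals 2.\<close>
      have "(axis_diff i j $ a - axis_diff i j $ b - rt g i j (conj_by g (diag (axis_diff i j)))) * Y $ a $ b = 0"
        using Y[unfolded root_space_conj_iff[OF g]] sum_axis_diff by blast
      moreover have "rt g i j (conj_by g (diag (axis_diff i j))) = 2"
        using ij by (simp add: rt_conj_diag[OF g sum_axis_diff] axis_diff_component)
      moreover have "axis_diff i j $ a - axis_diff i j $ b - 2 \<noteq> 0"
        using that ij by (auto simp: axis_diff_component)
      ultimately show ?thesis by (metis mult_eq_0_iff)
    qed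
    then have "Y = unit_mat i j (Y $ i $ j)" by (auto simp: vec_eq_iff unit_mat_component)
    then show "Y \<in> range (unit_mat i j)" by blast
  next
    assume "Y \<in> range (unit_mat i j)"
    then show "conj_by g Y \<in> root_space (conj_by g ` aa) (rt g i j)"
      using ij unfolding root_space_conj_iff[OF g]
      by (auto simp: unit_mat_component rt_conj_diag[OF g] trace_def intro!: sum.neutral split: if_splits)
  qed
  then have "X \<in> root_space (conj_by g ` aa) (rt g i j) \<longleftrightarrow> X \<in> conj_by g ` range (unit_mat i j)" for X
    using conj_by_inverse(1)[OF g, of X] conj_by_in_image_iff[OF g] by metis
  then show ?thesis by blast
qed

lemma rt_in_dual_space:
  fixes g :: "real^'n^'n"
  assumes g: "g \<in> GG"
  shows "rt g i j \<in> dual_space (conj_by g ` aa)"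
proof -
  have s: "subspace (conj_by g ` aa)" by (intro linear_subspace_image linear_conj_by subspace_aa)
  have "c *\<^sub>R X + d *\<^sub>R Y \<in> conj_by g ` aa" if "X \<in> conj_by g ` aa" "Y \<in> conj_by g ` aa" for X Y c d
    using that s by (simp add: subspace_add subspace_scale)
  then show ?thesis
    by (simp add: dual_space_def rt_def linear_add[OF linear_conj_by] linear_scale[OF linear_conj_by] algebra_simps)
qed

lemma rt_nonzero: "g \<in> GG \<Longrightarrow> i \<noteq> j \<Longrightarrow> rt g i j \<noteq> (\<lambda>_. 0)"
  using rt_conj_diag[OF _ sum_axis_diff, of g i j i j] by (auto simp: axis_diff_component)

lemma rt_inj:
  assumes g: "g \<in> GG" and ij: "i \<noteq> j" and eq: "rt g i j = rt g i' j'"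
  shows "i = i' \<and> j = j'"
proof -
  have "axis_diff i j $ i' - axis_diff i j $ j' = axis_diff i j $ i - axis_diff i j $ j"
    using arg_cong[OF eq, of "\<lambda>f. f (conj_by g (diag (axis_diff i j)))"]
    unfolding rt_conj_diag[OF g sum_axis_diff] by simp
  then show ?thesis using ij by (auto simp: axis_diff_component split: if_splits)
qed

lemma unit_mat_0_iff: "unit_mat i j c = 0 \<longleftrightarrow> c = 0"
  by (auto simp: vec_eq_iff unit_mat_component)

lemma conj_by_0_iff: "g \<in> GG \<Longrightarrow> conj_by g x = 0 \<longleftrightarrow> x = 0"
  using conj_by_eq_iff[of g x 0] linear_0[OF linear_conj_by[of g]] by simp

text \<open>A single nonzero entry of a root vector, read in the basis \<open>g\<close>, determines
  the root.\<close>

lemma roots_conj_aa: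
  fixes g :: "real^'n^'n"
  assumes g: "g \<in> GG"
  shows "roots (conj_by g ` aa) = {rt g i j | i j. i \<noteq> j}"
proof
  show "{rt g i j | i j. i \<noteq> j} \<subseteq> roots (conj_by g ` aa)"
  proof safe
    fix i j :: 'n assume ij: "i \<noteq> j"
    have "conj_by g (unit_mat i j 1) \<in> root_space (conj_by g ` aa) (rt g i j)"
      unfolding root_space_rt[OF g ij] by blast
    moreover have "conj_by g (unit_mat i j 1) \<noteq> 0" by (simp add: conj_by_0_iff[OF g] unit_mat_0_iff)
    ultimately show "rt g i j \<in> roots (conj_by g ` aa)"
      using rt_in_dual_space[OF g] rt_nonzero[OF g ij] by (auto simp: roots_def)
  qed
  show "roots (conj_by g ` aa) \<subseteq> {rt g i j | i j. i \<noteq> j}"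
  proof
    fix \<alpha> assume \<alpha>: "\<alpha> \<in> roots (conj_by g ` aa)"
    have "0 \<in> root_space (conj_by g ` aa) \<alpha>"
      by (simp add: root_space_def sl_def trace_def linear_0[OF linear_matrix_mult_left] linear_0[OF linear_matrix_mult_right])
    then obtain X where X: "X \<in> root_space (conj_by g ` aa) \<alpha>" "X \<noteq> 0" using \<alpha> by (auto simp: roots_def)
    define Y where "Y = conj_by (matrix_inv g) X"
    have XY: "X = conj_by g Y" using g by (simp add: Y_def conj_by_inverse)
    then have "Y \<noteq> 0" using X(2) conj_by_0_iff[OF g] by auto
    then obtain a b where ab: "Y $ a $ b \<noteq> 0" by (auto simp: vec_eq_iff)
    have val: "\<alpha> (conj_by g (diag x)) = x $ a - x $ b" if "sum (($) x) UNIV = 0" for x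
    proof -
      have "(x $ a - x $ b - \<alpha> (conj_by g (diag x))) * Y $ a $ b = 0"
        using X(1) that unfolding XY root_space_conj_iff[OF g] by blast
      then show ?thesis using ab by simp
    qed
    have out: "\<alpha> Z = 0" if "Z \<notin> conj_by g ` aa" for Z using \<alpha> that by (simp add: roots_def dual_space_def)
    have "\<alpha> Z = rt g a b Z" for Z
    proof (cases "Z \<in> conj_by g ` aa")
      case True
      then obtain x where x: "Z = conj_by g (diag x)" "sum (($) x) UNIV = 0" by (auto simp: aa_def)
      then show ?thesis by (simp add: val rt_conj_diag[OF g])
    qed (simp add: out rt_def)
    then have "\<alpha> = rt g a b" by blast
    moreover have "a \<noteq> b"
    proof
      assume "a = b"
      then have "\<alpha> = (\<lambda>_. 0)" using \<open>\<alpha> = rt g a b\<close> by (auto simp: rt_def)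
      then show False using \<alpha> by (simp add: roots_def)
    qed
    ultimately show "\<alpha> \<in> {rt g i j | i j. i \<noteq> j}" by blast
  qed
qed

lemma roots_of_conj:
  fixes g :: "'n::{finite,linorder} mat"
  assumes g: "g \<in> GG"
  shows "roots_of (conj_by g ` aa) (conj_by g ` BB) = {rt g i j | i j. i < j}"
proof -
  have "root_space (conj_by g ` aa) (rt g i j) \<subseteq> lie (unip_radical (conj_by g ` BB)) \<longleftrightarrow> i < j"
    if ij: "i \<noteq> j" for i j :: 'n
  proof -
    have "root_space (conj_by g ` aa) (rt g i j) \<subseteq> lie (unip_radical (conj_by g ` BB))
        \<longleftrightarrow> range (unit_mat i j) \<subseteq> NN"
      using inj_image_subset_iff[of "conj_by g" "range (unit_mat i j)" NN]
      by (simp add: root_space_rt[OF g ij] unip_radical_conj_BB[OF g] lie_conj_by[OF g] lie_UU inj_def conj_by_eq_iff[OF g])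
    also have "\<dots> \<longleftrightarrow> i < j"
    proof
      assume "range (unit_mat i j) \<subseteq> NN"
      then have "unit_mat i j 1 \<in> NN" by blast
      then have "unit_mat i j 1 $ i $ j = 0" if "j \<le> i" using that unfolding NN_def by blast
      then show "i < j" by (auto simp: unit_mat_component not_le[symmetric])
    next
      assume "i < j"
      then show "range (unit_mat i j) \<subseteq> NN" by (auto simp: NN_def unit_mat_component)
    qed
    finally show ?thesis .
  qed
  then show ?thesis unfolding roots_of_def roots_conj_aa[OF g] by (blast dest: less_imp_neq)
qed

lemma unit_mat_commutes_iff:
  "unit_mat i j c ** R = R ** unit_mat i j c \<longleftrightarrow>
    c = 0 \<or> ((\<forall>a. a \<noteq> i \<longrightarrow> R $ a $ i = 0) \<and> (\<forall>b. b \<noteq> j \<longrightarrow> R $ j $ b = 0) \<and> R $ i $ i = R $ j $ j)"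
proof -
  have "(unit_mat i j c ** R) $ a $ b = (if a = i then c * R $ j $ b else 0)" for a b
    by (simp add: matrix_matrix_mult_def unit_mat_component if_distrib[of "\<lambda>x. x * _"] cong: if_cong)
  moreover have "(R ** unit_mat i j c) $ a $ b = (if b = j then c * R $ a $ i else 0)" for a b
    by (simp add: matrix_matrix_mult_def unit_mat_component if_distrib[of "\<lambda>x. _ * x"] mult.commute cong: if_cong)
  ultimately have "unit_mat i j c ** R = R ** unit_mat i j c \<longleftrightarrow>
     (\<forall>a b. (if a = i then c * R $ j $ b else 0) = (if b = j then c * R $ a $ i else 0))"
    by (simp add: vec_eq_iff)
  also have "\<dots> \<longleftrightarrow> c = 0 \<or> ((\<forall>a. a \<noteq> i \<longrightarrow> R $ a $ i = 0) \<and> (\<forall>b. b \<noteq> j \<longrightarrow> R $ j $ b = 0) \<and> R $ i $ i = R $ j $ j)"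
    by (auto split: if_splits)
  finally show ?thesis .
qed

text \<open>The left side is the criterion of \<open>unit_mat_commutes_iff\<close> for c \<noteq> 0.
  Thus the root space of e_i - e_j meets the fixed algebra of \<open>sigma\<close> exactly when i
  and j avoid \<open>E\<close>.\<close>

definition moved :: "'n set \<Rightarrow> (real, 'n::finite) vec \<Rightarrow> (real, 'n) vec \<Rightarrow> bool" where
  "moved E v l \<longleftrightarrow> (\<forall>i j. i \<noteq> j \<longrightarrow>
     ((\<forall>a. a \<noteq> i \<longrightarrow> reflection v l $ a $ i = 0) \<and> (\<forall>b. b \<noteq> j \<longrightarrow> reflection v l $ j $ b = 0) \<and>
      reflection v l $ i $ i = reflection v l $ j $ j) \<longleftrightarrow> i \<notin> E \<and> j \<notin> E)"

lemma moved_swap: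
  fixes v l :: "real^'n::{finite,linorder}"
  assumes "swap_type a b v l" shows "moved {a, b} v l"
  unfolding moved_def
proof (intro allI impI)
  fix i j :: 'n assume ij: "i \<noteq> j"
  have nz: "v $ a \<noteq> 0" "v $ b \<noteq> 0" "l $ a \<noteq> 0" "l $ b \<noteq> 0" "a \<noteq> b"
    and z: "\<And>c. c \<noteq> a \<Longrightarrow> c \<noteq> b \<Longrightarrow> v $ c = 0 \<and> l $ c = 0"
    using assms by (auto simp: swap_type_def)
  have "reflection v l $ b $ a \<noteq> 0" "reflection v l $ a $ b \<noteq> 0" using nz by (auto simp: refl_component)
  moreover have "i \<notin> {a, b} \<Longrightarrow> reflection v l $ c $ i = (if c = i then 1 else 0)"
    "j \<notin> {a, b} \<Longrightarrow> reflection v l $ j $ c = (if c = j then 1 else 0)"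
    "i \<notin> {a, b} \<Longrightarrow> reflection v l $ i $ c = (if c = i then 1 else 0)" for c
    using z by (auto simp: refl_component)
  ultimately show "((\<forall>a. a \<noteq> i \<longrightarrow> reflection v l $ a $ i = 0) \<and> (\<forall>b. b \<noteq> j \<longrightarrow> reflection v l $ j $ b = 0) \<and>
      reflection v l $ i $ i = reflection v l $ j $ j) \<longleftrightarrow> i \<notin> {a, b} \<and> j \<notin> {a, b}"
    using nz(5) by (smt (verit) insert_iff singletonD)
qed

lemma moved_sign:
  fixes v l :: "real^'n"
  assumes "sign_type k v l" shows "moved {k} v l"
  unfolding moved_def
proof (intro allI impI)
  fix i j :: 'n assume ij: "i \<noteq> j"
  have "reflection v l $ c $ d = (if c = d then if c = k then -1 else 1 else 0)" for c d
    using assms by (cases "c = k"; cases "d = k") (auto simp: refl_component sign_type_def)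
  then show "((\<forall>a. a \<noteq> i \<longrightarrow> reflection v l $ a $ i = 0) \<and> (\<forall>b. b \<noteq> j \<longrightarrow> reflection v l $ j $ b = 0) \<and>
      reflection v l $ i $ i = reflection v l $ j $ j) \<longleftrightarrow> i \<notin> {k} \<and> j \<notin> {k}"
    using ij by auto
qed

lemma roots_h_conj:
  fixes g :: "'n::{finite,linorder} mat"
  assumes n: "CARD('n) \<ge> 2" and g: "g \<in> GG" and R: "conj_by g (reflection v l) = Smat" and E: "moved E v l"
  shows "roots_h (conj_by g ` aa) = {rt g i j | i j. i \<noteq> j \<and> i \<notin> E \<and> j \<notin> E}"
proof -
  have "root_space (conj_by g ` aa) (rt g i j) \<inter> hh \<noteq> {0} \<longleftrightarrow> i \<notin> E \<and> j \<notin> E" if ij: "i \<noteq> j" for i j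
  proof -
    have mem: "conj_by g (unit_mat i j c) \<in> hh \<longleftrightarrow> c = 0 \<or> (i \<notin> E \<and> j \<notin> E)" for c
    proof -
      have "trace (unit_mat i j c) = 0"
        using ij by (auto simp: trace_def unit_mat_component intro!: sum.neutral)
      then have "conj_by g (unit_mat i j c) \<in> hh \<longleftrightarrow>
          reflection v l ** unit_mat i j c = unit_mat i j c ** reflection v l"
        using sigma_conj_by_iff[OF n g R] by (simp add: hh_def sl_def trace_conj_by[OF g])
      also have "\<dots> \<longleftrightarrow> unit_mat i j c ** reflection v l = reflection v l ** unit_mat i j c" by auto
      also have "\<dots> \<longleftrightarrow> c = 0 \<or> (i \<notin> E \<and> j \<notin> E)"
        unfolding unit_mat_commutes_iff using E ij by (simp add: moved_def)
      finally show ?thesis .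
    qed
    have "root_space (conj_by g ` aa) (rt g i j) \<inter> hh = {conj_by g (unit_mat i j c) | c. c = 0 \<or> (i \<notin> E \<and> j \<notin> E)}"
      unfolding root_space_rt[OF g ij] using mem by auto
    also have "\<dots> \<noteq> {0} \<longleftrightarrow> i \<notin> E \<and> j \<notin> E"
    proof
      assume "{conj_by g (unit_mat i j c) | c. c = 0 \<or> (i \<notin> E \<and> j \<notin> E)} \<noteq> {0}"
      then show "i \<notin> E \<and> j \<notin> E"
        by (rule contrapos_np) (auto simp: conj_by_0_iff[OF g] unit_mat_0_iff)
    next
      assume "i \<notin> E \<and> j \<notin> E"
      then have "conj_by g (unit_mat i j 1) \<in> {conj_by g (unit_mat i j c) | c. c = 0 \<or> (i \<notin> E \<and> j \<notin> E)}" by blast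
      moreover have "conj_by g (unit_mat i j 1) \<noteq> 0" by (simp add: conj_by_0_iff[OF g] unit_mat_0_iff)
      ultimately show "{conj_by g (unit_mat i j c) | c. c = 0 \<or> (i \<notin> E \<and> j \<notin> E)} \<noteq> {0}" by blast
    qed
    finally show ?thesis .
  qed
  then show ?thesis unfolding roots_h_def roots_conj_aa[OF g] by auto
qed

text \<open>The form \<open>\<rho>\<^sub>P\<^sub>,\<^sub>h\<close> as a vector. Only root spaces with both indices outside the set \<open>E\<close> of eigenlines
  on which \<open>S\<close> acts non-trivially meet \<^const>\<open>hh\<close>.\<close>

definition rvec :: "'n set \<Rightarrow> (real, 'n::{finite,linorder}) vec" where
  "rvec E = (\<chi> i. if i \<in> E then 0
     else (real (card {j. i < j \<and> j \<notin> E}) - real (card {j. j < i \<and> j \<notin> E})) / 2)"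

text \<open>For i outside \<open>E\<close>, x_i occurs with sign plus once for every larger index
  outside \<open>E\<close> and with sign minus once for every smaller one.\<close>

lemma sum_pairs_rvec:
  fixes x :: "(real, 'n::{finite,linorder}) vec"
  shows "(1/2) * (\<Sum>(i, j)\<in>{(i, j). i < j \<and> i \<notin> E \<and> j \<notin> E}. x $ i - x $ j) = (\<Sum>i\<in>UNIV. rvec E $ i * x $ i)"
proof -
  let ?U = "-E"
  have "(\<Sum>(i, j)\<in>{(i, j). i < j \<and> i \<notin> E \<and> j \<notin> E}. x $ i - x $ j)
      = (\<Sum>p\<in>{p. fst p < snd p \<and> fst p \<notin> E \<and> snd p \<notin> E}. x $ fst p)
       - (\<Sum>p\<in>{p. fst p < snd p \<and> fst p \<notin> E \<and> snd p \<notin> E}. x $ snd p)"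
    by (simp add: case_prod_unfold sum_subtractf)
  also have "{p. fst p < snd p \<and> fst p \<notin> E \<and> snd p \<notin> E} = Sigma ?U (\<lambda>i. {j. i < j \<and> j \<notin> E})" by auto
  also have "(\<Sum>p\<in>Sigma ?U (\<lambda>i. {j. i < j \<and> j \<notin> E}). x $ fst p) = (\<Sum>i\<in>?U. \<Sum>j\<in>{j. i < j \<and> j \<notin> E}. x $ i)"
    by (subst sum.Sigma) (auto simp: case_prod_unfold)
  also have "(\<Sum>p\<in>Sigma ?U (\<lambda>i. {j. i < j \<and> j \<notin> E}). x $ snd p) = (\<Sum>j\<in>?U. \<Sum>i\<in>{i. i < j \<and> i \<notin> E}. x $ j)"
    by (subst sum.Sigma) (auto simp: case_prod_unfold intro!: sum.reindex_bij_witness[of _ prod.swap prod.swap])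
  finally have "(\<Sum>(i, j)\<in>{(i, j). i < j \<and> i \<notin> E \<and> j \<notin> E}. x $ i - x $ j) = 
     (\<Sum>i\<in>?U. (real (card {j. i < j \<and> j \<notin> E}) - real (card {j. j < i \<and> j \<notin> E})) * x $ i)"
    by (simp add: sum_subtractf algebra_simps)
  then have "(1/2) * (\<Sum>(i, j)\<in>{(i, j). i < j \<and> i \<notin> E \<and> j \<notin> E}. x $ i - x $ j) = (\<Sum>i\<in>?U. rvec E $ i * x $ i)"
    by (simp add: sum_distrib_left rvec_def)
  also have "\<dots> = (\<Sum>i\<in>UNIV. rvec E $ i * x $ i)"
    by (rule sum.mono_neutral_left) (auto simp: rvec_def)
  finally show ?thesis .
qed

text \<open>Tested on the constant vector, where all differences vanish.\<close>

lemma sum_rvec: "sum (($) (rvec E)) UNIV = 0"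
  using sum_pairs_rvec[where E = E and x = "\<chi> i. 1"] by (simp add: case_prod_unfold)

lemma rho_h_conj:
  fixes g :: "'n::{finite,linorder} mat"
  assumes n: "CARD('n) \<ge> 2" and g: "g \<in> GG" and R: "conj_by g (reflection v l) = Smat" and E: "moved E v l"
    and x: "sum (($) x) UNIV = 0"
  shows "rho_h (conj_by g ` aa) (conj_by g ` BB) (conj_by g (diag x)) = (\<Sum>i\<in>UNIV. rvec E $ i * x $ i)"
proof -
  let ?I = "{(i, j). i < j \<and> i \<notin> E \<and> j \<notin> E}"
  have "roots_of (conj_by g ` aa) (conj_by g ` BB) \<inter> roots_h (conj_by g ` aa) = (\<lambda>(i, j). rt g i j) ` ?I"
    unfolding roots_of_conj[OF g] roots_h_conj[OF n g R E]
    by (auto simp: image_iff dest: rt_inj[OF g less_imp_neq])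
  moreover have "inj_on (\<lambda>(i, j). rt g i j) ?I"
    by (auto simp: inj_on_def dest: rt_inj[OF g less_imp_neq])
  ultimately have "rho_h (conj_by g ` aa) (conj_by g ` BB) (conj_by g (diag x))
      = (1/2) * (\<Sum>(i, j)\<in>?I. rt g i j (conj_by g (diag x)))"
    by (simp add: rho_h_def sum.reindex case_prod_unfold)
  also have "\<dots> = (1/2) * (\<Sum>(i, j)\<in>?I. x $ i - x $ j)" by (simp add: rt_conj_diag[OF g x])
  finally show ?thesis by (simp only: sum_pairs_rvec)
qed

lemma trace_conj_diag_mult:
  "g \<in> GG \<Longrightarrow> trace (conj_by g (diag x) ** conj_by g (diag y)) = (\<Sum>i\<in>UNIV. x $ i * y $ i)"
  by (simp add: conj_by_mult[symmetric] trace_conj_by diag_mult_diag trace_diag)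

lemma dual_vec_conj:
  assumes g: "g \<in> GG" and c: "sum (($) c) UNIV = 0"
    and \<alpha>: "\<And>x. sum (($) x) UNIV = 0 \<Longrightarrow> \<alpha> (conj_by g (diag x)) = (\<Sum>i\<in>UNIV. c $ i * x $ i)"
  shows "dual_vec (conj_by g ` aa) \<alpha> = conj_by g (diag c)"
  unfolding dual_vec_def
proof (rule the_equality)
  show "conj_by g (diag c) \<in> conj_by g ` aa \<and> (\<forall>X\<in>conj_by g ` aa. \<alpha> X = trace (conj_by g (diag c) ** X))"
    using c by (auto simp: aa_def \<alpha> trace_conj_diag_mult[OF g])
next
  fix T assume T: "T \<in> conj_by g ` aa \<and> (\<forall>X\<in>conj_by g ` aa. \<alpha> X = trace (T ** X))"
  then obtain t where t: "T = conj_by g (diag t)" "sum (($) t) UNIV = 0" by (auto simp: aa_def)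
  \<comment> \<open>Testing on the difference of the two candidates makes its sum of squares
    0.\<close>
  let ?x = "t - c"
  have x: "sum (($) ?x) UNIV = 0" using t(2) c by (simp add: sum_subtractf)
  then have "\<alpha> (conj_by g (diag ?x)) = trace (T ** conj_by g (diag ?x))" using T unfolding aa_def by blast
  then have "(\<Sum>i\<in>UNIV. c $ i * ?x $ i) = (\<Sum>i\<in>UNIV. t $ i * ?x $ i)"
    by (simp only: \<alpha>[OF x] t(1) trace_conj_diag_mult[OF g])
  moreover have "(\<Sum>i\<in>UNIV. (?x $ i)\<^sup>2) = (\<Sum>i\<in>UNIV. t $ i * ?x $ i) - (\<Sum>i\<in>UNIV. c $ i * ?x $ i)"
    by (simp add: power2_eq_square left_diff_distrib sum_subtractf)
  ultimately have "(\<Sum>i\<in>UNIV. (?x $ i)\<^sup>2) = 0" by simp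
  then have "?x $ i = 0" for i by (simp add: sum_nonneg_eq_0_iff)
  then have "t = c" by (simp add: vec_eq_iff)
  then show "T = conj_by g (diag c)" by (simp add: t(1))
qed

text \<open>With it, compatibility becomes monotonicity of the entries of \<open>rvec E\<close>:
  weak in rank one and strict in rank zero.\<close>

lemma dual_inner_rho_h:
  fixes g :: "'n::{finite,linorder} mat"
  assumes n: "CARD('n) \<ge> 2" and g: "g \<in> GG" and R: "conj_by g (reflection v l) = Smat" and E: "moved E v l"
  shows "dual_inner (conj_by g ` aa) (rt g i j) (rho_h (conj_by g ` aa) (conj_by g ` BB)) = rvec E $ i - rvec E $ j"
proof -
  have rt: "dual_vec (conj_by g ` aa) (rt g i j) = conj_by g (diag (axis_diff i j))"
    by (rule dual_vec_conj[OF g sum_axis_diff])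
      (simp add: rt_conj_diag[OF g] axis_diff_component left_diff_distrib sum_subtractf
        if_distrib[of "\<lambda>x. x * _"] cong: if_cong)
  have rho: "dual_vec (conj_by g ` aa) (rho_h (conj_by g ` aa) (conj_by g ` BB)) = conj_by g (diag (rvec E))"
    by (rule dual_vec_conj[OF g sum_rvec]) (rule rho_h_conj[OF n g R E])
  show ?thesis
    by (simp add: dual_inner_def rt rho trace_conj_diag_mult[OF g] axis_diff_component left_diff_distrib sum_subtractf
        if_distrib[of "\<lambda>x. x * _"] cong: if_cong)
qed

lemma h_compatible_swapI:
  fixes g :: "'n::{finite,linorder} mat"
  assumes n: "CARD('n) \<ge> 2" and g: "g \<in> GG" and R: "conj_by g (reflection v l) = Smat"
    and t: "swap_type a b v l" and r: "\<And>i j. i < j \<Longrightarrow> rvec {a, b} $ j \<le> rvec {a, b} $ i"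
  shows "conj_by g ` BB \<in> parab_P_h"
proof -
  have "conj_by g ` BB \<in> parab_P" unfolding parab_P_iff[OF n] using g R t by blast
  moreover have "stable_split_component (conj_by g ` BB) (conj_by g ` DP)"
    using stable_split_componentI[OF n g R] t by blast
  ultimately show ?thesis
    unfolding parab_P_h_def h_compatible_def
    using r by (auto simp: lie_conj_by[OF g] lie_DP roots_of_conj[OF g] dual_inner_rho_h[OF n g R moved_swap[OF t]]
        intro!: exI[of _ "conj_by g ` DP"])
qed

text \<open>The rank is defined through some stable split component, which may differ from the one
  that witnesses compatibility; \<open>swap_sign_exclusive\<close> ensures that both give the same
  type.\<close>

lemma h_compatible_cases:
  fixes P :: "'n::{finite,linorder} mat set"
  assumes n: "CARD('n) \<ge> 2" and P: "h_compatible P"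
  obtains (swap) g v l a b where "g \<in> GG" "P = conj_by g ` BB" "conj_by g (reflection v l) = Smat"
      "swap_type a b v l" "\<And>i j. i < j \<Longrightarrow> rvec {a, b} $ j \<le> rvec {a, b} $ i"
    | (sign) g v l k where "g \<in> GG" "P = conj_by g ` BB" "conj_by g (reflection v l) = Smat"
      "sign_type k v l" "\<And>i j. i < j \<Longrightarrow> rvec {k} $ j < rvec {k} $ i"
proof -
  obtain A where A: "stable_split_component P A"
    and c: "P \<in> parab_P \<and> (\<forall>\<alpha>\<in>roots_of (lie A) P. dual_inner (lie A) \<alpha> (rho_h (lie A) P) \<ge> 0) \<or>
      P \<in> parab_Q \<and> (\<forall>\<alpha>\<in>roots_of (lie A) P. dual_inner (lie A) \<alpha> (rho_h (lie A) P) > 0)"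
    using P by (auto simp: h_compatible_def)
  have mp: "minimal_parabolic P" using c by (auto simp: parab_P_def parab_Q_def)
  obtain g v l where g: "g \<in> GG" "P = conj_by g ` BB" "A = conj_by g ` DP" "conj_by g (reflection v l) = Smat"
    and t: "(\<exists>a b. swap_type a b v l) \<or> (\<exists>k. sign_type k v l)"
    using stable_split_component_cases[OF n mp A] by metis
  have la: "lie A = conj_by g ` aa" by (simp add: g(3) lie_conj_by[OF g(1)] lie_DP)
  note inner = dual_inner_rho_h[OF n g(1) g(4)]
  from t show ?thesis
  proof
    assume "\<exists>a b. swap_type a b v l"
    then obtain a b where ab: "swap_type a b v l" by blast
    have "P \<notin> parab_Q"
    proof
      assume "P \<in> parab_Q"
      then obtain h v' l' k where h: "h \<in> GG" "P = conj_by h ` BB" "conj_by h (reflection v' l') = Smat" "sign_type k v' l'"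
        using parab_Q_cases[OF n] by blast
      then show False using swap_sign_exclusive[OF n h(1,3,4) g(1,4) ab] g(2) h(2) by simp
    qed
    with c have r: "\<forall>\<alpha>\<in>roots_of (lie A) P. dual_inner (lie A) \<alpha> (rho_h (lie A) P) \<ge> 0" by blast
    have "rvec {a, b} $ j \<le> rvec {a, b} $ i" if "i < j" for i j
    proof -
      have "rt g i j \<in> roots_of (lie A) P" using that by (auto simp: la g(2) roots_of_conj[OF g(1)])
      with r show ?thesis using inner[OF moved_swap[OF ab], of i j] by (auto simp: la g(2))
    qed
    then show ?thesis using swap[OF g(1,2,4) ab] by blast
  next
    assume "\<exists>k. sign_type k v l"
    then obtain k where k: "sign_type k v l" by blast
    have "P \<notin> parab_P"
    proof
      assume "P \<in> parab_P"
      then obtain h v' l' a b where h: "h \<in> GG" "P = conj_by h ` BB" "conj_by h (reflection v' l') = Smat" "swap_type a b v' l'"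
        unfolding parab_P_iff[OF n] by blast
      then show False using swap_sign_exclusive[OF n g(1,4) k h(1,3,4)] g(2) h(2) by simp
    qed
    with c have r: "\<forall>\<alpha>\<in>roots_of (lie A) P. dual_inner (lie A) \<alpha> (rho_h (lie A) P) > 0" by blast
    have "rvec {k} $ j < rvec {k} $ i" if "i < j" for i j
    proof -
      have "rt g i j \<in> roots_of (lie A) P" using that by (auto simp: la g(2) roots_of_conj[OF g(1)])
      with r show ?thesis using inner[OF moved_sign[OF k], of i j] by (auto simp: la g(2))
    qed
    then show ?thesis using sign[OF g(1,2,4) k] by blast
  qed
qed

section \<open>Normal form relative to a flag\<close>

text \<open>The matrix of \<open>S\<close> in a basis adapted to a flag but not to a \<open>\<sigma>\<close>-stable split component. Its
  advantage over \<^const>\<open>swap_type\<close> is that both \<^const>\<open>swap_type\<close> and \<^const>\<open>sign_type\<close> reduce to it,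
  the latter for \<open>e = 0\<close>, so that rank zero becomes a limit of rank one.\<close>

definition flag_refl :: "'n::finite \<Rightarrow> 'n \<Rightarrow> real \<Rightarrow> 'n mat" where
  "flag_refl l k e = reflection (axis k 1) (axis k 1 + axis l e)"

lemma conj_by_trv_flag_refl:
  assumes "l \<noteq> k"
  shows "conj_by (trv l k c) (flag_refl l k e) = reflection (axis k 1 + axis l c) (axis k (1 - c * e) + axis l e)"
proof -
  have "trv l k c *v axis k 1 = axis k 1 + axis l c" by (simp add: trv_mult_vec axis_def)
  moreover have "(axis k 1 + axis l e) v* matrix_inv (trv l k c) = axis k (1 - c * e) + axis l e"
    using assms by (auto simp: matrix_inv_trv vec_mult_trv vec_eq_iff axis_def)
  ultimately show ?thesis by (simp add: flag_refl_def conj_by_refl[OF trv_in_GG[OF assms]])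
qed

lemma swap_type_imp_flag_refl:
  fixes g :: "'n::{finite,linorder} mat"
  assumes g: "g \<in> GG" and R: "conj_by g (reflection v l) = Smat" and t: "swap_type a b v l"
  obtains q e where "q \<in> GG" "e \<noteq> 0" "conj_by q ` BB = conj_by g ` BB" "conj_by q (flag_refl a b e) = Smat"
proof -
  have ab: "a < b" "v $ a * l $ a = 1/2" "v $ b * l $ b = 1/2" "\<And>c. c \<noteq> a \<Longrightarrow> c \<noteq> b \<Longrightarrow> v $ c = 0 \<and> l $ c = 0"
    using t by (auto simp: swap_type_def)
  \<comment> \<open>Scaling the pair so that v_b = 1 gives the vector the entry \<open>c\<close> at
    a, to be removed by a shear, and gives the form the entry \<open>e\<close> there. Their product
    is v_a l_a = 1/2.\<close>
  define c where "c = v $ a / v $ b"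
  define e where "e = v $ b * l $ a"
  have nz: "v $ b \<noteq> 0" "e \<noteq> 0" using ab(2,3) by (auto simp: e_def)
  have ce: "c * e = 1/2" using nz ab(2) by (simp add: c_def e_def)
  have "v $ b *\<^sub>R (axis b 1 + axis a c) = v" "v $ b *\<^sub>R l = axis b (1/2) + axis a e"
    using ab nz by (auto simp: vec_eq_iff axis_def c_def e_def)
  then have "reflection v l = reflection (axis b 1 + axis a c) (axis b (1/2) + axis a e)"
    using refl_scale[OF nz(1), of "axis b 1 + axis a c" l] by simp
  also have "\<dots> = conj_by (trv a b c) (flag_refl a b e)" unfolding conj_by_trv_flag_refl[OF less_imp_neq[OF ab(1)]] by (simp add: ce)
  finally have eq: "reflection v l = conj_by (trv a b c) (flag_refl a b e)" .
  have u: "trv a b c \<in> GG" "trv a b c \<in> BB" using ab(1) trv_in_UU UU_subset_GG UU_subset_BB by blast+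
  show ?thesis
  proof (rule that[of "g ** trv a b c" e])
    show "conj_by (g ** trv a b c) ` BB = conj_by g ` BB"
      using g u by (simp add: conj_by_image_comp[symmetric] conj_by_BB)
    show "conj_by (g ** trv a b c) (flag_refl a b e) = Smat"
      using g u R by (simp add: conj_by_conj_by[symmetric] eq)
  qed (use g u nz mult_in_GG in auto)
qed

lemma flag_refl_imp_swap_type:
  fixes q :: "'n::{finite,linorder} mat"
  assumes q: "q \<in> GG" and R: "conj_by q (flag_refl l k e) = Smat" and e: "e \<noteq> 0" and lk: "l < k"
  obtains g v w where "g \<in> GG" "conj_by g ` BB = conj_by q ` BB" "conj_by g (reflection v w) = Smat" "swap_type l k v w"
proof -
  \<comment> \<open>Chosen so that after the shear both products of entries, c e at l and 1 - c e at
    k, equal 1/2.\<close>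
  define c where "c = 1 / (2 * e)"
  have ce: "c * e = 1/2" using e by (simp add: c_def)
  let ?u = "trv l k c"
  have u: "?u \<in> GG" "?u \<in> BB" using lk trv_in_UU UU_subset_GG UU_subset_BB by blast+
  have u': "matrix_inv ?u \<in> GG" "matrix_inv ?u \<in> BB" using u GG_inverse BB_inverse by auto
  show ?thesis
  proof (rule that[of "q ** matrix_inv ?u" "axis k 1 + axis l c" "axis k (1/2) + axis l e"])
    show "conj_by (q ** matrix_inv ?u) ` BB = conj_by q ` BB"
      using q u' by (simp add: conj_by_image_comp[symmetric] conj_by_BB)
    have "reflection (axis k 1 + axis l c) (axis k (1/2) + axis l e) = conj_by ?u (flag_refl l k e)"
      unfolding conj_by_trv_flag_refl[OF less_imp_neq[OF lk]] by (simp add: ce)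
    then show "conj_by (q ** matrix_inv ?u) (reflection (axis k 1 + axis l c) (axis k (1/2) + axis l e)) = Smat"
      using q u u' R by (simp add: conj_by_conj_by[symmetric] conj_by_inverse)
    show "swap_type l k (axis k 1 + axis l c) (axis k (1/2) + axis l e)"
      using lk ce by (auto simp: swap_type_def axis_def)
  qed (use q u' mult_in_GG in auto)
qed

text \<open>For e = 0 the index \<open>i\<close> is free. It is chosen later as the predecessor of
  k, so that nearby values of e give adjacent pairs.\<close>

lemma sign_type_imp_flag_refl:
  assumes "sign_type k v l"
  shows "reflection v l = flag_refl i k 0"
proof -
  have "v $ a * l $ b = axis k 1 $ a * axis k 1 $ b" for a b
    using assms by (cases "a = k"; cases "b = k") (auto simp: sign_type_def axis_def)
  then show ?thesis by (simp add: flag_refl_def vec_eq_iff refl_component axis_def)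
qed

abbreviation adjacent :: "'n::linorder \<Rightarrow> 'n \<Rightarrow> bool" where
  "adjacent l k \<equiv> l < k \<and> (\<forall>c. \<not> (l < c \<and> c < k))"

text \<open>X commutes with the reflection of a pair (v, w) iff X v is a multiple of v and w X is
  the same multiple of w. For strictly upper triangular X the entry of X e_k at k is 0, so the
  multiple is 0.\<close>

lemma NN_Int_commutant_flag_refl:
  assumes lk: "l < k"
  shows "NN \<inter> commutant (flag_refl l k e) = {X \<in> NN. (\<forall>i. X $ i $ k = 0) \<and> (\<forall>j. X $ k $ j = - e * X $ l $ j)}"
proof -
  let ?L = "axis k 1 + axis l e"
  have "X ** flag_refl l k e = flag_refl l k e ** X \<longleftrightarrow> (\<forall>i. X $ i $ k = 0) \<and> (\<forall>j. X $ k $ j = - e * X $ l $ j)"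
    if X: "X \<in> NN" for X
  proof -
    have "X ** flag_refl l k e = flag_refl l k e ** X \<longleftrightarrow> outer (X *v axis k 1) ?L = outer (axis k 1) (?L v* X)"
      unfolding flag_refl_def reflection_def
      by (simp add: linear_diff[OF linear_matrix_mult_left] linear_diff[OF linear_matrix_mult_right]
        linear_scale[OF linear_matrix_mult_left] linear_scale[OF linear_matrix_mult_right] mult_outer outer_mult)
    also have "\<dots> \<longleftrightarrow> X *v axis k 1 = 0 \<and> ?L v* X = 0"
    proof
      assume eq: "outer (X *v axis k 1) ?L = outer (axis k 1) (?L v* X)"
      have c: "(X *v axis k 1) $ i * ?L $ j = axis k 1 $ i * (?L v* X) $ j" for i j
        using arg_cong[OF eq, of "\<lambda>Z. Z $ i $ j"] by (simp add: outer_component)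
      have "(X *v axis k 1) $ k = 0"
        using X by (simp add: matrix_vector_mult_def NN_def axis_def if_distrib[of "\<lambda>x. _ * x"] cong: if_cong)
      then have L: "(?L v* X) $ j = 0" for j using c[of k j] by (simp add: axis_def)
      moreover have "?L $ k = 1" using lk by (auto simp: axis_def)
      ultimately have "(X *v axis k 1) $ i = 0" for i using c[of i k] by simp
      with L show "X *v axis k 1 = 0 \<and> ?L v* X = 0" by (simp add: vec_eq_iff)
    next
      assume "X *v axis k 1 = 0 \<and> ?L v* X = 0"
      then show "outer (X *v axis k 1) ?L = outer (axis k 1) (?L v* X)" by (simp add: outer_def)
    qed
    also have "X *v axis k 1 = 0 \<longleftrightarrow> (\<forall>i. X $ i $ k = 0)"
      by (simp add: vec_eq_iff matrix_vector_mult_def axis_def if_distrib[of "\<lambda>x. _ * x"] cong: if_cong)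
    also have "?L v* X = 0 \<longleftrightarrow> (\<forall>j. X $ k $ j = - e * X $ l $ j)"
    proof -
      have "(?L v* X) $ j = X $ k $ j + e * X $ l $ j" for j
        by (simp add: vector_matrix_mult_def axis_def distrib_right sum.distrib if_distrib[of "\<lambda>x. x * _"] cong: if_cong)
      then show ?thesis by (simp add: vec_eq_iff eq_neg_iff_add_eq_0)
    qed
    finally show ?thesis .
  qed
  then show ?thesis by (auto simp: commutant_def)
qed

text \<open>The positions that determine an element of the Lie algebra of the stabiliser, in which
  column k vanishes and row k is a multiple of row l.\<close>

definition upper_pairs :: "'n::{finite,linorder} \<Rightarrow> ('n \<times> 'n) set" where
  "upper_pairs k = {(i, j). i < j \<and> i \<noteq> k \<and> j \<noteq> k}"

lemma card_upper_pairs: "card (upper_pairs (k :: 'n::{finite,linorder})) = (CARD('n) - 1) choose 2"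
proof -
  have "bij_betw (\<lambda>(i, j). {i, j}) (upper_pairs k) {B. B \<subseteq> UNIV - {k} \<and> card B = 2}"
    unfolding bij_betw_def
  proof
    show "inj_on (\<lambda>(i, j). {i, j}) (upper_pairs k)"
      by (auto simp: inj_on_def upper_pairs_def doubleton_eq_iff)
    show "(\<lambda>(i, j). {i, j}) ` upper_pairs k = {B. B \<subseteq> UNIV - {k} \<and> card B = 2}"
    proof (intro subset_antisym subsetI)
      fix B assume "B \<in> {B. B \<subseteq> UNIV - {k} \<and> card B = 2}"
      then obtain x y where xy: "B = {x, y}" "x \<noteq> y" "x \<noteq> k" "y \<noteq> k" by (auto simp: card_2_iff)
      then have "(min x y, max x y) \<in> upper_pairs k" "B = {min x y, max x y}"
        by (auto simp: upper_pairs_def min_def max_def)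
      then show "B \<in> (\<lambda>(i, j). {i, j}) ` upper_pairs k" by force
    qed (auto simp: upper_pairs_def)
  qed
  from bij_betw_same_card[OF this] show ?thesis by (simp add: n_subsets)
qed

lemma dim_support:
  "dim {X :: real^'n^'n. \<forall>i j. (i, j) \<notin> I \<longrightarrow> X $ i $ j = 0} = card I"
proof -
  let ?f = "\<lambda>(i, j). axis i (axis j 1) :: real^'n^'n"
  have inj: "inj_on ?f A" for A by (auto simp: inj_on_def axis_eq_axis)
  have B: "(Basis :: (real^'n^'n) set) = range ?f" by (auto simp: Basis_vec_def)
  have "{X :: real^'n^'n. \<forall>i j. (i, j) \<notin> I \<longrightarrow> X $ i $ j = 0} = {X. \<forall>b\<in>Basis. b \<notin> ?f ` I \<longrightarrow> X \<bullet> b = 0}"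
  proof -
    have "axis i (axis j 1) \<in> ?f ` I \<longleftrightarrow> (i, j) \<in> I" for i j
      using inj_image_mem_iff[OF inj[of UNIV], of "(i, j)" I] by simp
    then show ?thesis unfolding B by (simp add: inner_axis)
  qed
  also have "dim \<dots> = card (?f ` I)" by (rule dim_substandard) (auto simp: B)
  also have "\<dots> = card I" by (rule card_image[OF inj])
  finally show ?thesis .
qed

text \<open>Deleting row k and column k loses no information, which gives the bound. For adjacent l
  and k every strictly upper triangular remainder extends back; otherwise the relation between the
  rows k and l can impose further zeros.\<close>

lemma dim_NN_commutant:
  fixes l k :: "'n::{finite,linorder}"
  assumes lk: "l < k"
  shows "dim (NN \<inter> commutant (flag_refl l k e)) \<le> (CARD('n) - 1) choose 2"
    and "adjacent l k \<Longrightarrow> dim (NN \<inter> commutant (flag_refl l k e)) = (CARD('n) - 1) choose 2"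
proof -
  let ?W = "NN \<inter> commutant (flag_refl l k e)"
  let ?E = "{X :: 'n mat. \<forall>i j. (i, j) \<notin> upper_pairs k \<longrightarrow> X $ i $ j = 0}"
  let ?f = "\<lambda>X :: 'n mat. (\<chi> i j. if i = k \<or> j = k then 0 else X $ i $ j) :: 'n mat"
  note W = NN_Int_commutant_flag_refl[OF lk, of e]
  have lin: "linear ?f" by (rule linearI) (auto simp: vec_eq_iff)
  have sW: "subspace ?W"
    unfolding W by (auto simp: subspace_def NN_def algebra_simps)
  have "inj_on ?f ?W"
  proof (rule inj_onI)
    fix X Y assume X: "X \<in> ?W" and Y: "Y \<in> ?W" and eq: "?f X = ?f Y"
    have e: "X $ i $ j = Y $ i $ j" if "i \<noteq> k" "j \<noteq> k" for i j
      using arg_cong[OF eq, of "\<lambda>Z. Z $ i $ j"] that by simp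
    have "X $ i $ j = Y $ i $ j" for i j
    proof (cases "i = k")
      case True
      have "X $ k $ j = - e * X $ l $ j" "Y $ k $ j = - e * Y $ l $ j" using X Y unfolding W by auto
      moreover have "X $ l $ j = Y $ l $ j" using e[of l j] lk X Y unfolding W by (cases "j = k") auto
      ultimately show ?thesis using True by simp
    next
      case False
      then show ?thesis using e[of i j] X Y unfolding W by (cases "j = k") auto
    qed
    then show "X = Y" by (simp add: vec_eq_iff)
  qed
  then have d: "dim (?f ` ?W) = dim ?W"
    using sW by (intro dim_image_eq[OF lin]) (simp add: span_eq_iff[THEN iffD2, OF sW])
  have sub: "?f ` ?W \<subseteq> ?E" by (auto simp: upper_pairs_def NN_def)
  have dE: "dim ?E = (CARD('n) - 1) choose 2" by (simp only: dim_support card_upper_pairs)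
  show "dim ?W \<le> (CARD('n) - 1) choose 2" using dim_subset[OF sub] d dE by simp
  assume adj: "adjacent l k"
  have "?E \<subseteq> ?f ` ?W"
  proof
    fix Y assume Y: "Y \<in> ?E"
    have Y0: "Y $ i $ j = 0" if "j \<le> i \<or> i = k \<or> j = k" for i j
    proof -
      have "(i, j) \<notin> upper_pairs k" using that by (auto simp: upper_pairs_def)
      then show ?thesis using Y by blast
    qed
    \<comment> \<open>Row k is reconstructed from row l. It remains strictly upper triangular
      because a column other than k beyond l is also beyond k.\<close>
    define X :: "'n mat" where "X = (\<chi> i j. if j = k then 0 else if i = k then - e * Y $ l $ j else Y $ i $ j)"
    have "X $ i $ j = 0" if "j \<le> i" for i j
    proof (cases "i = k \<and> j \<noteq> k")
      case True
      then have "j \<le> l" using adj that by (metis not_le order_le_less)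
      then show ?thesis using True Y0 by (simp add: X_def)
    qed (use that Y0 in \<open>auto simp: X_def\<close>)
    then have "X \<in> ?W" unfolding W using lk by (auto simp: NN_def X_def)
    moreover have "?f X = Y" using Y0 by (auto simp: vec_eq_iff X_def)
    ultimately show "Y \<in> ?f ` ?W" by (metis (no_types, lifting) imageI)
  qed
  with sub have "?f ` ?W = ?E" by blast
  then show "dim ?W = (CARD('n) - 1) choose 2" using d dE by simp
qed

lemma Dim_unip_radical_Int_HH:
  fixes q :: "'n::{finite,linorder} mat"
  assumes n: "CARD('n) \<ge> 2" and q: "q \<in> GG" and R: "conj_by q (flag_refl l k e) = Smat"
  shows "Dim (unip_radical (conj_by q ` BB) \<inter> HH) = dim (NN \<inter> commutant (flag_refl l k e))"
  unfolding unip_radical_conj_BB[OF q]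
  by (subst Dim_conj_Int_HH[OF n q R]) (auto simp: lie_UU UU_subset_GG)

text \<open>Every member of \<open>parab_P\<close> has a base point of the form
  \<open>flag_refl\<close>, so the bound of \<open>dim_NN_commutant\<close> holds for all of them,
  and an adjacent pair attains it.\<close>

lemma adjacent_in_parab_P_star:
  fixes q :: "'n::{finite,linorder} mat"
  assumes n: "CARD('n) \<ge> 2" and q: "q \<in> GG" and R: "conj_by q (flag_refl l k e) = Smat" and e: "e \<noteq> 0"
    and adj: "adjacent l k"
  shows "conj_by q ` BB \<in> parab_P_star"
proof -
  let ?D = "{Dim (unip_radical Q \<inter> HH) | Q :: 'n mat set. Q \<in> parab_P}"
  have P: "conj_by q ` BB \<in> parab_P"
    using flag_refl_imp_swap_type[OF q R e] adj unfolding parab_P_iff[OF n] by metis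
  have dP: "Dim (unip_radical (conj_by q ` BB) \<inter> HH) = (CARD('n) - 1) choose 2"
    using Dim_unip_radical_Int_HH[OF n q R] dim_NN_commutant(2)[of l k e] adj by simp
  have le: "d \<le> (CARD('n) - 1) choose 2" if "d \<in> ?D" for d
  proof -
    from that obtain Q :: "'n mat set" where Q: "Q \<in> parab_P" "d = Dim (unip_radical Q \<inter> HH)" by blast
    then obtain g v w a b where g: "g \<in> GG" "Q = conj_by g ` BB" "conj_by g (reflection v w) = Smat" "swap_type a b v w"
      unfolding parab_P_iff[OF n] by blast
    obtain q' e' where q': "q' \<in> GG" "conj_by q' ` BB = conj_by g ` BB" "conj_by q' (flag_refl a b e') = Smat"
      using swap_type_imp_flag_refl[OF g(1,3,4)] by metis
    have "a < b" using g(4) by (simp add: swap_type_def)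
    then show ?thesis
      using Dim_unip_radical_Int_HH[OF n q'(1,3)] dim_NN_commutant(1)[of a b e'] Q(2) g(2) q'(2) by simp
  qed
  have "Max ?D = (CARD('n) - 1) choose 2"
  proof (rule Max_eqI)
    show "finite ?D" using le by (meson finite_nat_set_iff_bounded_le)
    show "(CARD('n) - 1) choose 2 \<in> ?D" using P dP[symmetric] by blast
  qed (rule le)
  then show ?thesis using P dP by (simp add: parab_P_star_def)
qed

section \<open>Monotonicity of the vector of rho\<close>

lemma rvec_component:
  "i \<notin> E \<Longrightarrow> rvec E $ i = (real (card {j. i < j \<and> j \<notin> E}) - real (card {j. j < i \<and> j \<notin> E})) / 2"
  "i \<in> E \<Longrightarrow> rvec E $ i = 0"
  by (simp_all add: rvec_def)

lemma rvec_strict: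
  assumes "i \<notin> E" "j \<notin> E" "i < j"
  shows "rvec E $ j < rvec E $ i"
proof -
  have "card {a. j < a \<and> a \<notin> E} < card {a. i < a \<and> a \<notin> E}"
    using assms by (intro psubset_card_mono) auto
  moreover have "card {a. a < i \<and> a \<notin> E} < card {a. a < j \<and> a \<notin> E}"
    using assms by (intro psubset_card_mono) auto
  ultimately show ?thesis using assms by (simp add: rvec_component)
qed

text \<open>The entries at a and b are 0, so every entry between them is squeezed to 0. Strict
  decrease outside {a, b} leaves room for at most one such index m, and a zero entry means equally
  many indices on both sides of m.\<close>

lemma antitone_rvec_cases:
  fixes a b :: "'n::{finite,linorder}"
  assumes ab: "a < b" and anti: "\<And>i j. i < j \<Longrightarrow> rvec {a, b} $ j \<le> rvec {a, b} $ i"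
  shows "adjacent a b \<or>
    (\<exists>m. a < m \<and> m < b \<and> (\<forall>c. a < c \<and> c < b \<longrightarrow> c = m) \<and> card {j. j < m} = card {j. m < j})"
proof (rule disjCI)
  assume "\<not> (\<exists>m. a < m \<and> m < b \<and> (\<forall>c. a < c \<and> c < b \<longrightarrow> c = m) \<and> card {j. j < m} = card {j. m < j})"
  moreover have zero: "rvec {a, b} $ c = 0" if "a < c" "c < b" for c
    using anti[OF that(1)] anti[OF that(2)] by (simp add: rvec_component)
  have uniq: "c = c'" if "a < c" "c < b" "a < c'" "c' < b" for c c'
    using zero[of c] zero[of c'] rvec_strict[of c "{a, b}" c'] rvec_strict[of c' "{a, b}" c] that
    by (cases c c' rule: linorder_cases) auto
  have "card {j. j < m} = card {j. m < j}" if m: "a < m" "m < b" for m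
  proof -
    have 1: "{j. m < j} = insert b {j. m < j \<and> j \<notin> {a, b}}" "{j. j < m} = insert a {j. j < m \<and> j \<notin> {a, b}}"
      using m by auto
    have "card {j. m < j \<and> j \<notin> {a, b}} = card {j. j < m \<and> j \<notin> {a, b}}"
    proof -
      have "m \<notin> {a, b}" using m by auto
      from rvec_component(1)[OF this] zero[OF m] show ?thesis by simp
    qed
    then show ?thesis unfolding 1 by simp
  qed
  ultimately show "adjacent a b" using uniq ab by metis
qed

lemma card_less_pred:
  fixes l k :: "'n::{finite,linorder}"
  assumes "adjacent l k"
  shows "card {j. j < k} = Suc (card {j. j < l})" "card {j. l < j} = Suc (card {j. k < j})"
proof -
  have "j < k \<longleftrightarrow> j = l \<or> j < l" "l < j \<longleftrightarrow> j = k \<or> k < j" for j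
    using assms by (metis linorder_neqE order.strict_trans)+
  then have "{j. j < k} = insert l {j. j < l}" "{j. l < j} = insert k {j. k < j}" by auto
  then show "card {j. j < k} = Suc (card {j. j < l})" "card {j. l < j} = Suc (card {j. k < j})" by auto
qed

lemma exists_pred:
  fixes k :: "'n::{finite,linorder}"
  assumes "j < k" shows "\<exists>l. adjacent l k"
proof -
  have "Max {j. j < k} \<in> {j. j < k}" using assms by (intro Max_in) auto
  then show ?thesis using Max_ge[of "{j. j < k}"] by (metis finite mem_Collect_eq not_less)
qed

lemma exists_succ:
  fixes k :: "'n::{finite,linorder}"
  assumes "k < j" shows "\<exists>l. adjacent k l"
proof -
  have "Min {j. k < j} \<in> {j. k < j}" using assms by (intro Min_in) auto
  then show ?thesis using Min_le[of "{j. k < j}"] by (metis finite mem_Collect_eq not_less)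
qed

text \<open>The entry at k is 0. If there are more indices below k than above, the entry at the
  predecessor of k is not positive; in the opposite case the entry at the successor is not
  negative.\<close>

lemma strict_rvec_balanced:
  fixes k :: "'n::{finite,linorder}"
  assumes anti: "\<And>i j. i < j \<Longrightarrow> rvec {k} $ j < rvec {k} $ i"
  shows "card {j. j < k} = card {j. k < j}"
proof (rule ccontr)
  assume "\<not> ?thesis"
  then consider "card {j. j < k} > card {j. k < j}" | "card {j. j < k} < card {j. k < j}" by linarith
  then show False
  proof cases
    case 1
    then have "{j. j < k} \<noteq> {}" by (metis card.empty not_less_zero)
    then obtain l where l: "adjacent l k" using exists_pred by blast
    have "l < j \<and> j \<noteq> k \<longleftrightarrow> k < j" "j < l \<and> j \<noteq> k \<longleftrightarrow> j < l" for j
      using l by (metis linorder_neqE order.strict_trans)+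
    then have S: "{j. l < j \<and> j \<notin> {k}} = {j. k < j}" "{j. j < l \<and> j \<notin> {k}} = {j. j < l}" by auto
    have lk: "l \<notin> {k}" using l by auto
    have "rvec {k} $ l = (real (card {j. k < j}) - real (card {j. j < l})) / 2"
      by (simp only: rvec_component(1)[OF lk] S)
    then show False using anti[of l k] l 1 card_less_pred(1)[OF l] by (simp add: rvec_component(2))
  next
    case 2
    then have "{j. k < j} \<noteq> {}" by (metis card.empty not_less_zero)
    then obtain l where l: "adjacent k l" using exists_succ by blast
    have "l < j \<and> j \<noteq> k \<longleftrightarrow> l < j" "j < l \<and> j \<noteq> k \<longleftrightarrow> j < k" for j
      using l by (metis linorder_neqE order.strict_trans)+
    then have S: "{j. l < j \<and> j \<notin> {k}} = {j. l < j}" "{j. j < l \<and> j \<notin> {k}} = {j. j < k}" by auto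
    have lk: "l \<notin> {k}" using l by auto
    have "rvec {k} $ l = (real (card {j. l < j}) - real (card {j. j < k})) / 2"
      by (simp only: rvec_component(1)[OF lk] S)
    then show False using anti[of k l] l 2 card_less_pred(2)[OF l] by (simp add: rvec_component(2))
  qed
qed

text \<open>Entries outside {l, k} decrease strictly and those on it are 0, so only signs matter.
  Counts that differ by at most one make the entries before l nonnegative and those after k
  nonpositive.\<close>

lemma rvec_antitone:
  fixes l k :: "'n::{finite,linorder}"
  assumes adj: "adjacent l k"
    and c: "card {j. j < l} \<le> card {j. k < j} + 1" "card {j. k < j} \<le> card {j. j < l} + 1"
    and ij: "i < j"
  shows "rvec {l, k} $ j \<le> rvec {l, k} $ i"
proof -
  let ?E = "{l, k}"
  have lower_part: "rvec ?E $ i \<ge> 0" if "i < l" for i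
  proof -
    have "i \<notin> ?E" using that adj by auto
    have "card {j. k < j} \<le> card {j. i < j \<and> j \<notin> ?E}" using that adj by (intro card_mono) auto
    moreover have "card {j. j < i \<and> j \<notin> ?E} < card {j. j < l}"
      using that by (intro psubset_card_mono) auto
    ultimately show ?thesis using c(1) \<open>i \<notin> ?E\<close> by (simp add: rvec_component)
  qed
  have upper_part: "rvec ?E $ j \<le> 0" if "k < j" for j
  proof -
    have "j \<notin> ?E" using that adj by auto
    have "card {i. i < l} \<le> card {i. i < j \<and> i \<notin> ?E}" using that adj by (intro card_mono) auto
    moreover have "card {i. j < i \<and> i \<notin> ?E} < card {i. k < i}"
      using that by (intro psubset_card_mono) auto
    ultimately show ?thesis using c(2) \<open>j \<notin> ?E\<close> by (simp add: rvec_component)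
  qed
  have next_k: "k < c" if "l < c" "c \<noteq> k" for c using adj that by (metis linorder_neqE)
  have prev_l: "c < l" if "c < k" "c \<noteq> l" for c using adj that by (metis linorder_neqE)
  consider "i \<in> ?E" "j \<in> ?E" | "i \<notin> ?E" "j \<notin> ?E" | "i \<in> ?E" "j \<notin> ?E" | "i \<notin> ?E" "j \<in> ?E" by blast
  then show ?thesis
  proof cases
    case 1 then show ?thesis by (simp add: rvec_component)
  next
    case 2 then show ?thesis using rvec_strict[OF 2 ij] by simp
  next
    case 3
    then have "k < j" using ij next_k[of j] by auto
    then show ?thesis using upper_part 3 by (simp add: rvec_component(2))
  next
    case 4
    then have "i < l" using ij prev_l[of i] by auto
    then show ?thesis using lower_part 4 by (simp add: rvec_component(2))
  qed
qed

lemma flag_refl_in_parab_P_h: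
  fixes q :: "'n::{finite,linorder} mat"
  assumes n: "CARD('n) \<ge> 2" and q: "q \<in> GG" and R: "conj_by q (flag_refl l k e) = Smat" and e: "e \<noteq> 0" and lk: "l < k"
    and anti: "\<And>i j. i < j \<Longrightarrow> rvec {l, k} $ j \<le> rvec {l, k} $ i"
  shows "conj_by q ` BB \<in> parab_P_h"
proof -
  obtain g v w where g: "g \<in> GG" "conj_by g ` BB = conj_by q ` BB" "conj_by g (reflection v w) = Smat" "swap_type l k v w"
    by (rule flag_refl_imp_swap_type[OF q R e lk])
  show ?thesis unfolding g(2)[symmetric] by (rule h_compatible_swapI[OF n g(1,3,4) anti])
qed

section \<open>Measures invariant under translations\<close>

lemma lborel_diag_affine:
  fixes t c :: "real^'n"
  assumes c: "\<And>j. c $ j \<noteq> 0" "(\<Prod>j\<in>UNIV. \<bar>c $ j\<bar>) = 1"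
  shows "distr lborel borel (\<lambda>x. \<chi> j. t $ j + c $ j * x $ j) = lborel"
proof -
  have inj: "inj (\<lambda>j::'n. axis j (1::real))" by (auto simp: inj_def axis_eq_axis)
  have B: "(Basis :: (real^'n) set) = (\<lambda>j. axis j 1) ` UNIV" by (auto simp: Basis_vec_def)
  have "(\<Sum>b\<in>Basis. ((c \<bullet> b) * (x \<bullet> b)) *\<^sub>R b) $ i = c $ i * x $ i" for x i
  proof -
    have "axis j (1::real) $ i = (if i = j then 1 else 0)" for j by (simp add: axis_def)
    then show ?thesis
      unfolding B by (subst sum.reindex[OF inj])
        (simp add: inner_axis sum_component if_distrib[of "\<lambda>x. _ * x"] cong: if_cong)
  qed
  then have eq: "t + (\<Sum>b\<in>Basis. ((c \<bullet> b) * (x \<bullet> b)) *\<^sub>R b) = (\<chi> j. t $ j + c $ j * x $ j)" for x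
    by (simp add: vec_eq_iff)
  have p: "(\<Prod>b\<in>Basis. \<bar>c \<bullet> b\<bar>) = 1"
    unfolding B by (subst prod.reindex[OF inj]) (simp add: inner_axis c(2))
  have "c \<bullet> b \<noteq> 0" if "b \<in> Basis" for b using that c(1) by (auto simp: B inner_axis)
  from lborel_affine_euclidean[of "\<lambda>b. c \<bullet> b" t, OF this] show ?thesis
    by (simp add: eq p density_1)
qed

definition put :: "'n::finite \<Rightarrow> (real, 'n) vec \<Rightarrow> real \<Rightarrow> (real, 'n) vec" where
  "put k z y = (\<chi> j. if j = k then y else z $ j)"

lemma put_component: "put k z y $ j = (if j = k then y else z $ j)"
  by (simp add: put_def)

definition slab :: "'n::finite \<Rightarrow> (real, 'n) vec set" where
  "slab k = {z. 0 \<le> z $ k \<and> z $ k \<le> 1}"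

text \<open>A cylinder, unrestricted in z_k. Its translates along the hyperplane serve as weights of
  total mass one in the averaging, by \<open>nn_integral_slab_cube\<close>.\<close>

definition cube :: "'n::finite \<Rightarrow> (real, 'n) vec set" where
  "cube k = {z. \<forall>j. j \<noteq> k \<longrightarrow> 0 \<le> z $ j \<and> z $ j \<le> 1}"

text \<open>Lebesgue measure on the hyperplane \<open>z\<^sub>k = 0\<close>, realised on the whole space by means of a dummy
  coordinate \<open>z\<^sub>k\<close> of total mass one.\<close>

definition slab_measure :: "'n::finite \<Rightarrow> (real, 'n) vec measure" where
  "slab_measure k = density lborel (indicator (slab k))"

lemma measurable_vec_lambda [measurable]:
  assumes "\<And>j. (\<lambda>x. f x j) \<in> borel_measurable M"
  shows "(\<lambda>x. (\<chi> j. f x j) :: real^'n) \<in> borel_measurable M"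
  by (rule iffD2[OF borel_measurable_euclidean_space]) (auto simp: Basis_vec_def inner_axis assms)

lemma measurable_vec_nth [measurable]:
  "f \<in> borel_measurable M \<Longrightarrow> (\<lambda>x. (f x :: real^'n) $ j) \<in> borel_measurable M"
  by (rule borel_measurable_continuous_on[OF _, of "\<lambda>z. z $ j"]) (auto intro!: continuous_intros)

lemma measurable_put [measurable (raw)]:
  assumes [measurable]: "f \<in> borel_measurable M" "h \<in> borel_measurable M"
  shows "(\<lambda>x. put k (f x) (h x)) \<in> borel_measurable M"
proof -
  have "(\<lambda>x. if j = k then h x else f x $ j) \<in> borel_measurable M" for j by (cases "j = k") simp_all
  then show ?thesis unfolding put_def by (rule measurable_vec_lambda)
qed

lemma slab_sets [measurable]: "slab k \<in> sets borel" and cube_sets [measurable]: "cube k \<in> sets borel"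
proof -
  have "slab k = (\<lambda>z. z $ k) -` {0..1}" by (auto simp: slab_def)
  moreover have "closed ((\<lambda>z::real^'a. z $ k) -` {0..1})"
    by (intro continuous_closed_vimage) (auto intro!: continuous_intros)
  ultimately show "slab k \<in> sets borel" by simp
  have "cube k = (\<Inter>j\<in>-{k}. (\<lambda>z. z $ j) -` {0..1})" by (auto simp: cube_def)
  moreover have "closed ((\<lambda>z::real^'a. z $ j) -` {0..1})" for j
    by (intro continuous_closed_vimage) (auto intro!: continuous_intros)
  ultimately show "cube k \<in> sets borel" by (simp add: closed_INT)
qed

lemma sets_slab_measure [measurable_cong, simp]: "sets (slab_measure k) = sets borel"
  by (simp add: slab_measure_def)

lemma nn_integral_slab_measure:
  "f \<in> borel_measurable borel \<Longrightarrow> (\<integral>\<^sup>+w. f w \<partial>slab_measure k) = (\<integral>\<^sup>+w. indicator (slab k) w * f w \<partial>lborel)"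
  unfolding slab_measure_def by (subst nn_integral_density) auto

lemma sigma_finite_slab_measure: "sigma_finite_measure (slab_measure k)"
  unfolding slab_measure_def
  by (subst sigma_finite_measure.sigma_finite_iff_density_finite[OF sigma_finite_lborel])
    (auto intro!: AE_I2 simp: indicator_def)

lemma slab_measure_affine:
  fixes t c :: "real^'n"
  assumes c: "\<And>j. c $ j \<noteq> 0" "(\<Prod>j\<in>UNIV. \<bar>c $ j\<bar>) = 1" and k: "t $ k = 0" "c $ k = 1"
    and [measurable]: "f \<in> borel_measurable borel"
  shows "(\<integral>\<^sup>+w. f (\<chi> j. t $ j + c $ j * w $ j) \<partial>slab_measure k) = (\<integral>\<^sup>+w. f w \<partial>slab_measure k)"
proof -
  let ?T = "\<lambda>w :: real^'n. \<chi> j. t $ j + c $ j * w $ j"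
  have [measurable]: "?T \<in> borel_measurable borel" by (intro measurable_vec_lambda) measurable
  have "(\<integral>\<^sup>+w. f w \<partial>slab_measure k) = (\<integral>\<^sup>+w. indicator (slab k) w * f w \<partial>distr lborel borel ?T)"
    by (simp add: nn_integral_slab_measure lborel_diag_affine[OF c])
  also have "\<dots> = (\<integral>\<^sup>+w. indicator (slab k) (?T w) * f (?T w) \<partial>lborel)"
    by (subst nn_integral_distr) auto
  also have "\<dots> = (\<integral>\<^sup>+w. indicator (slab k) w * f (?T w) \<partial>lborel)"
    using k by (intro nn_integral_cong) (simp add: slab_def indicator_def)
  also have "\<dots> = (\<integral>\<^sup>+w. f (?T w) \<partial>slab_measure k)" by (simp add: nn_integral_slab_measure)
  finally show ?thesis ..
qed

lemma nn_integral_slab_cube: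
  "(\<integral>\<^sup>+w. indicator (cube k) (z + put k w 0) \<partial>slab_measure k) = 1"
proof -
  let ?a = "\<chi> j. if j = k then 0 else - z $ j" and ?b = "\<chi> j. if j = k then 1 else 1 - z $ j"
  have [measurable]: "(\<lambda>w. z + put k w 0) \<in> borel_measurable borel" by measurable
  have "(\<integral>\<^sup>+w. indicator (cube k) (z + put k w 0) \<partial>slab_measure k)
      = (\<integral>\<^sup>+w. indicator (slab k) w * indicator (cube k) (z + put k w 0) \<partial>lborel)"
    by (simp add: nn_integral_slab_measure)
  also have "\<dots> = (\<integral>\<^sup>+w. indicator (cbox ?a ?b) w \<partial>lborel)"
  proof (rule nn_integral_cong)
    fix w :: "(real, 'a) vec"
    have "w \<in> cbox ?a ?b \<longleftrightarrow>
        (\<forall>i. if i = k then 0 \<le> w $ k \<and> w $ k \<le> 1 else 0 \<le> z $ i + w $ i \<and> z $ i + w $ i \<le> 1)"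
      unfolding mem_box_cart by (intro arg_cong[where f = All] ext) auto
    also have "\<dots> \<longleftrightarrow> w \<in> slab k \<and> z + put k w 0 \<in> cube k"
      by (auto simp: slab_def cube_def put_component split: if_splits)
    finally show "indicator (slab k) w * indicator (cube k) (z + put k w 0) = (indicator (cbox ?a ?b) w :: ennreal)"
      by (simp add: indicator_def)
  qed
  also have "\<dots> = emeasure lborel (cbox ?a ?b)" by simp
  also have "\<dots> = 1"
  proof -
    have "?a \<bullet> b \<le> ?b \<bullet> b" "(?b - ?a) \<bullet> b = 1" if "b \<in> Basis" for b
      using that by (auto simp: Basis_vec_def inner_axis inner_diff_left)
    then show ?thesis by (simp add: emeasure_lborel_cbox_eq)
  qed
  finally show ?thesis .
qed

text \<open>The argument for uniqueness of Haar measure, applied to the group of translations \<open>a\<close> with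
  \<open>a\<^sub>k = 0\<close>, which acts freely but not transitively.\<close>

lemma nn_integral_hyperplane_invariant:
  fixes \<nu> :: "(real^'n) measure"
  assumes sets [measurable_cong]: "sets \<nu> = sets borel" and sf: "sigma_finite_measure \<nu>"
    and inv: "\<And>a. a $ k = 0 \<Longrightarrow> distr \<nu> borel ((+) a) = \<nu>"
    and f [measurable]: "f \<in> borel_measurable borel"
  shows "(\<integral>\<^sup>+z. f z \<partial>\<nu>) = (\<integral>\<^sup>+z. indicator (cube k) z * (\<integral>\<^sup>+w. f (put k w (z $ k)) \<partial>slab_measure k) \<partial>\<nu>)"
proof -
  interpret \<nu>: sigma_finite_measure \<nu> by (rule sf)
  interpret L: sigma_finite_measure "slab_measure k" by (rule sigma_finite_slab_measure)
  interpret pair_sigma_finite \<nu> "slab_measure k" ..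
  have "(\<integral>\<^sup>+z. f z \<partial>\<nu>) = (\<integral>\<^sup>+z. f z * (\<integral>\<^sup>+w. indicator (cube k) (z + put k w 0) \<partial>slab_measure k) \<partial>\<nu>)"
    by (simp add: nn_integral_slab_cube)
  also have "\<dots> = (\<integral>\<^sup>+z. (\<integral>\<^sup>+w. f z * indicator (cube k) (z + put k w 0) \<partial>slab_measure k) \<partial>\<nu>)"
    by (intro nn_integral_cong nn_integral_cmult[symmetric]) measurable
  also have "\<dots> = (\<integral>\<^sup>+w. (\<integral>\<^sup>+z. f z * indicator (cube k) (z + put k w 0) \<partial>\<nu>) \<partial>slab_measure k)"
    by (rule Fubini'[symmetric]) measurable
  also have "\<dots> = (\<integral>\<^sup>+w. (\<integral>\<^sup>+z. f (z - put k w 0) * indicator (cube k) z \<partial>\<nu>) \<partial>slab_measure k)"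
  proof (rule nn_integral_cong)
    fix w
    let ?h = "\<lambda>z. f (z - put k w 0) * indicator (cube k) z"
    have "(\<integral>\<^sup>+z. ?h z \<partial>\<nu>) = (\<integral>\<^sup>+z. ?h z \<partial>distr \<nu> borel ((+) (put k w 0)))"
      by (subst inv) (simp_all add: put_component)
    also have "\<dots> = (\<integral>\<^sup>+z. ?h (put k w 0 + z) \<partial>\<nu>)" by (subst nn_integral_distr) auto
    finally show "(\<integral>\<^sup>+z. f z * indicator (cube k) (z + put k w 0) \<partial>\<nu>) = (\<integral>\<^sup>+z. ?h z \<partial>\<nu>)"
      by (simp add: add.commute)
  qed
  also have "\<dots> = (\<integral>\<^sup>+z. (\<integral>\<^sup>+w. f (z - put k w 0) * indicator (cube k) z \<partial>slab_measure k) \<partial>\<nu>)"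
    by (rule Fubini') measurable
  also have "\<dots> = (\<integral>\<^sup>+z. indicator (cube k) z * (\<integral>\<^sup>+w. f (z - put k w 0) \<partial>slab_measure k) \<partial>\<nu>)"
    by (intro nn_integral_cong, subst nn_integral_cmult[symmetric]) (auto simp: mult.commute)
  also have "\<dots> = (\<integral>\<^sup>+z. indicator (cube k) z * (\<integral>\<^sup>+w. f (put k w (z $ k)) \<partial>slab_measure k) \<partial>\<nu>)"
  proof (rule nn_integral_cong)
    fix z :: "real^'n"
    \<comment> \<open>The reflection w \<mapsto> z - w in the coordinates other than k preserves
      \<open>slab_measure\<close> and removes the translation from the argument of f.\<close>
    let ?t = "\<chi> j. if j = k then 0 else z $ j" and ?c = "\<chi> j. if j = k then 1 else - (1 :: real)"
    have arg: "put k (\<chi> j. ?t $ j + ?c $ j * w $ j) (z $ k) = z - put k w 0" for w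
      by (simp add: vec_eq_iff put_component)
    have "(\<integral>\<^sup>+w. f (put k w (z $ k)) \<partial>slab_measure k)
        = (\<integral>\<^sup>+w. f (put k (\<chi> j. ?t $ j + ?c $ j * w $ j) (z $ k)) \<partial>slab_measure k)"
      by (rule slab_measure_affine[symmetric, where f = "\<lambda>w. f (put k w (z $ k))"]) 
        (auto intro!: prod.neutral)
    then show "indicator (cube k) z * (\<integral>\<^sup>+w. f (z - put k w 0) \<partial>slab_measure k)
        = indicator (cube k) z * (\<integral>\<^sup>+w. f (put k w (z $ k)) \<partial>slab_measure k)" by (simp only: arg)
  qed
  finally show ?thesis .
qed

text \<open>The preceding formula splits \<open>\<nu>\<close> into Lebesgue measure on the
  hyperplanes of constant z_k and an unknown distribution of z_k, namely that of
  \<open>\<nu>\<close> on \<open>cube k\<close>. Vanishing on each hyperplane then suffices by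
  Fubini's theorem.\<close>

lemma integral_hyperplane_invariant_eq_0:
  fixes \<nu> :: "(real^'n) measure" and F :: "real^'n \<Rightarrow> complex"
  assumes sets [measurable_cong]: "sets \<nu> = sets borel" and sf: "sigma_finite_measure \<nu>"
    and inv: "\<And>a. a $ k = 0 \<Longrightarrow> distr \<nu> borel ((+) a) = \<nu>"
    and F [measurable]: "F \<in> borel_measurable borel"
    and zero: "\<And>y. (\<integral>w. F (put k w y) \<partial>slab_measure k) = 0"
  shows "(\<integral>z. F z \<partial>\<nu>) = 0"
proof (cases "integrable \<nu> F")
  case True
  define \<nu>' where "\<nu>' = density \<nu> (indicator (cube k))"
  have [measurable_cong, simp]: "sets \<nu>' = sets borel" by (simp add: \<nu>'_def sets)
  interpret \<nu>: sigma_finite_measure \<nu> by (rule sf)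
  interpret \<nu>': sigma_finite_measure \<nu>' unfolding \<nu>'_def by (subst \<nu>.sigma_finite_iff_density_finite) (auto intro!: AE_I2 simp: indicator_def)
  interpret L: sigma_finite_measure "slab_measure k" by (rule sigma_finite_slab_measure)
  interpret pair_sigma_finite \<nu>' "slab_measure k" ..
  let ?T = "\<lambda>p. put k (snd p) (fst p $ k)"
  have T [measurable]: "?T \<in> \<nu>' \<Otimes>\<^sub>M slab_measure k \<rightarrow>\<^sub>M borel" by measurable
  have eq: "\<nu> = distr (\<nu>' \<Otimes>\<^sub>M slab_measure k) borel ?T"
  proof (rule measure_eqI)
    fix A assume "A \<in> sets \<nu>"
    then have A [measurable]: "A \<in> sets borel" by (simp add: sets)
    have "emeasure \<nu> A = (\<integral>\<^sup>+z. indicator A z \<partial>\<nu>)" using A by (simp add: sets)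
    also have "\<dots> = (\<integral>\<^sup>+z. indicator (cube k) z * (\<integral>\<^sup>+w. indicator A (put k w (z $ k)) \<partial>slab_measure k) \<partial>\<nu>)"
      by (rule nn_integral_hyperplane_invariant[OF sets sf inv]) auto
    also have "\<dots> = (\<integral>\<^sup>+z. (\<integral>\<^sup>+w. indicator A (put k w (z $ k)) \<partial>slab_measure k) \<partial>\<nu>')"
      unfolding \<nu>'_def by (subst nn_integral_density) auto
    also have "\<dots> = (\<integral>\<^sup>+p. indicator A (?T p) \<partial>(\<nu>' \<Otimes>\<^sub>M slab_measure k))"
      by (subst L.nn_integral_fst[symmetric]) auto
    also have "\<dots> = (\<integral>\<^sup>+z. indicator A z \<partial>distr (\<nu>' \<Otimes>\<^sub>M slab_measure k) borel ?T)"
      by (subst nn_integral_distr) auto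
    finally show "emeasure \<nu> A = emeasure (distr (\<nu>' \<Otimes>\<^sub>M slab_measure k) borel ?T) A" by simp
  qed (simp add: sets)
  have int: "integrable (\<nu>' \<Otimes>\<^sub>M slab_measure k) (\<lambda>p. F (?T p))"
    using True by (subst (asm) eq) (simp add: integrable_distr_eq)
  have "(\<integral>z. F z \<partial>\<nu>) = (\<integral>p. F (?T p) \<partial>(\<nu>' \<Otimes>\<^sub>M slab_measure k))"
    by (subst eq) (simp add: integral_distr)
  also have "\<dots> = (\<integral>z. (\<integral>w. F (put k w (z $ k)) \<partial>slab_measure k) \<partial>\<nu>')"
    using integral_fst'[OF int] by simp
  finally show ?thesis by (simp add: zero)
qed (rule not_integrable_integral_eq)

text \<open>Concentration on z_k = 0 makes \<open>\<nu>\<close> equal to \<open>c\<close> times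
  Lebesgue measure of that hyperplane. Since c is neither 0 nor infinite, the vanishing of the
  integral passes to Lebesgue measure.\<close>

lemma integral_slab_eq_0:
  fixes \<nu> :: "(real^'n) measure" and F :: "real^'n \<Rightarrow> complex"
  assumes sets [measurable_cong]: "sets \<nu> = sets borel" and sf: "sigma_finite_measure \<nu>"
    and inv: "\<And>a. a $ k = 0 \<Longrightarrow> distr \<nu> borel ((+) a) = \<nu>"
    and conc: "AE z in \<nu>. z $ k = 0" and nz: "emeasure \<nu> UNIV \<noteq> 0"
    and fin: "\<And>a b. emeasure \<nu> (cbox a b) < \<infinity>"
    and F [measurable]: "F \<in> borel_measurable borel" and zero: "(\<integral>z. F z \<partial>\<nu>) = 0"
  shows "(\<integral>w. F (put k w 0) \<partial>slab_measure k) = 0"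
proof -
  let ?N = "distr (slab_measure k) borel (\<lambda>w. put k w 0)"
  define c where "c = emeasure \<nu> (cube k)"
  have formula: "emeasure \<nu> A = c * emeasure ?N A" if A [measurable]: "A \<in> sets borel" for A
  proof -
    have "emeasure \<nu> A = (\<integral>\<^sup>+z. indicator A z \<partial>\<nu>)" using A by (simp add: sets)
    also have "\<dots> = (\<integral>\<^sup>+z. indicator (cube k) z * (\<integral>\<^sup>+w. indicator A (put k w (z $ k)) \<partial>slab_measure k) \<partial>\<nu>)"
      by (rule nn_integral_hyperplane_invariant[OF sets sf inv]) auto
    also have "\<dots> = (\<integral>\<^sup>+z. indicator (cube k) z * (\<integral>\<^sup>+w. indicator A (put k w 0) \<partial>slab_measure k) \<partial>\<nu>)"
      using conc by (intro nn_integral_cong_AE) (auto elim!: eventually_mono)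
    also have "\<dots> = c * (\<integral>\<^sup>+w. indicator A (put k w 0) \<partial>slab_measure k)"
      by (subst nn_integral_multc) (auto simp: c_def sets)
    also have "(\<integral>\<^sup>+w. indicator A (put k w 0) \<partial>slab_measure k) = (\<integral>\<^sup>+z. indicator A z \<partial>?N)"
      by (subst nn_integral_distr) auto
    finally show ?thesis by simp
  qed
  have "c \<noteq> 0" using formula[of UNIV] nz by auto
  \<comment> \<open>\<open>cube k\<close> itself is unbounded; concentration on the hyperplane moves
    its mass into a compact box.\<close>
  have "c = emeasure \<nu> (cube k \<inter> {z. z $ k = 0})"
    unfolding c_def using conc by (intro emeasure_eq_AE) (auto simp: sets elim!: eventually_mono)
  also have "\<dots> \<le> emeasure \<nu> (cbox 0 (\<chi> j. 1))"
    by (intro emeasure_mono) (auto simp: sets cube_def mem_box_cart, metis order_refl zero_le_one, metis order_refl zero_le_one)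
  finally have "c < \<infinity>" using fin[of 0 "\<chi> j. 1"] by auto
  then obtain r where r: "c = ennreal r" "r \<ge> 0" by (cases c) auto
  have "\<nu> = density ?N (\<lambda>_. ennreal r)"
    by (rule measure_eqI) (auto simp: sets formula r(1) emeasure_density nn_integral_cmult)
  then have "(\<integral>z. F z \<partial>\<nu>) = r *\<^sub>R (\<integral>z. F z \<partial>?N)"
    by (simp add: integral_density r(2))
  moreover have "r \<noteq> 0" using \<open>c \<noteq> 0\<close> r(1) by auto
  ultimately have "(\<integral>z. F z \<partial>?N) = 0" using zero by simp
  then show ?thesis by (simp add: integral_distr)
qed

section \<open>From coset spaces to Euclidean coordinates\<close>

lemma lcosets_carrier: "lcosets\<^bsub>SLn\<lparr>carrier := N\<rparr>\<^esub> M = (\<lambda>n. (\<lambda>m. n ** m) ` M) ` N"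
  by (auto simp: LCOSETS_def l_coset_def)

lemma l_coset_SLn: "n <#\<^bsub>SLn\<^esub> C = (\<lambda>m. n ** m) ` C"
  by (auto simp: l_coset_def)

lemma topspace_coset_topology: "topspace (coset_topology N M) = (\<lambda>n. (\<lambda>m. n ** m) ` M) ` N"
proof -
  have "openin (coset_topology N M) ((\<lambda>n. (\<lambda>m. n ** m) ` M) ` N)"
    unfolding openin_coset_topology lcosets_carrier l_coset_SLn
  proof
    have "{n \<in> N. (\<lambda>m. n ** m) ` M \<in> (\<lambda>n. (\<lambda>m. n ** m) ` M) ` N} = N" by blast
    then show "openin (top_of_set N) {n \<in> N. (\<lambda>m. n ** m) ` M \<in> (\<lambda>n. (\<lambda>m. n ** m) ` M) ` N}" by simp
  qed simp
  moreover have "U \<subseteq> (\<lambda>n. (\<lambda>m. n ** m) ` M) ` N" if "openin (coset_topology N M) U" for U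
    using that by (simp add: openin_coset_topology lcosets_carrier)
  ultimately show ?thesis by (meson openin_subset openin_topspace subset_antisym)
qed

text \<open>A measure on the coset space is transported to Euclidean space by coordinates \<open>ct\<close> with a
  section \<open>sec\<close>; \<open>Z\<close> is the range of the coordinates and \<open>k\<close> the index of the one coordinate in which
  no translation invariance is available.\<close>

lemma transport_to_coordinates:
  fixes N M :: "'n::{finite,linorder} mat set" and ct :: "'n mat \<Rightarrow> (real, 'n) vec" and sec :: "(real, 'n) vec \<Rightarrow> 'n mat"
  assumes N: "subgroup N SLn" and M: "mat 1 \<in> M"
    and rad: "Radon_measure (coset_topology N M) \<mu>" and nz: "emeasure \<mu> (space \<mu>) \<noteq> 0"
    and inv: "\<And>n B. n \<in> N \<Longrightarrow> B \<in> sets \<mu> \<Longrightarrow> emeasure \<mu> ((\<lambda>C. n <#\<^bsub>SLn\<^esub> C) ` B) = emeasure \<mu> B"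
    and ct: "continuous_on N ct" "\<And>n m. n \<in> N \<Longrightarrow> m \<in> M \<Longrightarrow> ct (n ** m) = ct n" "\<And>n. n \<in> N \<Longrightarrow> ct n \<in> Z"
    and sec: "continuous_on UNIV sec" "\<And>z. sec z \<in> N" "\<And>z. z \<in> Z \<Longrightarrow> ct (sec z) = z"
    and ct_sec: "\<And>n. n \<in> N \<Longrightarrow> (\<lambda>m. sec (ct n) ** m) ` M = (\<lambda>m. n ** m) ` M"
    and Z: "closed Z"
    and trans: "\<And>a n. a $ k = 0 \<Longrightarrow> n \<in> N \<Longrightarrow> ct (sec a ** n) = ct n + a"
  obtains \<nu> where "sets \<nu> = sets borel" "sigma_finite_measure \<nu>" "AE z in \<nu>. z \<in> Z" "emeasure \<nu> UNIV \<noteq> 0"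
    "\<And>a b. emeasure \<nu> (cbox a b) < \<infinity>" "\<And>a. a $ k = 0 \<Longrightarrow> distr \<nu> borel ((+) a) = \<nu>"
    "\<And>\<phi> g. (\<And>n m. n \<in> N \<Longrightarrow> m \<in> M \<Longrightarrow> \<phi> (g ** (n ** m)) = \<phi> (g ** n)) \<Longrightarrow>
       (\<lambda>z. \<phi> (g ** sec z)) \<in> borel_measurable borel \<Longrightarrow>
       horo_integral \<mu> \<phi> g = (\<integral>z. \<phi> (g ** sec z) \<partial>\<nu>)"
proof
  let ?cs = "\<lambda>n. (\<lambda>m. n ** m) ` M"
  define cc where "cc C = the_elem (ct ` C)" for C
  have cc: "cc (?cs n) = ct n" if "n \<in> N" for n
  proof -
    have "ct ` ?cs n = {ct n}" using that ct(2) M by (auto simp: image_image)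
    then show ?thesis by (simp add: cc_def)
  qed
  have sp: "space \<mu> = ?cs ` N" using rad by (simp add: Radon_measure_def topspace_coset_topology)
  have sets\<mu>: "sets \<mu> = sigma_sets (space \<mu>) {U. openin (coset_topology N M) U}"
    using rad by (simp add: Radon_measure_def)
  have opn: "openin (coset_topology N M) (cc -` S \<inter> space \<mu>)" if S: "open S" for S
    unfolding openin_coset_topology lcosets_carrier l_coset_SLn sp
  proof
    have "{n \<in> N. ?cs n \<in> cc -` S \<inter> ?cs ` N} = N \<inter> ct -` S" using cc by auto
    then show "openin (top_of_set N) {n \<in> N. ?cs n \<in> cc -` S \<inter> ?cs ` N}"
      using continuous_openin_preimage_gen[OF ct(1) S] by simp
  qed blast
  have ccm [measurable]: "cc \<in> borel_measurable \<mu>"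
  proof (rule borel_measurableI)
    fix S :: "(real, 'n) vec set" assume "open S"
    then show "cc -` S \<inter> space \<mu> \<in> sets \<mu>" unfolding sets\<mu> using opn by blast
  qed
  define \<nu> where "\<nu> = distr \<mu> borel cc"
  show sets\<nu>: "sets \<nu> = sets borel" by (simp add: \<nu>_def)
  have em: "emeasure \<nu> A = emeasure \<mu> (cc -` A \<inter> space \<mu>)" if "A \<in> sets borel" for A
    using that by (simp add: \<nu>_def emeasure_distr)
  show "AE z in \<nu>. z \<in> Z"
    unfolding \<nu>_def using Z by (subst AE_distr_iff) (auto simp: sp cc ct(3) intro!: AE_I2)
  show "emeasure \<nu> UNIV \<noteq> 0" using nz by (simp add: em)
  show fin: "emeasure \<nu> (cbox a b) < \<infinity>" for a b
  proof -
    have cont: "continuous_map euclidean (coset_topology N M) (\<lambda>z. ?cs (sec z))"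
      unfolding continuous_map_def topspace_coset_topology
    proof (intro conjI allI impI)
      fix U assume "openin (coset_topology N M) U"
      then have U: "openin (top_of_set N) {n \<in> N. ?cs n \<in> U}"
        by (simp add: openin_coset_topology l_coset_SLn)
      have "openin (top_of_set UNIV) (UNIV \<inter> sec -` {n \<in> N. ?cs n \<in> U})"
        by (rule continuous_openin_preimage[OF sec(1) _ U]) (use sec(2) in blast)
      moreover have "UNIV \<inter> sec -` {n \<in> N. ?cs n \<in> U} = {z. ?cs (sec z) \<in> U}" using sec(2) by auto
      ultimately show "openin euclidean {x \<in> topspace euclidean. ?cs (sec x) \<in> U}" by simp
    qed (use sec(2) in auto)
    \<comment> \<open>The part of the coset space with coordinates in a box is the continuous image
      of this compact set, and Radon measures are finite on compact sets.\<close>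
    have "compactin euclidean (cbox a b \<inter> Z)" using Z by (simp add: compact_Int_closed)
    from image_compactin[OF this cont]
    have "compactin (coset_topology N M) ((\<lambda>z. ?cs (sec z)) ` (cbox a b \<inter> Z))" .
    moreover have "(\<lambda>z. ?cs (sec z)) ` (cbox a b \<inter> Z) = cc -` cbox a b \<inter> space \<mu>"
    proof (intro subset_antisym subsetI)
      fix C assume "C \<in> cc -` cbox a b \<inter> space \<mu>"
      then obtain n where n: "n \<in> N" "C = ?cs n" "ct n \<in> cbox a b" by (auto simp: sp cc)
      then have "C = ?cs (sec (ct n))" "ct n \<in> cbox a b \<inter> Z" using ct_sec ct(3) by auto
      then show "C \<in> (\<lambda>z. ?cs (sec z)) ` (cbox a b \<inter> Z)" by blast
    qed (use sec in \<open>auto simp: sp cc\<close>)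
    ultimately show ?thesis using rad by (auto simp: em Radon_measure_def)
  qed
  show "sigma_finite_measure \<nu>"
  proof
    let ?A = "\<lambda>i::nat. cbox (\<chi> j. - real i) (\<chi> j. real i) :: (real, 'n) vec set"
    have "\<exists>i. x \<in> ?A i" for x
    proof -
      obtain i where i: "norm x \<le> real i" using real_arch_simple by blast
      then have "\<bar>x $ j\<bar> \<le> real i" for j using component_le_norm_cart[of x j] by linarith
      then have "x \<in> ?A i" by (simp add: mem_box_cart abs_le_iff) (metis add.inverse_inverse neg_le_iff_le)
      then show ?thesis by blast
    qed
    then have "\<Union> (range ?A) = space \<nu>" by (auto simp: \<nu>_def)
    then show "\<exists>A. countable A \<and> A \<subseteq> sets \<nu> \<and> \<Union> A = space \<nu> \<and> (\<forall>a\<in>A. emeasure \<nu> a \<noteq> \<infinity>)"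
      using fin by (intro exI[of _ "range ?A"]) (auto simp: sets\<nu> less_top)
  qed
  show "distr \<nu> borel ((+) a) = \<nu>" if a: "a $ k = 0" for a
  proof (rule measure_eqI)
    fix E assume "E \<in> sets (distr \<nu> borel ((+) a))"
    then have E [measurable]: "E \<in> sets borel" by simp
    let ?B = "cc -` ((+) a -` E) \<inter> space \<mu>"
    have E': "(+) a -` E \<in> sets borel" using measurable_sets[of "(+) a" borel borel E] by simp
    then have B: "?B \<in> sets \<mu>" using ccm measurable_sets by blast
    \<comment> \<open>Left translation by \<open>sec a\<close> adds \<open>a\<close> to the
      coordinates, so it carries the preimage of E - a onto that of E.\<close>
    have "(\<lambda>C. sec a <#\<^bsub>SLn\<^esub> C) ` ?B = cc -` E \<inter> space \<mu>"
    proof (intro subset_antisym subsetI)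
      fix C assume "C \<in> (\<lambda>C. sec a <#\<^bsub>SLn\<^esub> C) ` ?B"
      then obtain n where n: "n \<in> N" "a + ct n \<in> E" "C = ?cs (sec a ** n)"
        by (auto simp: sp cc l_coset_SLn image_image matrix_mul_assoc)
      have "sec a ** n \<in> N" using N sec(2) n(1) by (simp add: subgroup_SLn_iff)
      then show "C \<in> cc -` E \<inter> space \<mu>" using n trans[OF a n(1)] by (auto simp: sp cc add.commute)
    next
      fix C assume "C \<in> cc -` E \<inter> space \<mu>"
      then obtain n where n: "n \<in> N" "ct n \<in> E" "C = ?cs n" by (auto simp: sp cc)
      let ?n = "matrix_inv (sec a) ** n"
      have n': "?n \<in> N" using N sec(2) n(1) by (simp add: subgroup_SLn_iff)
      have sn: "sec a ** ?n = n" using N sec(2) by (auto simp: subgroup_SLn_iff intro!: GG_cancel(1))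
      have "ct n = ct ?n + a" using trans[OF a n'] sn by simp
      then have "?cs ?n \<in> ?B" using n n' by (auto simp: sp cc add.commute)
      moreover have "sec a <#\<^bsub>SLn\<^esub> ?cs ?n = C"
        using sn n(3) by (simp add: l_coset_SLn image_image matrix_mul_assoc)
      ultimately show "C \<in> (\<lambda>C. sec a <#\<^bsub>SLn\<^esub> C) ` ?B" by blast
    qed
    then have "emeasure \<mu> (cc -` E \<inter> space \<mu>) = emeasure \<mu> ?B" using inv[OF sec(2)[of a] B] by (simp only:)
    moreover have "emeasure (distr \<nu> borel ((+) a)) E = emeasure \<nu> ((+) a -` E)"
      by (subst emeasure_distr) (auto simp: measurable_cong_sets[OF sets\<nu>] \<nu>_def)
    ultimately show "emeasure (distr \<nu> borel ((+) a)) E = emeasure \<nu> E"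
      using E E' by (simp add: em)
  qed (simp add: sets\<nu>)
  show "horo_integral \<mu> \<phi> g = (\<integral>z. \<phi> (g ** sec z) \<partial>\<nu>)"
    if \<phi>: "\<And>n m. n \<in> N \<Longrightarrow> m \<in> M \<Longrightarrow> \<phi> (g ** (n ** m)) = \<phi> (g ** n)"
      "(\<lambda>z. \<phi> (g ** sec z)) \<in> borel_measurable borel" for \<phi> g
  proof -
    have "horo_integral \<mu> \<phi> g = (\<integral>C. \<phi> (g ** sec (cc C)) \<partial>\<mu>)"
      unfolding horo_integral_def
    proof (rule Bochner_Integration.integral_cong[OF refl])
      fix C assume "C \<in> space \<mu>"
      then obtain n where n: "n \<in> N" "C = ?cs n" by (auto simp: sp)
      have "sec (ct n) \<in> ?cs (sec (ct n))" using M by (intro image_eqI[of _ _ "mat 1"]) auto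
      then obtain m where m: "m \<in> M" "sec (ct n) = n ** m" using ct_sec[OF n(1)] by auto
      have "n \<in> C" unfolding n(2) by (rule image_eqI[of _ _ "mat 1"]) (simp_all add: M)
      moreover have "\<phi> (g ** x) = \<phi> (g ** n)" if "x \<in> C" for x using that n \<phi>(1)[OF n(1)] by auto
      ultimately have img: "(\<lambda>n. \<phi> (g ** n)) ` C = {\<phi> (g ** n)}" by blast
      then show "the_elem ((\<lambda>n. \<phi> (g ** n)) ` C) = \<phi> (g ** sec (cc C))"
      proof -
        have "cc C = ct n" unfolding n(2) by (rule cc[OF n(1)])
        then have "\<phi> (g ** sec (cc C)) = \<phi> (g ** (n ** m))" using m(2) by simp
        also have "\<dots> = \<phi> (g ** n)" by (rule \<phi>(1)[OF n(1) m(1)])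
        finally show ?thesis unfolding img by simp
      qed
    qed
    also have "\<dots> = (\<integral>z. \<phi> (g ** sec z) \<partial>\<nu>)" unfolding \<nu>_def by (subst integral_distr) (auto simp: \<phi>(2))
    finally show ?thesis .
  qed
qed

section \<open>Orbits of the unipotent radical\<close>

text \<open>The function on the orbit of \<open>Smat\<close> induced by \<phi>. For right
  H-invariant \<phi> the value does not depend on the choice, by \<open>Phi_conj_by\<close>.\<close>

definition Phi :: "('n::{finite,linorder} mat \<Rightarrow> complex) \<Rightarrow> 'n mat \<Rightarrow> complex" where
  "Phi \<phi> Y = \<phi> (SOME x. x \<in> GG \<and> conj_by x Smat = Y)"

lemma Phi_conj_by:
  fixes \<phi> :: "'n::{finite,linorder} mat \<Rightarrow> complex"
  assumes n: "CARD('n) \<ge> 2" and \<phi>: "\<And>g h. g \<in> GG \<Longrightarrow> h \<in> HH \<Longrightarrow> \<phi> (g ** h) = \<phi> g" and x: "x \<in> GG"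
  shows "Phi \<phi> (conj_by x Smat) = \<phi> x"
proof -
  let ?y = "SOME y. y \<in> GG \<and> conj_by y Smat = conj_by x Smat"
  have y: "?y \<in> GG" "conj_by ?y Smat = conj_by x Smat"
    using someI[of "\<lambda>y. y \<in> GG \<and> conj_by y Smat = conj_by x Smat" x] x by auto
  then have "conj_by (matrix_inv x ** ?y) Smat = Smat"
    using x by (simp add: conj_by_conj_by[symmetric] GG_inverse conj_by_inverse)
  then have "matrix_inv x ** ?y \<in> HH" using x y by (simp add: HH_iff[OF n] mult_in_GG GG_inverse)
  from \<phi>[OF x this] show ?thesis using x by (simp add: Phi_def GG_cancel)
qed

text \<open>Cramer's rule: on \<open>GG\<close> the inverse is polynomial in the entries, hence
  continuous.\<close>

lemma matrix_inv_component:
  fixes A :: "real^'n^'n"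
  assumes "A \<in> GG"
  shows "matrix_inv A $ i $ j = det (\<chi> a b. if b = i then axis j 1 $ a else A $ a $ b)"
proof -
  have d: "det A = 1" using assms by (simp add: GG_iff)
  have "A *v (matrix_inv A *v axis j 1) = axis j 1" by (simp add: GG_cancel[OF assms])
  then have "matrix_inv A *v axis j 1 = (\<chi> i. det (\<chi> a b. if b = i then axis j 1 $ a else A $ a $ b) / det A)"
    using cramer[of A "matrix_inv A *v axis j 1" "axis j 1"] d by simp
  moreover have "(matrix_inv A *v axis j 1) $ i = matrix_inv A $ i $ j"
    by (simp add: matrix_vector_mult_def axis_def if_distrib[of "\<lambda>x. _ * x"] cong: if_cong)
  ultimately show ?thesis using d by simp
qed

lemma continuous_on_det: "continuous_on S f \<Longrightarrow> continuous_on S (\<lambda>x. det (f x :: real^'n^'n))"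
  unfolding det_def by (intro continuous_intros continuous_on_component)

lemma continuous_on_matrix_inv: "S \<subseteq> GG \<Longrightarrow> continuous_on S (matrix_inv :: real^'n^'n \<Rightarrow> _)"
proof -
  assume S: "S \<subseteq> (GG :: (real^'n^'n) set)"
  have "continuous_on S (\<lambda>A. \<chi> i j. det (\<chi> a b. if b = i then axis j (1::real) $ a else A $ a $ b))"
  proof (intro continuous_on_vec_lambda continuous_on_det)
    fix i j a b :: 'n
    show "continuous_on S (\<lambda>A. if b = i then axis j 1 $ a else A $ a $ b)"
      by (cases "b = i") (auto intro!: continuous_intros)
  qed
  moreover have "(\<chi> i j. det (\<chi> a b. if b = i then axis j 1 $ a else A $ a $ b)) = matrix_inv A" if "A \<in> S" for A
    using matrix_inv_component[of A] S that by (auto simp: vec_eq_iff)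
  ultimately show ?thesis by (metis (mono_tags, lifting) continuous_on_eq)
qed

definition lower_part :: "'n::{finite,linorder} \<Rightarrow> (real, 'n) vec \<Rightarrow> (real, 'n) vec" where
  "lower_part k z = (\<chi> j. if j < k then z $ j else 0)"

definition upper_part :: "'n::{finite,linorder} \<Rightarrow> (real, 'n) vec \<Rightarrow> (real, 'n) vec" where
  "upper_part k z = (\<chi> j. if k < j then z $ j else 0)"

definition orbit_vec :: "'n::{finite,linorder} \<Rightarrow> (real, 'n) vec \<Rightarrow> (real, 'n) vec" where
  "orbit_vec k z = axis k 1 + lower_part k z"

text \<open>The entry at k is the one that makes the pairing with \<open>orbit_vec k z\<close> equal
  to 1.\<close>

definition orbit_form :: "'n::{finite,linorder} \<Rightarrow> 'n \<Rightarrow> 'n \<Rightarrow> real \<Rightarrow> real \<Rightarrow> (real, 'n) vec \<Rightarrow> (real, 'n) vec" where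
  "orbit_form l m k e t z = axis l e + axis m (t * z $ k) + axis k (1 - e * z $ l - t * z $ k * z $ m) + upper_part k z"

lemma lower_part_component: "lower_part k z $ j = (if j < k then z $ j else 0)"
  and upper_part_component: "upper_part k z $ j = (if k < j then z $ j else 0)"
  by (simp_all add: lower_part_def upper_part_def)

lemma axis_component: "axis i c $ j = (if j = i then c else 0)"
  by (simp add: axis_def)

lemma inner_axis_left: "axis i c \<bullet> v = c * (v $ i :: real)"
  by (simp add: inner_axis')

lemma inner_axis_right: "v \<bullet> axis i c = c * (v $ i :: real)"
  by (simp add: inner_axis mult.commute)

lemma upper_part_inner_lower_part: "upper_part k z \<bullet> lower_part k z' = 0" "lower_part k z' \<bullet> upper_part k z = 0"
  by (auto simp: inner_vec_def lower_part_component upper_part_component intro!: sum.neutral)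

lemma mult_vec_plus_outer: "(mat 1 + outer x y) *v u = u + (y \<bullet> u) *\<^sub>R x"
  and mult_vec_minus_outer: "(mat 1 - outer x y) *v u = u - (y \<bullet> u) *\<^sub>R x"
  by (simp_all add: matrix_vector_mult_add_rdistrib matrix_vector_mult_diff_rdistrib outer_mult_vec)

lemma vec_mult_plus_outer: "u v* (mat 1 + outer x y) = u + (u \<bullet> x) *\<^sub>R y"
  and vec_mult_minus_outer: "u v* (mat 1 - outer x y) = u - (u \<bullet> x) *\<^sub>R y"
proof -
  have "u v* (A + B) = u v* A + u v* B" "u v* (A - B) = u v* A - u v* B" for A B :: "real^'a^'a"
    by (simp_all add: vec_eq_iff vector_matrix_mult_def distrib_left right_diff_distrib sum.distrib sum_subtractf)
  then show "u v* (mat 1 + outer x y) = u + (u \<bullet> x) *\<^sub>R y" "u v* (mat 1 - outer x y) = u - (u \<bullet> x) *\<^sub>R y"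
    by (simp_all add: vec_mult_outer)
qed

lemma continuous_on_outer [continuous_intros]:
  "continuous_on S f \<Longrightarrow> continuous_on S g \<Longrightarrow> continuous_on S (\<lambda>x. outer (f x) (g x))"
  unfolding outer_def by (intro continuous_intros continuous_on_component)

text \<open>The orbit of the unipotent radical through the base point, in coordinates. In \<open>G/H\<close> it consists
  of the pairs \<open>(orbit_vec k z, orbit_form l m k e t z)\<close> with \<open>t = e d \<in> {0, 1}\<close>. For \<open>d = 0\<close> the coordinate \<open>z\<^sub>k\<close> is
  void. For \<open>e d = 1\<close>, when a single index \<open>m\<close> lies between \<open>l\<close> and \<open>k\<close>, it is the coordinate
  of the second entry at \<open>m\<close>.\<close>

locale orbit =
  fixes l m k :: "'n::{finite,linorder}" and e d :: real
  assumes lk: "l < k"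
    and shape: "(d = 0 \<and> (e = 0 \<or> adjacent l k)) \<or>
      (e * d = 1 \<and> l < m \<and> m < k \<and> (\<forall>c. l < c \<and> c < k \<longrightarrow> c = m))"
begin

abbreviation "t \<equiv> e * d"

text \<open>It is supported at an index where the second entry of the pair is constant along the
  orbit: \<open>e\<close> at l for e \<noteq> 0, and 1 at k for e = 0. The pairing with
  \<open>piv\<close> is therefore 1 on the whole orbit, which makes the upper factor below act as a
  translation.\<close>

definition piv :: "(real, 'n) vec" where
  "piv = (if e = 0 then axis k 1 else axis l (1 / e))"

text \<open>The first factor moves e_k to \<open>orbit_vec k z\<close>, the second adds the upper
  part to the form, and the shear creates the entry at m: its inverse adds d z_k times the entry e
  at l, that is t z_k.\<close>

definition orbit_rep :: "(real, 'n) vec \<Rightarrow> 'n mat" where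
  "orbit_rep z = (mat 1 + outer (lower_part k z) (axis k 1)) ** ((mat 1 - outer piv (upper_part k z)) ** trv l m (- (d * z $ k)))"

definition lam :: "'n mat \<Rightarrow> (real, 'n) vec" where
  "lam u = (axis k 1 + axis l e) v* matrix_inv u"

text \<open>The factor \<open>t\<close>, which is 0 or 1 in this locale, sets the coordinate at k to
  0 when it is void.\<close>

definition orbit_coords :: "'n mat \<Rightarrow> (real, 'n) vec" where
  "orbit_coords u = (\<chi> j. if j < k then (u *v axis k 1) $ j else if j = k then t * lam u $ m else lam u $ j)"

lemma t_cases: "d = 0 \<or> (t = 1 \<and> e \<noteq> 0 \<and> l < m \<and> m < k)"
  using shape by auto

lemma trv_UU: "trv l m (- (d * y)) \<in> UU"
  using t_cases trv_in_UU[of l m] mat1_in_UU by auto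

lemma lower_factor_UU: "mat 1 + outer (lower_part k z) (axis k 1) \<in> UU"
  by (auto simp: UU_def outer_component lower_part_component mat_def axis_component)

lemma upper_factor_UU: "mat 1 - outer piv (upper_part k z) \<in> UU"
  using lk by (auto simp: UU_def outer_component upper_part_component mat_def axis_component piv_def)

lemma orbit_rep_UU: "orbit_rep z \<in> UU"
  unfolding orbit_rep_def by (intro UU_mult lower_factor_UU upper_factor_UU trv_UU)

lemma orbit_rep_mult_axis: "orbit_rep z *v axis k 1 = orbit_vec k z"
proof -
  have "trv l m (- (d * z $ k)) *v axis k 1 = axis k 1"
    using t_cases by (auto simp: trv_mult_vec axis_component vec_eq_iff)
  then show ?thesis
    by (simp add: orbit_rep_def orbit_vec_def matrix_vector_mul_assoc[symmetric] mult_vec_plus_outer mult_vec_minus_outer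
        inner_axis_right upper_part_component inner_axis_axis_real)
qed

lemma upper_part_inner_piv: "upper_part k z \<bullet> piv = 0"
  using lk by (auto simp: piv_def inner_axis_right upper_part_component)

text \<open>Multiplying the claimed form by the three factors of \<open>orbit_rep z\<close> one
  after the other leads back to the base form, which avoids computing an inverse.\<close>

lemma lam_orbit_rep: "lam (orbit_rep z) = orbit_form l m k e t z"
proof -
  let ?L = "orbit_form l m k e t z" and ?mu = "axis l e + axis m (t * z $ k) + axis k 1 + upper_part k z"
  have lower_part_l: "lower_part k z $ l = z $ l" "lower_part k z $ k = 0" using lk by (auto simp: lower_part_component)
  have lower_part_m: "t * z $ k * lower_part k z $ m = t * z $ k * z $ m" using t_cases by (auto simp: lower_part_component)
  have "?L \<bullet> lower_part k z = e * z $ l + t * z $ k * z $ m"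
    using lower_part_m by (simp add: orbit_form_def inner_add_left inner_axis_left lower_part_l upper_part_inner_lower_part)
  then have 1: "?L v* (mat 1 + outer (lower_part k z) (axis k 1)) = ?mu"
    by (simp add: vec_mult_plus_outer orbit_form_def vec_eq_iff axis_component)
  have "?mu \<bullet> piv = 1"
  proof (cases "e = 0")
    case True
    then have piv: "piv = axis k 1" unfolding piv_def by simp
    have "l \<noteq> k" using lk by auto
    then show ?thesis unfolding piv using True by (simp add: inner_axis_right axis_component upper_part_component)
  next
    case False
    have "upper_part k z $ l = 0" using lk by (auto simp: upper_part_component)
    moreover have "axis m (t * z $ k) $ l = 0" using t_cases by (auto simp: axis_component)
    ultimately show ?thesis using False lk by (auto simp: piv_def inner_axis_right axis_component)
  qed
  then have 2: "?mu v* (mat 1 - outer piv (upper_part k z)) = axis l e + axis m (t * z $ k) + axis k 1"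
    by (simp add: vec_mult_minus_outer)
  have "(axis l e + axis m (t * z $ k) + axis k 1) v* trv l m (- (d * z $ k)) = axis k 1 + axis l e"
    using t_cases lk by (auto simp: vec_mult_trv vec_eq_iff axis_component)
  then have "?L v* orbit_rep z = axis k 1 + axis l e"
    by (simp add: orbit_rep_def vec_mult_assoc[symmetric] 1 2)
  then have "lam (orbit_rep z) = ?L v* (orbit_rep z ** matrix_inv (orbit_rep z))"
    by (simp add: lam_def vec_mult_assoc[symmetric])
  then show ?thesis by (simp add: GG_inverse[OF UU_subset_GG[OF orbit_rep_UU]])
qed

lemma conj_by_UU_flag_refl: "u \<in> UU \<Longrightarrow> conj_by u (flag_refl l k e) = reflection (u *v axis k 1) (lam u)"
  by (simp add: flag_refl_def lam_def conj_by_refl[OF UU_subset_GG])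

lemma conj_by_orbit_rep: "conj_by (orbit_rep z) (flag_refl l k e) = reflection (orbit_vec k z) (orbit_form l m k e t z)"
  by (simp add: conj_by_UU_flag_refl[OF orbit_rep_UU] orbit_rep_mult_axis lam_orbit_rep)

lemma orbit_coords_orbit_rep:
  assumes "t = 0 \<longrightarrow> z $ k = 0" shows "orbit_coords (orbit_rep z) = z"
proof -
  have "orbit_form l m k e t z $ j = z $ j" if "k < j" for j
    using that lk t_cases by (auto simp: orbit_form_def axis_component upper_part_component)
  moreover have "t * orbit_form l m k e t z $ m = z $ k"
    using t_cases assms by (auto simp: orbit_form_def axis_component upper_part_component)
  ultimately show ?thesis
    by (simp add: orbit_coords_def orbit_rep_mult_axis lam_orbit_rep vec_eq_iff) (auto simp: orbit_vec_def axis_component lower_part_component)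
qed

lemma lam_component: "lam u $ j = matrix_inv u $ k $ j + e * matrix_inv u $ l $ j"
  by (simp add: lam_def vector_matrix_mult_def axis_component distrib_right sum.distrib
      if_distrib[of "\<lambda>x. x * _"] cong: if_cong)

text \<open>Unitriangularity fixes the entry 1 of the vector at k and the entry e of the form at l,
  and makes everything beyond or before these vanish. Strictly between l and k the shape of the pair
  leaves only m, or e = 0. The remaining entry of the form at k follows from the pairing being
  1.\<close>

lemma orbit_coords_determines:
  assumes u: "u \<in> UU"
  shows "u *v axis k 1 = orbit_vec k (orbit_coords u)" and "lam u = orbit_form l m k e t (orbit_coords u)"
proof -
  let ?x = "orbit_coords u"
  have col: "(u *v axis k 1) $ j = u $ j $ k" for j
    by (simp add: matrix_vector_mult_def axis_component if_distrib[of "\<lambda>x. _ * x"] cong: if_cong)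
  show v: "u *v axis k 1 = orbit_vec k ?x"
    using u by (auto simp: vec_eq_iff orbit_vec_def axis_component lower_part_component orbit_coords_def UU_def col
        dest: linorder_neqE)
  have iu: "matrix_inv u $ i $ i = 1" "j < i \<Longrightarrow> matrix_inv u $ i $ j = 0" for i j
    using UU_inverse[OF u] by (auto simp: UU_def)
  have lj: "lam u $ j = (axis l e + axis m (t * ?x $ k) + axis k (lam u $ k) + upper_part k ?x) $ j" for j
  proof (cases j l rule: linorder_cases)
    case less
    then show ?thesis using lk t_cases by (auto simp: lam_component iu axis_component upper_part_component)
  next
    case equal
    then show ?thesis using lk t_cases by (auto simp: lam_component iu axis_component upper_part_component)
  next
    case greater
    show ?thesis
    proof (cases j k rule: linorder_cases)
      case less
      show ?thesis
      proof (cases "d = 0")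
        case True
        then have "e = 0" using shape less greater by auto
        moreover have "j \<noteq> l" "j \<noteq> k" "\<not> k < j" using less greater by auto
        ultimately show ?thesis using less unfolding lam_component by (simp add: iu axis_component upper_part_component)
      next
        case False
        then have "j = m" "t = 1" using shape less greater by auto
        then show ?thesis using less greater by (auto simp: axis_component upper_part_component orbit_coords_def)
      qed
    next
      case equal
      then show ?thesis using lk t_cases by (auto simp: axis_component upper_part_component)
    next
      case j: greater
      then show ?thesis using greater t_cases by (auto simp: axis_component upper_part_component orbit_coords_def)
    qed
  qed
  then have lam': "lam u = axis l e + axis m (t * ?x $ k) + axis k (lam u $ k) + upper_part k ?x"
    unfolding vec_eq_iff by blast
  have "lam u \<bullet> (u *v axis k 1) = (axis k 1 + axis l e) \<bullet> axis k 1"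
    unfolding lam_def by (rule inner_dual_pairing[OF UU_subset_GG[OF u]])
  also have "\<dots> = 1" using lk by (auto simp: inner_axis_right axis_component)
  finally have "lam u \<bullet> orbit_vec k ?x = 1" by (simp add: v)
  moreover have "orbit_vec k ?x $ l = ?x $ l" "orbit_vec k ?x $ k = 1" using lk by (auto simp: orbit_vec_def axis_component lower_part_component)
  moreover have "t * ?x $ k * orbit_vec k ?x $ m = t * ?x $ k * ?x $ m"
    using t_cases by (auto simp: orbit_vec_def axis_component lower_part_component)
  moreover have "upper_part k ?x \<bullet> orbit_vec k ?x = 0" by (simp add: orbit_vec_def inner_add_right upper_part_inner_lower_part inner_axis_right upper_part_component)
  ultimately have "lam u $ k = 1 - e * ?x $ l - t * ?x $ k * ?x $ m"
    by (subst (asm) lam') (simp add: inner_add_left inner_axis_left)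
  then show "lam u = orbit_form l m k e t ?x" by (subst lam') (simp add: orbit_form_def)
qed

text \<open>Fixing the reflection might still scale the pair; a unitriangular \<open>w\<close> keeps
  the entry of \<open>w *v axis k 1\<close> at k equal to 1, which excludes this.\<close>

lemma stabilizer:
  assumes w: "w \<in> UU \<inter> commutant (flag_refl l k e)"
  shows "w *v axis k 1 = axis k 1" "(axis k 1 + axis l e) v* matrix_inv w = axis k 1 + axis l e"
proof -
  have wU: "w \<in> UU" and "w ** flag_refl l k e = flag_refl l k e ** w" using w by (auto simp: commutant_def)
  then have "conj_by w (flag_refl l k e) = flag_refl l k e" by (simp add: conj_by_def GG_cancel UU_subset_GG)
  then have "reflection (w *v axis k 1) (lam w) = flag_refl l k e" by (simp only: conj_by_UU_flag_refl[OF wU])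
  then have eq: "outer (w *v axis k 1) (lam w) = outer (axis k 1) (axis k 1 + axis l e)"
    unfolding flag_refl_def refl_eq_iff .
  have "(w *v axis k 1) $ k = 1"
    using wU by (simp add: matrix_vector_mult_def axis_component UU_def if_distrib[of "\<lambda>x. _ * x"] cong: if_cong)
  note D = outer_eq_outerD[OF eq this, unfolded axis_component, simplified]
  show 1: "(axis k 1 + axis l e) v* matrix_inv w = axis k 1 + axis l e" using D(1) by (simp add: lam_def)
  have "lam w $ k \<noteq> 0" using D(1) lk by (auto simp: axis_component)
  then have "lam w \<noteq> 0" by auto
  then show "w *v axis k 1 = axis k 1" using D(2) by blast
qed

lemma orbit_coords_right_invariant:
  assumes u: "u \<in> UU" and w: "w \<in> UU \<inter> commutant (flag_refl l k e)"
  shows "orbit_coords (u ** w) = orbit_coords u"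
proof -
  have g: "u \<in> GG" "w \<in> GG" using u w UU_subset_GG by auto
  have 1: "(u ** w) *v axis k 1 = u *v axis k 1" by (simp add: matrix_vector_mul_assoc[symmetric] stabilizer[OF w])
  have 2: "lam (u ** w) = lam u"
    by (simp add: lam_def matrix_inv_mult g vec_mult_assoc[symmetric] stabilizer[OF w])
  show ?thesis unfolding orbit_coords_def 1 2 ..
qed

lemma orbit_rep_orbit_coords:
  assumes u: "u \<in> UU"
  shows "matrix_inv (orbit_rep (orbit_coords u)) ** u \<in> UU \<inter> commutant (flag_refl l k e)"
proof -
  let ?s = "orbit_rep (orbit_coords u)"
  have s: "?s \<in> GG" "u \<in> GG" "matrix_inv ?s \<in> GG" using u orbit_rep_UU UU_subset_GG GG_inverse by blast+
  have "conj_by u (flag_refl l k e) = conj_by ?s (flag_refl l k e)"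
    by (simp add: conj_by_UU_flag_refl[OF u] orbit_coords_determines[OF u] conj_by_orbit_rep)
  then have "conj_by (matrix_inv ?s ** u) (flag_refl l k e) = flag_refl l k e"
    using s by (simp add: conj_by_conj_by[symmetric] conj_by_inverse)
  then have "(matrix_inv ?s ** u) ** flag_refl l k e = flag_refl l k e ** (matrix_inv ?s ** u)"
    using GG_cancel(4)[OF mult_in_GG[OF s(3,2)]] unfolding conj_by_def by metis
  then show ?thesis using UU_mult[OF UU_inverse[OF orbit_rep_UU] u] by (simp add: commutant_def)
qed

text \<open>For a_k = 0 the shear in \<open>orbit_rep a\<close> is trivial. The other two factors
  add the lower part of \<open>a\<close> to the vector and the upper part to the form, changing
  otherwise only the entry of the form at k, which is not a coordinate.\<close>

lemma orbit_coords_translate: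
  assumes a: "a $ k = 0" and u: "u \<in> UU"
  shows "orbit_coords (orbit_rep a ** u) = orbit_coords u + a"
proof -
  let ?y = "lam u"
  have s: "orbit_rep a \<in> GG" "u \<in> GG" using u orbit_rep_UU UU_subset_GG by blast+
  have sec: "orbit_rep a = (mat 1 + outer (lower_part k a) (axis k 1)) ** (mat 1 - outer piv (upper_part k a))"
    using a by (simp add: orbit_rep_def)
  have "upper_part k a \<bullet> orbit_vec k (orbit_coords u) = 0" by (simp add: orbit_vec_def inner_add_right upper_part_inner_lower_part inner_axis_right upper_part_component)
  then have v: "(orbit_rep a ** u) *v axis k 1 = u *v axis k 1 + lower_part k a"
    by (simp add: sec matrix_vector_mul_assoc[symmetric] orbit_coords_determines(1)[OF u] mult_vec_plus_outer mult_vec_minus_outer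
        inner_axis_left) (simp add: orbit_vec_def axis_component lower_part_component)
  \<comment> \<open>The correction at k compensates for the shift of the vector, so that the pairing
    stays 1.\<close>
  let ?w = "?y + upper_part k a - (?y \<bullet> lower_part k a) *\<^sub>R axis k 1"
  have "?w \<bullet> lower_part k a = ?y \<bullet> lower_part k a"
    by (simp add: inner_add_left inner_diff_left upper_part_inner_lower_part inner_axis_left lower_part_component)
  then have 1: "?w v* (mat 1 + outer (lower_part k a) (axis k 1)) = ?y + upper_part k a"
    by (simp add: vec_mult_plus_outer)
  have "?y \<bullet> piv = 1"
    using lk t_cases by (auto simp: orbit_coords_determines(2)[OF u] piv_def inner_axis_right orbit_form_def axis_component upper_part_component)
  then have "?w v* orbit_rep a = ?y"
    by (simp add: sec vec_mult_assoc[symmetric] 1 vec_mult_minus_outer inner_add_left upper_part_inner_piv)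
  then have "?y v* matrix_inv (orbit_rep a) = ?w v* (orbit_rep a ** matrix_inv (orbit_rep a))" by (simp add: vec_mult_assoc[symmetric])
  then have L: "lam (orbit_rep a ** u) = ?w"
    using s by (simp add: lam_def matrix_inv_mult vec_mult_assoc[symmetric] GG_inverse)
  have "t * ?w $ m = t * ?y $ m" using t_cases by (auto simp: axis_component upper_part_component)
  then show ?thesis
    using a by (simp add: orbit_coords_def v L vec_eq_iff) (auto simp: lower_part_component upper_part_component axis_component)
qed

lemma continuous_on_orbit_rep: "continuous_on UNIV orbit_rep"
proof -
  have nth: "continuous_on UNIV (\<lambda>z::(real, 'n) vec. z $ j)" for j by (intro continuous_intros)
  have "continuous_on UNIV (\<lambda>z::(real, 'n) vec. if P j then z $ j else 0)" for P j
    using nth by (cases "P j") auto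
  then have "continuous_on UNIV (lower_part k)" "continuous_on UNIV (upper_part k)"
    unfolding lower_part_def upper_part_def by (auto intro!: continuous_on_vec_lambda)
  moreover have "continuous_on UNIV (\<lambda>z::(real, 'n) vec. axis l (- (d * z $ k)) :: (real, 'n) vec)"
  proof -
    have "continuous_on UNIV (\<lambda>z::(real, 'n) vec. if i = l then - (d * z $ k) else 0)" for i
      using nth by (cases "i = l") (auto intro!: continuous_intros)
    then show ?thesis unfolding axis_def by (intro continuous_on_vec_lambda)
  qed
  ultimately show ?thesis
    unfolding orbit_rep_def trv_def by (intro continuous_intros)
qed

lemma continuous_on_orbit_coords: "continuous_on UU orbit_coords"
proof -
  have U: "UU \<subseteq> GG" using UU_subset_GG by blast
  have mi: "continuous_on UU (\<lambda>u. matrix_inv u $ i $ j)" for i j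
    by (intro continuous_on_component continuous_on_matrix_inv[OF U])
  have L: "continuous_on UU (\<lambda>u. lam u $ j)" for j
    unfolding lam_component by (intro continuous_intros mi)
  moreover have "continuous_on UU (\<lambda>u. (u *v axis k 1) $ j)" for j
    unfolding matrix_vector_mult_def by (simp, intro continuous_intros)
  ultimately have "continuous_on UU (\<lambda>u. if j < k then (u *v axis k 1) $ j else if j = k then t * lam u $ m else lam u $ j)" for j
    using L continuous_on_mult_left[OF L] by (cases "j < k"; cases "j = k") simp_all
  then show ?thesis unfolding orbit_coords_def by (intro continuous_on_vec_lambda)
qed

end

lemma conj_by_mult_right: "q \<in> GG \<Longrightarrow> conj_by q s ** q = q ** s"
  by (simp add: conj_by_def GG_cancel)

lemma measurable_continuous_GG:
  fixes \<phi> :: "real^'n^'n \<Rightarrow> complex"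
  assumes "continuous_on GG \<phi>" "continuous_on UNIV f" "\<And>z::'b::topological_space. f z \<in> GG"
  shows "(\<lambda>z. \<phi> (f z)) \<in> borel_measurable borel"
  by (rule borel_measurable_continuous_onI) (use assms in \<open>auto intro: continuous_on_compose2\<close>)

context orbit
begin

text \<open>Conjugation by \<open>q\<close> carries the stabiliser of \<open>flag_refl l k e\<close>
  in \<open>UU\<close> to the intersection of the unipotent radical with H, so
  \<open>transport_to_coordinates\<close> applies with \<open>orbit_rep\<close> as section.\<close>

lemma horo_integral_coordinates:
  fixes \<phi> :: "'n mat \<Rightarrow> complex"
  assumes n: "CARD('n) \<ge> 2" and q: "q \<in> GG" and R: "conj_by q (flag_refl l k e) = Smat"
    and \<mu>: "invariant_measure (conj_by q ` BB) \<mu>"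
    and \<phi>: "\<And>g h. g \<in> GG \<Longrightarrow> h \<in> HH \<Longrightarrow> \<phi> (g ** h) = \<phi> g" "continuous_on GG \<phi>"
  obtains \<nu> where "sets \<nu> = sets borel" "sigma_finite_measure \<nu>" "AE z in \<nu>. t = 0 \<longrightarrow> z $ k = 0" "emeasure \<nu> UNIV \<noteq> 0"
    "\<And>a b. emeasure \<nu> (cbox a b) < \<infinity>" "\<And>a. a $ k = 0 \<Longrightarrow> distr \<nu> borel ((+) a) = \<nu>"
    "\<And>g. g \<in> GG \<Longrightarrow> (\<lambda>z. Phi \<phi> (conj_by g (reflection (orbit_vec k z) (orbit_form l m k e t z)))) \<in> borel_measurable borel"
    "\<And>g. g \<in> GG \<Longrightarrow>
       horo_integral \<mu> \<phi> g = (\<integral>z. Phi \<phi> (conj_by (g ** q) (reflection (orbit_vec k z) (orbit_form l m k e t z))) \<partial>\<nu>)"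
proof -
  let ?N = "conj_by q ` UU" and ?M = "conj_by q ` UU \<inter> HH"
  let ?stab = "UU \<inter> commutant (flag_refl l k e)"
  let ?ct = "\<lambda>n. orbit_coords (conj_by (matrix_inv q) n)" and ?sec = "\<lambda>z. conj_by q (orbit_rep z)"
  let ?Z = "{z :: (real, 'n) vec. t = 0 \<longrightarrow> z $ k = 0}"
  have q': "matrix_inv q \<in> GG" using GG_inverse[OF q] by simp
  have M: "?M = conj_by q ` ?stab"
    by (rule HH_eq_commutant[OF n q R]) (use UU_subset_GG in auto)
  have inM0: "mat 1 \<in> ?stab" by (simp add: mat1_in_UU commutant_def)
  have M0_mult: "x ** y \<in> ?stab" if "x \<in> ?stab" "y \<in> ?stab" for x y
    using that UU_mult by (auto simp: commutant_def) (metis matrix_mul_assoc)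
  have M0_inv: "matrix_inv x \<in> ?stab" if x: "x \<in> ?stab" for x
  proof -
    have xG: "x \<in> GG" using x UU_subset_GG by blast
    have "flag_refl l k e ** x = x ** flag_refl l k e" using x by (simp add: commutant_def)
    then have "matrix_inv x ** (flag_refl l k e ** x) ** matrix_inv x = matrix_inv x ** (x ** flag_refl l k e) ** matrix_inv x" by simp
    then have "matrix_inv x ** flag_refl l k e = flag_refl l k e ** matrix_inv x"
      using GG_cancel[OF xG] by (metis matrix_mul_assoc)
    then show ?thesis using x UU_inverse by (auto simp: commutant_def)
  qed
  have inv\<mu>: "Radon_measure (coset_topology ?N ?M) \<mu>" "emeasure \<mu> (space \<mu>) \<noteq> 0"
      "\<And>n B. n \<in> ?N \<Longrightarrow> B \<in> sets \<mu> \<Longrightarrow> emeasure \<mu> ((\<lambda>C. n <#\<^bsub>SLn\<^esub> C) ` B) = emeasure \<mu> B"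
    using \<mu> by (auto simp: invariant_measure_def unip_radical_conj_BB[OF q])
  have Phi: "\<phi> x = Phi \<phi> (conj_by x Smat)" if "x \<in> GG" for x using Phi_conj_by[OF n \<phi>(1) that] by simp
  have secG: "?sec z \<in> GG" for z using q orbit_rep_UU UU_subset_GG by (auto simp: conj_by_in_GG_iff)
  have secPhi: "\<phi> (g ** ?sec z) = Phi \<phi> (conj_by (g ** q) (reflection (orbit_vec k z) (orbit_form l m k e t z)))" if g: "g \<in> GG" for g z
  proof -
    have sG: "orbit_rep z \<in> GG" using orbit_rep_UU UU_subset_GG by blast
    have "conj_by (g ** ?sec z) Smat = conj_by (g ** ?sec z ** q) (flag_refl l k e)"
      using g secG q by (simp add: R[symmetric] conj_by_conj_by mult_in_GG)
    also have "g ** ?sec z ** q = g ** q ** orbit_rep z"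
      using conj_by_mult_right[OF q, of "orbit_rep z"] by (metis matrix_mul_assoc)
    also have "conj_by (g ** q ** orbit_rep z) (flag_refl l k e) = conj_by (g ** q) (reflection (orbit_vec k z) (orbit_form l m k e t z))"
      using g q sG by (simp add: conj_by_orbit_rep[symmetric] conj_by_conj_by mult_in_GG)
    finally show ?thesis using Phi[OF mult_in_GG[OF g secG]] by simp
  qed
  have meas: "(\<lambda>z. \<phi> (g ** ?sec z)) \<in> borel_measurable borel" if g: "g \<in> GG" for g
  proof (rule measurable_continuous_GG[OF \<phi>(2)])
    show "continuous_on UNIV (\<lambda>z. g ** ?sec z)"
      by (intro continuous_intros continuous_on_compose2[OF continuous_on_conj_by[of UNIV q] continuous_on_orbit_rep]) auto
  qed (use g secG mult_in_GG in blast)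
  show ?thesis
  proof (rule transport_to_coordinates[where N = ?N and M = ?M and ct = ?ct and sec = ?sec and Z = ?Z and k = k and \<mu> = \<mu>])
    show "subgroup ?N SLn" by (rule subgroup_conj_by[OF q subgroup_UU])
    show "mat 1 \<in> ?M" unfolding M using inM0 conj_by_one[OF q] by (metis imageI)
    show "continuous_on ?N ?ct"
      by (rule continuous_on_compose2[OF continuous_on_orbit_coords continuous_on_conj_by]) (use q in \<open>auto simp: conj_by_inverse\<close>)
    show "?ct (n ** m) = ?ct n" if "n \<in> ?N" "m \<in> ?M" for n m
      using that unfolding M using q q' by (auto simp: conj_by_mult conj_by_inverse orbit_coords_right_invariant)
    show "?ct n \<in> ?Z" if "n \<in> ?N" for n by (simp add: orbit_coords_def)
    show "continuous_on UNIV ?sec"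
      by (rule continuous_on_compose2[OF continuous_on_conj_by continuous_on_orbit_rep]) auto
    show "?sec z \<in> ?N" for z using orbit_rep_UU by blast
    show "?ct (?sec z) = z" if "z \<in> ?Z" for z using that q by (simp add: conj_by_inverse orbit_coords_orbit_rep)
    show "(\<lambda>m. ?sec (?ct n) ** m) ` ?M = (\<lambda>m. n ** m) ` ?M" if "n \<in> ?N" for n
    proof -
      obtain u where u: "u \<in> UU" "n = conj_by q u" using \<open>n \<in> ?N\<close> by blast
      let ?s = "orbit_rep (orbit_coords u)" and ?w = "matrix_inv (orbit_rep (orbit_coords u)) ** u"
      have sG: "?s \<in> GG" using orbit_rep_UU UU_subset_GG by blast
      have w: "?w \<in> ?stab" by (rule orbit_rep_orbit_coords[OF u(1)])
      have su: "?s ** ?w = u" by (simp add: GG_cancel[OF sG])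
      have wG: "?w \<in> GG" using w UU_subset_GG by blast
      have "(\<lambda>x. ?s ** x) ` ?stab = (\<lambda>x. u ** x) ` ?stab"
      proof (intro subset_antisym subsetI)
        fix y assume "y \<in> (\<lambda>x. ?s ** x) ` ?stab"
        then obtain x where x: "x \<in> ?stab" "y = ?s ** x" by blast
        have "y = u ** (matrix_inv ?w ** x)"
          using su GG_cancel(1)[OF wG] x(2) by (metis matrix_mul_assoc)
        then show "y \<in> (\<lambda>x. u ** x) ` ?stab" using M0_mult[OF M0_inv[OF w] x(1)] by blast
      next
        fix y assume "y \<in> (\<lambda>x. u ** x) ` ?stab"
        then obtain x where x: "x \<in> ?stab" "y = u ** x" by blast
        have "y = ?s ** (?w ** x)" using su x(2) by (metis matrix_mul_assoc)
        then show "y \<in> (\<lambda>x. ?s ** x) ` ?stab" using M0_mult[OF w x(1)] by blast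
      qed
      then have "conj_by q ` (\<lambda>x. ?s ** x) ` ?stab = conj_by q ` (\<lambda>x. u ** x) ` ?stab" by simp
      then show ?thesis
        unfolding M u(2) using q by (simp add: image_image conj_by_mult conj_by_inverse)
    qed
    show "closed ?Z"
      by (cases "t = 0") (auto intro!: closed_Collect_eq continuous_intros)
    show "?ct (?sec a ** n) = ?ct n + a" if "a $ k = 0" "n \<in> ?N" for a n
      using that q q' by (auto simp: conj_by_mult conj_by_inverse orbit_coords_translate)
  next
    fix \<nu> assume \<nu>: "sets \<nu> = sets borel" "sigma_finite_measure \<nu>" "AE z in \<nu>. z \<in> ?Z" "emeasure \<nu> UNIV \<noteq> 0"
      "\<And>a b. emeasure \<nu> (cbox a b) < \<infinity>" "\<And>a. a $ k = 0 \<Longrightarrow> distr \<nu> borel ((+) a) = \<nu>"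
      and horo: "\<And>\<phi> g. (\<And>n m. n \<in> ?N \<Longrightarrow> m \<in> ?M \<Longrightarrow> \<phi> (g ** (n ** m)) = \<phi> (g ** n)) \<Longrightarrow>
       (\<lambda>z. \<phi> (g ** ?sec z)) \<in> borel_measurable borel \<Longrightarrow>
       horo_integral \<mu> \<phi> g = (\<integral>z. \<phi> (g ** ?sec z) \<partial>\<nu>)"
    show thesis
    proof (rule that[OF \<nu>(1,2) _ \<nu>(4-6)])
      show "AE z in \<nu>. t = 0 \<longrightarrow> z $ k = 0" using \<nu>(3) by simp
      show "(\<lambda>z. Phi \<phi> (conj_by g (reflection (orbit_vec k z) (orbit_form l m k e t z)))) \<in> borel_measurable borel" if g: "g \<in> GG" for g
        using meas[OF mult_in_GG[OF g q']] secPhi[OF mult_in_GG[OF g q']] by (simp add: GG_cancel[OF q])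
      show "horo_integral \<mu> \<phi> g = (\<integral>z. Phi \<phi> (conj_by (g ** q) (reflection (orbit_vec k z) (orbit_form l m k e t z))) \<partial>\<nu>)"
        if g: "g \<in> GG" for g
      proof -
        have "\<phi> (g ** (x ** y)) = \<phi> (g ** x)" if "x \<in> ?N" "y \<in> ?M" for x y
        proof -
          have "x \<in> GG" using that(1) q UU_subset_GG by (auto simp: conj_by_in_GG_iff)
          then show ?thesis using \<phi>(1)[of "g ** x" y] g that(2) by (simp add: mult_in_GG matrix_mul_assoc)
        qed
        from horo[OF this meas[OF g]] show ?thesis by (simp only: secPhi[OF g])
      qed
    qed
  qed (use inv\<mu> in auto)
qed

lemma coordinates_put:
  "orbit_vec k (put k w y) = orbit_vec k w" "d = 0 \<Longrightarrow> orbit_form l m k e t (put k w y) = orbit_form l m k e 0 w"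
proof -
  have "lower_part k (put k w y) = lower_part k w" "upper_part k (put k w y) = upper_part k w"
    by (auto simp: vec_eq_iff lower_part_component upper_part_component put_component)
  then show "orbit_vec k (put k w y) = orbit_vec k w" "d = 0 \<Longrightarrow> orbit_form l m k e t (put k w y) = orbit_form l m k e 0 w"
    using lk by (auto simp: orbit_vec_def orbit_form_def put_component)
qed

text \<open>For d = 0 the transported measure lives on z_k = 0. Using the hypothesis at
  \<open>g ** matrix_inv q\<close> frees the conclusion from the base point q.\<close>

lemma slab_integral_of_horo_integral:
  fixes \<phi> :: "'n mat \<Rightarrow> complex"
  assumes n: "CARD('n) \<ge> 2" and q: "q \<in> GG" and R: "conj_by q (flag_refl l k e) = Smat"
    and \<mu>: "invariant_measure (conj_by q ` BB) \<mu>"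
    and \<phi>: "\<And>g h. g \<in> GG \<Longrightarrow> h \<in> HH \<Longrightarrow> \<phi> (g ** h) = \<phi> g" "continuous_on GG \<phi>"
    and d: "d = 0" and zero: "\<And>g. g \<in> GG \<Longrightarrow> horo_integral \<mu> \<phi> g = 0" and g: "g \<in> GG"
  shows "(\<integral>w. Phi \<phi> (conj_by g (reflection (orbit_vec k w) (orbit_form l m k e 0 w))) \<partial>slab_measure k) = 0"
proof -
  let ?F = "\<lambda>z. Phi \<phi> (conj_by g (reflection (orbit_vec k z) (orbit_form l m k e t z)))"
  obtain \<nu> where \<nu>: "sets \<nu> = sets borel" "sigma_finite_measure \<nu>" "AE z in \<nu>. t = 0 \<longrightarrow> z $ k = 0" "emeasure \<nu> UNIV \<noteq> 0"
    "\<And>a b. emeasure \<nu> (cbox a b) < \<infinity>" "\<And>a. a $ k = 0 \<Longrightarrow> distr \<nu> borel ((+) a) = \<nu>"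
    and m: "?F \<in> borel_measurable borel"
    and h: "\<And>g. g \<in> GG \<Longrightarrow>
       horo_integral \<mu> \<phi> g = (\<integral>z. Phi \<phi> (conj_by (g ** q) (reflection (orbit_vec k z) (orbit_form l m k e t z))) \<partial>\<nu>)"
  proof (rule horo_integral_coordinates[OF n q R \<mu> \<phi>])
  qed (use g that in blast)+
  have gq: "g ** matrix_inv q \<in> GG" using g q GG_inverse mult_in_GG by blast
  have "(\<integral>z. ?F z \<partial>\<nu>) = 0" using h[OF gq] zero[OF gq] by (simp add: GG_cancel[OF q])
  moreover have "AE z in \<nu>. z $ k = 0" using \<nu>(3) d by simp
  ultimately have "(\<integral>w. ?F (put k w 0) \<partial>slab_measure k) = 0"
    using integral_slab_eq_0[OF \<nu>(1,2,6) _ \<nu>(4,5) m] by blast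
  then show ?thesis by (simp only: coordinates_put(1) coordinates_put(2)[OF d])
qed

text \<open>The transported measure is invariant under translations with a_k = 0 for both shapes of
  the orbit, so vanishing on each hyperplane of constant z_k is enough.\<close>

lemma horo_integral_of_slab_integrals:
  fixes \<phi> :: "'n mat \<Rightarrow> complex"
  assumes n: "CARD('n) \<ge> 2" and q: "q \<in> GG" and R: "conj_by q (flag_refl l k e) = Smat"
    and \<mu>: "invariant_measure (conj_by q ` BB) \<mu>"
    and \<phi>: "\<And>g h. g \<in> GG \<Longrightarrow> h \<in> HH \<Longrightarrow> \<phi> (g ** h) = \<phi> g" "continuous_on GG \<phi>"
    and zero: "\<And>g y. g \<in> GG \<Longrightarrow>
      (\<integral>w. Phi \<phi> (conj_by g (reflection (orbit_vec k w) (orbit_form l m k e t (put k w y)))) \<partial>slab_measure k) = 0"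
    and g: "g \<in> GG"
  shows "horo_integral \<mu> \<phi> g = 0"
proof -
  let ?F = "\<lambda>z. Phi \<phi> (conj_by (g ** q) (reflection (orbit_vec k z) (orbit_form l m k e t z)))"
  have gq: "g ** q \<in> GG" using g q mult_in_GG by blast
  obtain \<nu> where \<nu>: "sets \<nu> = sets borel" "sigma_finite_measure \<nu>"
     "\<And>a. a $ k = 0 \<Longrightarrow> distr \<nu> borel ((+) a) = \<nu>"
    and m: "?F \<in> borel_measurable borel"
    and h: "horo_integral \<mu> \<phi> g = (\<integral>z. ?F z \<partial>\<nu>)"
  proof (rule horo_integral_coordinates[OF n q R \<mu> \<phi>])
  qed (use g gq that in blast)+
  have "(\<integral>w. ?F (put k w y) \<partial>slab_measure k) = 0" for y
    using zero[OF gq, of y] by (simp only: coordinates_put(1))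
  with integral_hyperplane_invariant_eq_0[of \<nu> k ?F, OF \<nu>(1,2,3) m] show ?thesis unfolding h by blast
qed

lemma measurable_orbit:
  fixes \<phi> :: "'n mat \<Rightarrow> complex"
  assumes n: "CARD('n) \<ge> 2" and q: "q \<in> GG" and R: "conj_by q (flag_refl l k e) = Smat"
    and \<phi>: "\<And>g h. g \<in> GG \<Longrightarrow> h \<in> HH \<Longrightarrow> \<phi> (g ** h) = \<phi> g" "continuous_on GG \<phi>" and g: "g \<in> GG"
  shows "(\<lambda>z. Phi \<phi> (conj_by g (reflection (orbit_vec k z) (orbit_form l m k e t z)))) \<in> borel_measurable borel"
proof -
  have s: "orbit_rep z \<in> GG" "matrix_inv q \<in> GG" for z using orbit_rep_UU UU_subset_GG q GG_inverse by blast+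
  have "conj_by g (reflection (orbit_vec k z) (orbit_form l m k e t z)) = conj_by (g ** orbit_rep z ** matrix_inv q) Smat" for z
    using g s q by (simp add: conj_by_orbit_rep[symmetric] R[symmetric] conj_by_conj_by mult_in_GG GG_cancel)
  then have eq: "Phi \<phi> (conj_by g (reflection (orbit_vec k z) (orbit_form l m k e t z))) = \<phi> (g ** orbit_rep z ** matrix_inv q)" for z
    using Phi_conj_by[OF n \<phi>(1), of "g ** orbit_rep z ** matrix_inv q"] g s by (simp add: mult_in_GG)
  show ?thesis unfolding eq
    by (rule measurable_continuous_GG[OF \<phi>(2)]) (intro continuous_intros continuous_on_orbit_rep, use g s mult_in_GG in blast)
qed

end

text \<open>Averaging over translations in direction \<open>i\<close> absorbs the shear.\<close>

lemma lborel_trv: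
  fixes i j :: "'n::finite"
  assumes ij: "i \<noteq> j"
  shows "distr lborel borel (\<lambda>x :: (real, 'n) vec. trv i j a *v x) = lborel"
proof (rule measure_eqI)
  have cont [measurable]: "(\<lambda>x. trv i j a *v x) \<in> borel_measurable borel"
    by (intro borel_measurable_continuous_onI linear_continuous_on matrix_vector_mul_bounded_linear)
  have [measurable]: "(\<lambda>c. axis i c :: (real, 'n) vec) \<in> borel_measurable borel"
  proof -
    have "linear (\<lambda>c. axis i c :: (real, 'n) vec)" by (rule linearI) (auto simp: axis_def vec_eq_iff)
    then show ?thesis
      by (intro borel_measurable_continuous_onI linear_continuous_on) (simp add: linear_conv_bounded_linear)
  qed
  fix A assume "A \<in> sets (distr lborel borel (\<lambda>x :: (real, 'n) vec. trv i j a *v x))"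
  then have A [measurable]: "A \<in> sets borel" by simp
  \<comment> \<open>\<open>?g\<close> is a weight of mass one on the line in direction i. Since i
    \<noteq> j, translations along this line leave x_j, and with it the amount of shear,
    unchanged.\<close>
  let ?f = "indicator A :: (real, 'n) vec \<Rightarrow> ennreal" and ?g = "indicator {0..1} :: real \<Rightarrow> ennreal"
  have shift: "(\<integral>\<^sup>+x. h (x + axis i r) \<partial>lborel) = (\<integral>\<^sup>+x. h x \<partial>lborel)"
    if [measurable]: "h \<in> borel_measurable borel" for h :: "(real, 'n) vec \<Rightarrow> ennreal" and r
  proof -
    have "(\<integral>\<^sup>+x. h x \<partial>lborel) = (\<integral>\<^sup>+x. h x \<partial>distr lborel borel ((+) (axis i r)))"
      by (simp add: lborel_distr_plus)
    also have "\<dots> = (\<integral>\<^sup>+x. h (axis i r + x) \<partial>lborel)" by (subst nn_integral_distr) auto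
    finally show ?thesis by (simp add: add.commute)
  qed
  have shift1: "(\<integral>\<^sup>+r. h (r + s) \<partial>lborel) = (\<integral>\<^sup>+r. h r \<partial>lborel)"
    if [measurable]: "h \<in> borel_measurable borel" for h :: "real \<Rightarrow> ennreal" and s
  proof -
    have "(\<integral>\<^sup>+r. h r \<partial>lborel) = (\<integral>\<^sup>+r. h r \<partial>distr lborel borel ((+) s))" by (simp add: lborel_distr_plus)
    also have "\<dots> = (\<integral>\<^sup>+r. h (s + r) \<partial>lborel)" by (subst nn_integral_distr) auto
    finally show ?thesis by (simp add: add.commute)
  qed
  have g1: "(\<integral>\<^sup>+r. ?g (r + s) \<partial>lborel) = 1" for s by (subst shift1) simp_all
  have T: "trv i j a *v x = x + axis i (a * x $ j)" for x by (rule trv_mult_vec)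
  have add: "x + axis i r + axis i s = x + axis i (r + s)" for x :: "(real, 'n) vec" and r s
    by (simp add: vec_eq_iff axis_def)
  have "emeasure (distr lborel borel (\<lambda>x. trv i j a *v x)) A = (\<integral>\<^sup>+x. ?f (trv i j a *v x) \<partial>lborel)"
    by (subst nn_integral_indicator[symmetric], simp, subst nn_integral_distr) auto
  also have "\<dots> = (\<integral>\<^sup>+x. (\<integral>\<^sup>+r. ?g (r + 0) * ?f (x + axis i (a * x $ j)) \<partial>lborel) \<partial>lborel)"
    by (subst nn_integral_multc) (simp_all add: g1 T del: add_0_right)
  also have "\<dots> = (\<integral>\<^sup>+r. (\<integral>\<^sup>+x. ?g (r + 0) * ?f (x + axis i (a * x $ j)) \<partial>lborel) \<partial>lborel)"
    by (rule lborel_pair.Fubini'[symmetric]) measurable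
  also have "\<dots> = (\<integral>\<^sup>+r. (\<integral>\<^sup>+x. ?g r * ?f (x + axis i (r + a * x $ j)) \<partial>lborel) \<partial>lborel)"
  proof (rule nn_integral_cong)
    fix r :: real
    have "(\<integral>\<^sup>+x. ?g (r + 0) * ?f (x + axis i (a * x $ j)) \<partial>lborel)
        = (\<integral>\<^sup>+x. ?g (r + 0) * ?f ((x + axis i r) + axis i (a * (x + axis i r) $ j)) \<partial>lborel)"
      by (rule shift[symmetric]) measurable
    then show "(\<integral>\<^sup>+x. ?g (r + 0) * ?f (x + axis i (a * x $ j)) \<partial>lborel)
        = (\<integral>\<^sup>+x. ?g r * ?f (x + axis i (r + a * x $ j)) \<partial>lborel)"
      using ij by (simp add: add axis_component)
  qed
  also have "\<dots> = (\<integral>\<^sup>+x. (\<integral>\<^sup>+r. ?g r * ?f (x + axis i (r + a * x $ j)) \<partial>lborel) \<partial>lborel)"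
    by (rule lborel_pair.Fubini') measurable
  also have "\<dots> = (\<integral>\<^sup>+x. (\<integral>\<^sup>+r. ?g (r + - (a * x $ j)) * ?f (x + axis i r) \<partial>lborel) \<partial>lborel)"
  proof (rule nn_integral_cong)
    fix x :: "(real, 'n) vec"
    have "(\<integral>\<^sup>+r. ?g (r + - (a * x $ j)) * ?f (x + axis i r) \<partial>lborel)
       = (\<integral>\<^sup>+r. ?g (r + a * x $ j + - (a * x $ j)) * ?f (x + axis i (r + a * x $ j)) \<partial>lborel)"
      by (rule shift1[symmetric]) measurable
    then show "(\<integral>\<^sup>+r. ?g r * ?f (x + axis i (r + a * x $ j)) \<partial>lborel)
       = (\<integral>\<^sup>+r. ?g (r + - (a * x $ j)) * ?f (x + axis i r) \<partial>lborel)" by simp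
  qed
  also have "\<dots> = (\<integral>\<^sup>+r. (\<integral>\<^sup>+x. ?g (r + - (a * x $ j)) * ?f (x + axis i r) \<partial>lborel) \<partial>lborel)"
    by (rule lborel_pair.Fubini'[symmetric]) measurable
  also have "\<dots> = (\<integral>\<^sup>+r. (\<integral>\<^sup>+x. ?g (r + - (a * x $ j)) * ?f x \<partial>lborel) \<partial>lborel)"
  proof (rule nn_integral_cong)
    fix r :: real
    have "(\<integral>\<^sup>+x. ?g (r + - (a * (x + axis i r) $ j)) * ?f (x + axis i r) \<partial>lborel)
        = (\<integral>\<^sup>+x. ?g (r + - (a * x $ j)) * ?f x \<partial>lborel)"
      by (rule shift) measurable
    then show "(\<integral>\<^sup>+x. ?g (r + - (a * x $ j)) * ?f (x + axis i r) \<partial>lborel)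
        = (\<integral>\<^sup>+x. ?g (r + - (a * x $ j)) * ?f x \<partial>lborel)" using ij by (simp add: axis_def)
  qed
  also have "\<dots> = (\<integral>\<^sup>+x. (\<integral>\<^sup>+r. ?g (r + - (a * x $ j)) * ?f x \<partial>lborel) \<partial>lborel)"
    by (rule lborel_pair.Fubini') measurable
  also have "\<dots> = (\<integral>\<^sup>+x. ?f x \<partial>lborel)"
    by (intro nn_integral_cong, subst nn_integral_multc) (simp_all add: g1 del: add_uminus_conv_diff)
  finally show "emeasure (distr lborel borel (\<lambda>x. trv i j a *v x)) A = emeasure lborel A" by simp
qed simp

lemma distr_slab_measure:
  assumes T [measurable]: "T \<in> borel_measurable borel" and inv: "distr lborel borel T = lborel"
    and k: "\<And>w. T w $ k = w $ k"
  shows "distr (slab_measure k) borel T = slab_measure k"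
proof (rule measure_eqI)
  fix A assume "A \<in> sets (distr (slab_measure k) borel T)"
  then have A [measurable]: "A \<in> sets borel" by simp
  have "emeasure (slab_measure k) A = (\<integral>\<^sup>+w. indicator (slab k) w * indicator A w \<partial>lborel)"
    using nn_integral_slab_measure[of "indicator A" k] by simp
  also have "\<dots> = (\<integral>\<^sup>+w. indicator (slab k) w * indicator A w \<partial>distr lborel borel T)" by (simp add: inv)
  also have "\<dots> = (\<integral>\<^sup>+w. indicator (slab k) (T w) * indicator A (T w) \<partial>lborel)"
    by (subst nn_integral_distr) auto
  also have "\<dots> = (\<integral>\<^sup>+w. indicator (slab k) w * indicator A (T w) \<partial>lborel)"
    by (intro nn_integral_cong) (simp add: slab_def indicator_def k)
  also have "\<dots> = (\<integral>\<^sup>+w. indicator A (T w) \<partial>slab_measure k)" by (simp add: nn_integral_slab_measure)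
  also have "\<dots> = (\<integral>\<^sup>+w. indicator A w \<partial>distr (slab_measure k) borel T)"
    by (subst nn_integral_distr) auto
  finally show "emeasure (distr (slab_measure k) borel T) A = emeasure (slab_measure k) A" by simp
qed simp

section \<open>Change of the flag\<close>

text \<open>The change of basis that replaces the flag step at \<open>l\<close> by the one at \<open>m\<close>: the
  second entry \<open>e e\<^sub>l + y e\<^sub>m + \<dots>\<close> becomes \<open>- e e\<^sub>m + \<dots>\<close>.\<close>

definition flip :: "'n::finite \<Rightarrow> 'n \<Rightarrow> real \<Rightarrow> real \<Rightarrow> 'n mat" where
  "flip l m e y = trv l m (- y / e) ** (trv l m (- 1) ** (trv m l 1 ** trv l m (- 1)))"

lemma flip_in_GG: "l \<noteq> m \<Longrightarrow> flip l m e y \<in> GG"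
  unfolding flip_def by (intro mult_in_GG trv_in_GG) auto

lemma lborel_flip:
  assumes "l \<noteq> m"
  shows "distr lborel borel (\<lambda>x. flip l m e y *v x) = lborel"
proof -
  have comp: "distr lborel borel (\<lambda>x. (trv i j a ** B) *v x) = lborel"
    if "i \<noteq> j" "distr lborel borel (\<lambda>x. B *v x) = lborel" for i j a and B :: "real^'a^'a"
  proof -
    have m: "(\<lambda>x. C *v x) \<in> borel_measurable borel" for C :: "real^'a^'a"
      by (intro borel_measurable_continuous_onI linear_continuous_on matrix_vector_mul_bounded_linear)
    have "distr lborel borel (\<lambda>x. (trv i j a ** B) *v x) = distr (distr lborel borel (\<lambda>x. B *v x)) borel (\<lambda>x. trv i j a *v x)"
      using m by (subst distr_distr) (auto simp: o_def matrix_vector_mul_assoc)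
    then show ?thesis using that by (simp add: lborel_trv)
  qed
  show ?thesis unfolding flip_def using assms by (intro comp lborel_trv) auto
qed

lemma flip_mult_vec:
  assumes "l \<noteq> m"
  shows "(flip l m e y *v w) $ j = (if j = l then - (y / e) * w $ l - w $ m else if j = m then w $ l else w $ j)"
  using assms by (simp add: flip_def matrix_vector_mul_assoc[symmetric] trv_mult_vec axis_component)

lemma vec_mult_flip:
  assumes "l \<noteq> m"
  shows "(x v* flip l m e y) $ j = (if j = l then x $ m - (y / e) * x $ l else if j = m then - x $ l else x $ j)"
  using assms by (simp add: flip_def vec_mult_assoc[symmetric] vec_mult_trv axis_component)

text \<open>The entry at l becomes y - (y / e) e = 0, and the terms with y in the entry at k cancel
  as well. The fixed coordinate y survives only in the matrix \<open>flip l m e y\<close>.\<close>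

lemma flip_orbit:
  assumes "l < m" "m < k" "e \<noteq> 0"
  shows "flip l m e y *v orbit_vec k w = orbit_vec k (flip l m e y *v w)"
    and "orbit_form l m k e 1 (put k (flip l m e y *v w) y) v* flip l m e y = orbit_form m m k (- e) 0 w"
proof -
  have ne: "l \<noteq> m" "l < k" "l \<noteq> k" "m \<noteq> k" using assms by auto
  show "flip l m e y *v orbit_vec k w = orbit_vec k (flip l m e y *v w)"
    using ne assms by (simp add: vec_eq_iff flip_mult_vec[OF ne(1)] orbit_vec_def axis_component lower_part_component)
  show "orbit_form l m k e 1 (put k (flip l m e y *v w) y) v* flip l m e y = orbit_form m m k (- e) 0 w"
    using ne assms
    by (auto simp: vec_eq_iff vec_mult_flip[OF ne(1)] flip_mult_vec[OF ne(1)] orbit_form_def axis_component upper_part_component put_component field_simps)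
qed

text \<open>This supplies a base point of adjacent type for the pair m, k, in general for another
  parabolic subgroup.\<close>

lemma conj_by_flip_flag_refl:
  fixes l m k :: "'n::{finite,linorder}"
  assumes "l < m" "m < k"
  shows "conj_by (flip l m e 0) (flag_refl m k (- e)) = flag_refl l k e"
proof -
  have ne: "l \<noteq> m" "l \<noteq> k" "m \<noteq> k" using assms by auto
  let ?c = "flip l m e 0"
  have c: "?c \<in> GG" by (rule flip_in_GG[OF ne(1)])
  have "?c *v axis k 1 = axis k 1" using ne by (auto simp: vec_eq_iff flip_mult_vec[OF ne(1)] axis_component)
  moreover have "(axis k 1 + axis l e) v* ?c = axis k 1 + axis m (- e)"
    using ne by (auto simp: vec_eq_iff vec_mult_flip[OF ne(1)] axis_component)
  then have "(axis k 1 + axis m (- e)) v* matrix_inv ?c = axis k 1 + axis l e"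
    by (metis vec_mult_assoc GG_inverse(1)[OF c] vec_mult_mat1)
  ultimately show ?thesis by (simp add: flag_refl_def conj_by_refl[OF c])
qed

text \<open>For fixed y the flip preserves volume and the coordinate w_k, so it may be substituted
  for w. It then moves into the group argument, where the hypothesis is available at
  \<open>g ** flip l m e y\<close>.\<close>

lemma slab_integral_flip:
  fixes \<phi> :: "'n::{finite,linorder} mat \<Rightarrow> complex"
  assumes n: "CARD('n) \<ge> 2" and q: "q \<in> GG" and R: "conj_by q (flag_refl l k e) = Smat"
    and \<phi>: "\<And>g h. g \<in> GG \<Longrightarrow> h \<in> HH \<Longrightarrow> \<phi> (g ** h) = \<phi> g" "continuous_on GG \<phi>" and g: "g \<in> GG"
    and e: "e \<noteq> 0" and m: "l < m" "m < k" "\<And>c. l < c \<and> c < k \<Longrightarrow> c = m"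
    and zero: "\<And>g. g \<in> GG \<Longrightarrow>
      (\<integral>w. Phi \<phi> (conj_by g (reflection (orbit_vec k w) (orbit_form m m k (- e) 0 w))) \<partial>slab_measure k) = 0"
  shows "(\<integral>w. Phi \<phi> (conj_by g (reflection (orbit_vec k w) (orbit_form l m k e 1 (put k w y)))) \<partial>slab_measure k) = 0"
proof -
  have t1: "e * (1 / e) = 1" using e by simp
  have lk: "l < k" using m(1,2) by (rule order.strict_trans)
  interpret orbit l m k e "1 / e" by unfold_locales (use lk t1 m in blast)+
  let ?c = "flip l m e y"
  have ne: "l \<noteq> m" "l \<noteq> k" "m \<noteq> k" using m(1,2) by auto
  have c: "?c \<in> GG" by (rule flip_in_GG[OF ne(1)])
  have T: "(\<lambda>w. ?c *v w) \<in> borel_measurable borel"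
    by (intro borel_measurable_continuous_onI linear_continuous_on matrix_vector_mul_bounded_linear)
  let ?F = "\<lambda>w. Phi \<phi> (conj_by g (reflection (orbit_vec k w) (orbit_form l m k e 1 (put k w y))))"
  have "(\<lambda>z. Phi \<phi> (conj_by g (reflection (orbit_vec k z) (orbit_form l m k e 1 z)))) \<in> borel_measurable borel"
    using measurable_orbit[OF n q R \<phi> g] unfolding t1 .
  from measurable_compose[OF _ this, of "\<lambda>w. put k w y" borel]
  have F: "?F \<in> borel_measurable borel" by (simp add: coordinates_put(1))
  have "(\<integral>w. ?F w \<partial>slab_measure k) = (\<integral>w. ?F w \<partial>distr (slab_measure k) borel (\<lambda>w. ?c *v w))"
    by (subst distr_slab_measure[OF T lborel_flip[OF ne(1)]]) (simp_all add: flip_mult_vec[OF ne(1)] ne[symmetric])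
  also have "\<dots> = (\<integral>w. ?F (?c *v w) \<partial>slab_measure k)"
    using T F by (subst integral_distr) (auto simp: measurable_cong_sets[OF sets_slab_measure])
  also have "\<dots> = (\<integral>w. Phi \<phi> (conj_by (g ** ?c) (reflection (orbit_vec k w) (orbit_form m m k (- e) 0 w))) \<partial>slab_measure k)"
  proof (rule Bochner_Integration.integral_cong[OF refl])
    fix w
    have "conj_by (g ** ?c) (reflection (orbit_vec k w) (orbit_form m m k (- e) 0 w))
        = conj_by g (reflection (?c *v orbit_vec k w) (orbit_form m m k (- e) 0 w v* matrix_inv ?c))"
      by (simp add: conj_by_conj_by[OF g c, symmetric] conj_by_refl[OF c])
    also have "orbit_form m m k (- e) 0 w v* matrix_inv ?c = orbit_form l m k e 1 (put k (?c *v w) y)"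
      unfolding flip_orbit(2)[OF m(1,2) e, of y w, symmetric] vec_mult_assoc GG_inverse(1)[OF c] by simp
    finally show "?F (?c *v w) = Phi \<phi> (conj_by (g ** ?c) (reflection (orbit_vec k w) (orbit_form m m k (- e) 0 w)))"
      by (simp add: flip_orbit(1)[OF m(1,2) e])
  qed
  also have "\<dots> = 0" by (rule zero[OF mult_in_GG[OF g c]])
  finally show ?thesis .
qed

section \<open>Decay of Schwartz functions\<close>

lemma smooth_on_G_imp_continuous:
  assumes "smooth_on_G \<phi>" shows "continuous_on GG \<phi>"
  unfolding continuous_on_eq_continuous_within
proof
  fix x :: "real^'a^'a" assume x: "x \<in> GG"
  obtain U F where U: "open U" "x \<in> U" "\<forall>k. Ck_on k F U" "\<forall>y\<in>U \<inter> GG. F y = \<phi> y"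
    using assms x unfolding smooth_on_G_def by blast
  from U(3) have "Ck_on 0 F U" by blast
  then have "continuous (at x) F" using U(1,2) by (simp add: continuous_on_eq_continuous_at)
  then have "(F \<longlongrightarrow> F x) (at x within GG)"
    by (simp add: continuous_at_imp_continuous_at_within continuous_within[symmetric])
  moreover have "eventually (\<lambda>y. F y = \<phi> y) (at x within GG)"
    unfolding eventually_at_topological using U by blast
  ultimately have "(\<phi> \<longlongrightarrow> F x) (at x within GG)" by (rule Lim_transform_eventually)
  moreover have "F x = \<phi> x" using U x by blast
  ultimately show "continuous (at x within GG) \<phi>" by (simp add: continuous_within)
qed

section \<open>Rotations and the decomposition G = KAH\<close>

lemma reflection_conj_orthogonal:
  assumes "orthogonal_matrix A"
  shows "A ** reflection v l ** transpose A = reflection (A *v v) (A *v l)"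
proof -
  have "A ** transpose A = mat 1" using assms by (simp add: orthogonal_matrix_def)
  then show ?thesis
    by (simp add: reflection_def linear_diff[OF linear_matrix_mult_left] linear_diff[OF linear_matrix_mult_right]
        linear_scale[OF linear_matrix_mult_left] linear_scale[OF linear_matrix_mult_right] mult_outer outer_mult)
qed

lemma reflection_orthogonal:
  assumes "norm p = 1"
  shows "orthogonal_matrix (reflection p p)" "det (reflection p p) = - 1"
proof -
  have pp: "p \<bullet> p = 1" using assms by (simp add: norm_eq_1)
  have "transpose (reflection p p) = reflection p p"
    by (auto simp: vec_eq_iff transpose_def refl_component)
  then show "orthogonal_matrix (reflection p p)"
    using refl_mult_refl[OF pp] by (simp add: orthogonal_matrix_def)
  fix k :: 'a
  obtain A where A: "orthogonal_matrix A" "A *v axis k 1 = p"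
    using orthogonal_matrix_exists_basis[OF assms] by blast
  have "reflection p p = A ** reflection (axis k 1) (axis k 1) ** transpose A"
    using reflection_conj_orthogonal[OF A(1), of "axis k 1" "axis k 1"] A(2) by simp
  moreover have "det A * det (transpose A) = 1"
    using A(1) by (metis det_I det_mul orthogonal_matrix_def)
  moreover have "det (reflection (axis k 1) (axis k (1::real)) :: real^'a^'a) = - 1"
  proof -
    have "det (reflection (axis k 1) (axis k (1::real)) :: real^'a^'a)
        = (\<Prod>i\<in>UNIV. reflection (axis k 1) (axis k (1::real)) $ i $ i)"
      by (rule det_diagonal) (auto simp: refl_component axis_component)
    also have "\<dots> = (\<Prod>i\<in>UNIV. if i = k then - 1 else 1)"
      by (rule prod.cong) (auto simp: refl_component axis_component)
    finally show ?thesis by (simp add: prod.If_cases)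
  qed
  ultimately show "det (reflection p p) = - 1" by (simp add: det_mul mult.commute)
qed

text \<open>The reflection along x - y. Its last property lets a second such reflection leave in
  place a vector that has already been moved to its target.\<close>

lemma householder:
  fixes x y :: "real^'n"
  assumes "norm x = norm y"
  obtains H where "orthogonal_matrix H" "H *v x = y" "\<And>z. z \<bullet> x = z \<bullet> y \<Longrightarrow> H *v z = z"
proof (cases "x = y")
  case True
  then show ?thesis using that[of "mat 1"] by (simp add: orthogonal_matrix_def)
next
  case False
  define s where "s = norm (x - y)"
  define p where "p = (1 / s) *\<^sub>R (x - y)"
  have s: "s > 0" using False by (simp add: s_def)
  have np: "norm p = 1" using s by (simp add: p_def s_def)
  have xy: "x \<bullet> x = y \<bullet> y" using assms by (simp add: norm_eq)
  have H: "reflection p p *v z = z - (2 * (p \<bullet> z)) *\<^sub>R p" for z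
    by (simp add: reflection_def matrix_vector_mult_diff_rdistrib scaleR_matrix_vector_assoc[symmetric] outer_mult_vec)
  have "s\<^sup>2 = 2 * ((x - y) \<bullet> x)"
    using xy by (simp add: s_def power2_norm_eq_inner inner_diff_left inner_diff_right inner_commute)
  moreover have "p \<bullet> x = ((x - y) \<bullet> x) / s" by (simp only: p_def inner_scaleR_left) simp
  ultimately have "s * s = s * (2 * (p \<bullet> x))" using s by (simp add: power2_eq_square)
  then have "2 * (p \<bullet> x) = s" using s by simp
  then have "reflection p p *v x = y" using s by (simp add: H) (simp add: p_def)
  moreover have "reflection p p *v z = z" if "z \<bullet> x = z \<bullet> y" for z
  proof -
    have "(x - y) \<bullet> z = 0"
      using that inner_diff_left[of x y z] inner_commute[of x z] inner_commute[of y z] by linarith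
    then have "p \<bullet> z = 0" by (simp only: p_def inner_scaleR_left mult_zero_right)
    then show ?thesis by (simp add: H)
  qed
  ultimately show ?thesis using that reflection_orthogonal(1)[OF np] by blast
qed

text \<open>Two successive Householder maps give an orthogonal matrix. If its determinant is -1, it
  is composed with the reflection along a unit vector orthogonal to v' and l', which exists because
  n \<ge> 3.\<close>

lemma rotation_of_pairs:
  fixes v l v' l' :: "real^'n"
  assumes n: "CARD('n) \<ge> 3" and "norm v = norm v'" "norm l = norm l'" "l \<bullet> v = l' \<bullet> v'"
  obtains A where "A \<in> KK" "A *v v = v'" "A *v l = l'"
proof -
  obtain H1 where H1: "orthogonal_matrix H1" "H1 *v v = v'" using householder[OF assms(2)] by metis
  have inner: "(H1 *v x) \<bullet> (H1 *v y) = x \<bullet> y" "norm (H1 *v x) = norm x" for x y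
    using H1(1) by (metis orthogonal_transformation_def orthogonal_transformation_matrix orthogonal_transformation_norm
        matrix_of_matrix_vector_mul matrix_vector_mul_linear)+
  obtain H2 where H2: "orthogonal_matrix H2" "H2 *v (H1 *v l) = l'"
    "\<And>z. z \<bullet> (H1 *v l) = z \<bullet> l' \<Longrightarrow> H2 *v z = z"
    using householder[of "H1 *v l" l'] inner(2) assms(3) by metis
  have "v' \<bullet> (H1 *v l) = v' \<bullet> l'"
    using inner(1)[of l v] assms(4) by (simp add: H1(2) inner_commute)
  then have fix_v: "H2 *v v' = v'" by (rule H2(3))
  let ?A = "H2 ** H1"
  have A: "orthogonal_matrix ?A" "?A *v v = v'" "?A *v l = l'"
    using orthogonal_matrix_mul[OF H2(1) H1(1)] H1(2) H2(2) fix_v by (simp_all add: matrix_vector_mul_assoc[symmetric])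
  show ?thesis
  proof (cases "det ?A = 1")
    case True
    then show ?thesis using that[of ?A] A by (simp add: KK_def rotation_matrix_def)
  next
    case False
    then have dA: "det ?A = - 1" using det_orthogonal_matrix[OF A(1)] by blast
    have "dim {v', l'} \<le> card {v', l'}" by (rule dim_le_card') simp
    also have "\<dots> \<le> 2" by (simp add: card_insert_if)
    finally have "dim {v', l'} < DIM(real^'n)" using n by simp
    then obtain p where p: "p \<noteq> 0" "\<And>y. y \<in> span {v', l'} \<Longrightarrow> orthogonal p y"
      using orthogonal_to_subspace_exists by metis
    define p' where "p' = (1 / norm p) *\<^sub>R p"
    have p': "norm p' = 1" "p' \<bullet> v' = 0" "p' \<bullet> l' = 0"
      using p(1) p(2)[of v'] p(2)[of l'] by (auto simp: p'_def span_base orthogonal_def)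
    have fix0: "reflection p' p' *v z = z" if "p' \<bullet> z = 0" for z
      using that by (simp add: reflection_def matrix_vector_mult_diff_rdistrib scaleR_matrix_vector_assoc[symmetric] outer_mult_vec)
    show ?thesis
    proof (rule that[of "reflection p' p' ** ?A"])
      show "reflection p' p' ** ?A \<in> KK"
        using orthogonal_matrix_mul[OF reflection_orthogonal(1)[OF p'(1)] A(1)] reflection_orthogonal(2)[OF p'(1)] dA
        by (simp add: KK_def rotation_matrix_def det_mul[of "reflection p' p'"])
    qed (simp_all add: matrix_vector_mul_assoc[symmetric, of "reflection p' p'"] A fix0 p')
  qed
qed

lemma a_mat_eq_diag: "a_mat t = diag (\<chi> i. if i = first_ix then exp t else if i = last_ix then exp (- t) else 1)"
  by (simp add: a_mat_def diag_def vec_eq_iff)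

lemma a_mat_in_GG:
  assumes "CARD('n::{finite,linorder}) \<ge> 2"
  shows "(a_mat t :: 'n mat) \<in> GG"
proof -
  let ?f = "\<lambda>i::'n. if i = first_ix then exp t else if i = last_ix then exp (- t) else 1"
  have ne: "(first_ix :: 'n) \<noteq> last_ix" using first_less_last[OF assms] by simp
  have "(\<Prod>i\<in>UNIV. ?f i) = (\<Prod>i\<in>{first_ix, last_ix}. ?f i)"
    by (rule prod.mono_neutral_right) auto
  also have "\<dots> = 1" using ne by (simp add: exp_minus)
  finally show ?thesis by (simp add: GG_iff a_mat_eq_diag det_diag)
qed

lemma diag_mult_vec: "(diag x *v w) $ i = x $ i * w $ i" "(w v* diag x) $ i = w $ i * x $ i"
  by (simp_all add: matrix_vector_mult_def vector_matrix_mult_def diag_component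
      if_distrib[of "\<lambda>z. z * _"] if_distrib[of "\<lambda>z. _ * z"] cong: if_cong)

text \<open>Rotations act transitively on the pairs \<open>(v, l)\<close> with prescribed norms and inner product, so
  that \<open>norm v * norm l\<close> is the only invariant of such a pair under rotations and scaling.\<close>

lemma polar_decomposition:
  fixes v l :: "real^'n::{finite,linorder}"
  assumes n: "CARD('n) \<ge> 3" and lv: "l \<bullet> v = 1"
  obtains A t where "A \<in> KK" "reflection v l = conj_by (A ** a_mat t) Smat" "cosh (2 * t) = norm v * norm l"
proof -
  have n2: "CARD('n) \<ge> 2" using n by simp
  let ?r = "norm v * norm l"
  have r1: "?r \<ge> 1" using norm_cauchy_schwarz[of l v] lv by (simp add: mult.commute)
  then have nz: "norm v > 0" "norm l > 0" by (auto simp: zero_less_mult_iff dest: less_le_trans[OF zero_less_one])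
  \<comment> \<open>The pair (c v, l / c) represents the same reflection and has entries of equal
    norm.\<close>
  define c where "c = sqrt (norm l / norm v)"
  have c: "c > 0" using nz by (simp add: c_def)
  have c2: "c\<^sup>2 = norm l / norm v" using nz by (simp add: c_def)
  define t where "t = arcosh ?r / 2"
  have ct: "cosh (2 * t) = ?r" using r1 by (simp add: t_def cosh_arcosh_real)
  let ?f = "first_ix :: 'n" and ?l = "last_ix :: 'n"
  have ne: "?f \<noteq> ?l" using first_less_last[OF n2] by simp
  \<comment> \<open>The pair of the reflection a_t S a_t^-1, scaled so that both entries have
    squared norm cosh (2 t).\<close>
  define V where "V = (1 / sqrt 2) *\<^sub>R (axis ?f (exp t) + axis ?l (exp (- t)))"
  define L where "L = (1 / sqrt 2) *\<^sub>R (axis ?f (exp (- t)) + axis ?l (exp t))"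
  have aG: "(a_mat t :: 'n mat) \<in> GG" by (rule a_mat_in_GG[OF n2])
  have RS: "conj_by (a_mat t) Smat = reflection V L"
  proof -
    let ?w = "axis ?f 1 + axis ?l 1 :: (real, 'n) vec"
    have aw: "a_mat t *v ?w = sqrt 2 *\<^sub>R V"
    proof -
      have "(a_mat t *v ?w) $ i = (sqrt 2 *\<^sub>R V) $ i" for i
        using ne by (simp add: a_mat_eq_diag diag_mult_vec V_def axis_component)
      then show ?thesis by (simp add: vec_eq_iff)
    qed
    have "(sqrt 2 *\<^sub>R L) v* a_mat t = ?w"
    proof -
      have "((sqrt 2 *\<^sub>R L) v* a_mat t) $ i = ?w $ i" for i
        using ne by (simp add: a_mat_eq_diag diag_mult_vec L_def axis_component exp_minus)
      then show ?thesis by (simp add: vec_eq_iff)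
    qed
    then have wL: "?w v* matrix_inv (a_mat t) = sqrt 2 *\<^sub>R L"
      by (metis vec_mult_assoc GG_inverse(1)[OF aG] vec_mult_mat1)
    have "((1/2) *\<^sub>R ?w) v* matrix_inv (a_mat t) = (1/2) *\<^sub>R (?w v* matrix_inv (a_mat t))"
      by (simp add: vec_eq_iff vector_matrix_mult_def sum_distrib_left mult_ac)
    then have "conj_by (a_mat t) Smat = reflection (sqrt 2 *\<^sub>R V) ((1/2) *\<^sub>R sqrt 2 *\<^sub>R L)"
      unfolding Smat_eq_refl[OF n2] conj_by_refl[OF aG] aw wL by simp
    also have "\<dots> = reflection V L"
      by (simp add: refl_scale)
    finally show ?thesis .
  qed
  have VV: "V \<bullet> V = ?r" "L \<bullet> L = ?r" "L \<bullet> V = 1"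
  proof -
    define s where "s = 1 / sqrt (2::real)"
    have ss: "s * s = 1 / 2" by (simp add: s_def)
    have e: "exp t * exp t = exp (2 * t)" "exp (- t) * exp (- t) = exp (- (2 * t))" "exp t * exp (- t) = 1"
      by (simp_all add: mult_exp_exp)
    have V: "V = s *\<^sub>R (axis ?f (exp t) + axis ?l (exp (- t)))" and L: "L = s *\<^sub>R (axis ?f (exp (- t)) + axis ?l (exp t))"
      by (simp_all add: V_def L_def s_def)
    have "V \<bullet> V = s * s * (exp t * exp t + exp (- t) * exp (- t))"
      "L \<bullet> L = s * s * (exp (- t) * exp (- t) + exp t * exp t)"
      "L \<bullet> V = s * s * (exp t * exp (- t) + exp t * exp (- t))"
      unfolding V L using ne
      by (simp_all only: inner_add_left inner_add_right inner_axis_axis_real inner_scaleR_left inner_scaleR_right)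
        (simp_all add: algebra_simps)
    then show "V \<bullet> V = ?r" "L \<bullet> L = ?r" "L \<bullet> V = 1"
      unfolding ss e ct[symmetric] by (simp_all add: cosh_field_def)
  qed
  have "norm V = norm (c *\<^sub>R v)"
  proof -
    have "(norm (c *\<^sub>R v))\<^sup>2 = c\<^sup>2 * (norm v)\<^sup>2" by (simp add: power_mult_distrib)
    also have "\<dots> = norm l / norm v * (norm v)\<^sup>2" by (simp only: c2)
    also have "\<dots> = ?r" using nz by (simp add: power2_eq_square)
    finally have "(norm V)\<^sup>2 = (norm (c *\<^sub>R v))\<^sup>2" using VV by (simp add: power2_norm_eq_inner)
    then show ?thesis by (simp add: power2_eq_iff_nonneg)
  qed
  moreover have "norm L = norm ((1 / c) *\<^sub>R l)"
  proof -
    have "(norm ((1 / c) *\<^sub>R l))\<^sup>2 = (norm l)\<^sup>2 / c\<^sup>2" by (simp add: power_divide)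
    also have "\<dots> = (norm l)\<^sup>2 / (norm l / norm v)" by (simp only: c2)
    also have "\<dots> = ?r" using nz by (simp add: power2_eq_square)
    finally have "(norm L)\<^sup>2 = (norm ((1 / c) *\<^sub>R l))\<^sup>2" using VV by (simp add: power2_norm_eq_inner)
    then show ?thesis by (simp add: power2_eq_iff_nonneg)
  qed
  moreover have "L \<bullet> V = ((1 / c) *\<^sub>R l) \<bullet> (c *\<^sub>R v)" using c VV lv by simp
  ultimately obtain A where A: "A \<in> KK" "A *v V = c *\<^sub>R v" "A *v L = (1 / c) *\<^sub>R l"
    using rotation_of_pairs[OF n] by metis
  have AG: "A \<in> GG" by (rule KK_subset_GG[OF A(1)])
  have orth: "orthogonal_matrix A" using A(1) by (simp add: KK_def rotation_matrix_def)
  then have "matrix_inv A = transpose A" by (intro matrix_inv_unique) (simp add: orthogonal_matrix_def)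
  then have "conj_by A (reflection V L) = reflection (c *\<^sub>R v) ((1 / c) *\<^sub>R l)"
    using reflection_conj_orthogonal[OF orth, of V L] A(2,3) by (simp only: conj_by_def)
  then have "conj_by (A ** a_mat t) Smat = reflection (c *\<^sub>R v) ((1 / c) *\<^sub>R l)"
    by (simp only: conj_by_conj_by[OF AG aG, symmetric] RS)
  also have "\<dots> = reflection v l" using c by (simp add: refl_scale)
  finally show ?thesis using that[OF A(1) _ ct] by simp
qed

text \<open>Here n - 1 = 2 d, and r = cosh (2 t) satisfies r \<le> 2 cosh(t)^2 and r \<le> exp (2
  |t|), so that 1 + ln r \<le> 2 (1 + |t|). These two estimates produce the factors
  \<open>2 ^ d\<close> and \<open>2 ^ M\<close>.\<close>

lemma Schwartz_bound:
  fixes \<phi> :: "'n::{finite,linorder} mat \<Rightarrow> complex"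
  assumes n: "CARD('n) \<ge> 3" and d: "CARD('n) = 2 * d + 1" and \<phi>: "\<phi> \<in> Schwartz"
  obtains C where "\<And>v l. l \<bullet> v = 1 \<Longrightarrow>
     norm (Phi \<phi> (reflection v l)) * ((norm v * norm l) ^ d * (1 + ln (norm v * norm l)) ^ M) \<le> C"
proof -
  have n2: "CARD('n) \<ge> 2" using n by simp
  have inv: "\<And>g h. g \<in> GG \<Longrightarrow> h \<in> HH \<Longrightarrow> \<phi> (g ** h) = \<phi> g" using \<phi> by (auto simp: Schwartz_def)
  obtain C where C: "\<And>k t. k \<in> KK \<Longrightarrow> cosh t ^ (2 * d) * (1 + \<bar>t\<bar>) ^ M * norm (\<phi> (k ** a_mat t)) \<le> C"
    using \<phi> U_operators.one d unfolding Schwartz_def by fastforce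
  show ?thesis
  proof (rule that[of "2 ^ d * 2 ^ M * C"])
    fix v l :: "(real, 'n) vec" assume lv: "l \<bullet> v = 1"
    let ?r = "norm v * norm l"
    obtain A t where A: "A \<in> KK" "reflection v l = conj_by (A ** a_mat t) Smat" "cosh (2 * t) = ?r"
      using polar_decomposition[OF n lv] .
    have "A ** a_mat t \<in> GG" using KK_subset_GG[OF A(1)] a_mat_in_GG[OF n2] mult_in_GG by blast
    then have P: "Phi \<phi> (reflection v l) = \<phi> (A ** a_mat t)" using Phi_conj_by[OF n2 inv] A(2) by simp
    have r1: "?r \<ge> 1" using A(3) cosh_real_ge_1[of "2 * t"] by simp
    have "2 * (cosh t)\<^sup>2 = ?r + 1" using A(3) cosh_double_cosh[of t] by simp
    then have "?r \<le> 2 * (cosh t)\<^sup>2" by simp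
    then have "?r ^ d \<le> (2 * (cosh t)\<^sup>2) ^ d" using r1 by (intro power_mono) auto
    then have 1: "?r ^ d \<le> 2 ^ d * cosh t ^ (2 * d)" by (simp add: power_mult_distrib power_mult)
    have "?r \<le> exp (2 * \<bar>t\<bar>)"
    proof -
      have "cosh (2 * t) = cosh (2 * \<bar>t\<bar>)" by (cases "t \<ge> 0") simp_all
      also have "\<dots> \<le> exp (2 * \<bar>t\<bar>)" by (simp add: cosh_field_def)
      finally show ?thesis using A(3) by simp
    qed
    then have "ln ?r \<le> ln (exp (2 * \<bar>t\<bar>))" using r1 by (subst ln_le_cancel_iff) auto
    then have "ln ?r \<le> 2 * \<bar>t\<bar>" by simp
    then have "(1 + ln ?r) ^ M \<le> (2 * (1 + \<bar>t\<bar>)) ^ M" using r1 by (intro power_mono) auto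
    then have 2: "(1 + ln ?r) ^ M \<le> 2 ^ M * (1 + \<bar>t\<bar>) ^ M" by (simp only: power_mult_distrib)
    have "?r ^ d * (1 + ln ?r) ^ M \<le> (2 ^ d * cosh t ^ (2 * d)) * (2 ^ M * (1 + \<bar>t\<bar>) ^ M)"
      using r1 by (intro mult_mono 1 2) auto
    then have "norm (Phi \<phi> (reflection v l)) * (?r ^ d * (1 + ln ?r) ^ M)
        \<le> norm (\<phi> (A ** a_mat t)) * ((2 ^ d * cosh t ^ (2 * d)) * (2 ^ M * (1 + \<bar>t\<bar>) ^ M))"
      unfolding P by (intro mult_left_mono) auto
    also have "\<dots> = 2 ^ d * 2 ^ M * (cosh t ^ (2 * d) * (1 + \<bar>t\<bar>) ^ M * norm (\<phi> (A ** a_mat t)))" by simp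
    also have "\<dots> \<le> 2 ^ d * 2 ^ M * C" by (intro mult_left_mono C A(1)) auto
    finally show "norm (Phi \<phi> (reflection v l)) * (?r ^ d * (1 + ln ?r) ^ M) \<le> 2 ^ d * 2 ^ M * C" .
  qed
qed

text \<open>From 1 + ln a + ln b \<le> (1 + ln a) (1 + ln b). Submultiplicativity means that
  enlarging r by a bounded factor costs only a constant.\<close>

lemma power_log_submult:
  fixes a b :: real
  assumes "a \<ge> 1" "b \<ge> 1"
  shows "(a * b) ^ d * (1 + ln (a * b)) ^ M \<le> (a ^ d * (1 + ln a) ^ M) * (b ^ d * (1 + ln b) ^ M)"
proof -
  have "1 + ln (a * b) \<le> (1 + ln a) * (1 + ln b)"
    using assms by (simp add: ln_mult algebra_simps)
  then have "(1 + ln (a * b)) ^ M \<le> ((1 + ln a) * (1 + ln b)) ^ M"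
    using assms by (intro power_mono) (auto simp: ln_mult)
  then have "(a * b) ^ d * (1 + ln (a * b)) ^ M \<le> (a * b) ^ d * ((1 + ln a) * (1 + ln b)) ^ M"
    using assms by (intro mult_left_mono) auto
  then show ?thesis by (simp add: power_mult_distrib mult_ac)
qed

lemma power_log_mono:
  fixes a b :: real
  assumes "1 \<le> a" "a \<le> b"
  shows "a ^ d * (1 + ln a) ^ M \<le> b ^ d * (1 + ln b) ^ M"
  using assms by (intro mult_mono power_mono) auto

lemma vec_mult_norm_bound:
  fixes A :: "real^'n^'n"
  obtains K where "K \<ge> 1" "\<And>x. norm (A *v x) \<le> K * norm x" "\<And>x. norm (x v* A) \<le> K * norm x"
proof -
  have "bounded_linear ((*v) A)" by (rule matrix_vector_mul_bounded_linear)
  then obtain K1 where K1: "\<And>x. norm (A *v x) \<le> norm x * K1" using bounded_linear.bounded by blast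
  have "bounded_linear ((*v) (transpose A))" by (rule matrix_vector_mul_bounded_linear)
  then obtain K2 where K2: "\<And>x. norm (transpose A *v x) \<le> norm x * K2" using bounded_linear.bounded by blast
  let ?K = "max 1 (max K1 K2)"
  have "norm (A *v x) \<le> ?K * norm x" for x
  proof -
    have "norm x * K1 \<le> norm x * ?K" by (intro mult_left_mono) auto
    with K1[of x] show ?thesis by (metis mult.commute order.trans)
  qed
  moreover have "norm (x v* A) \<le> ?K * norm x" for x
  proof -
    have "norm x * K2 \<le> norm x * ?K" by (intro mult_left_mono) auto
    with K2[of x] show ?thesis by (simp add: mult.commute)
  qed
  ultimately show ?thesis using that[of ?K] by simp
qed

text \<open>Translation by \<open>g\<close> changes the product of norms by at most the factor
  \<open>K\<close>, which \<open>power_log_submult\<close> turns into a constant.\<close>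

lemma Schwartz_bound_conj:
  fixes \<phi> :: "'n::{finite,linorder} mat \<Rightarrow> complex"
  assumes n: "CARD('n) \<ge> 3" and d: "CARD('n) = 2 * d + 1" and \<phi>: "\<phi> \<in> Schwartz" and g: "g \<in> GG"
  obtains C where "C \<ge> 0" "\<And>v l. l \<bullet> v = 1 \<Longrightarrow>
     norm (Phi \<phi> (conj_by g (reflection v l))) * ((norm v * norm l) ^ d * (1 + ln (norm v * norm l)) ^ M) \<le> C"
proof -
  obtain C where C: "\<And>v l. l \<bullet> v = 1 \<Longrightarrow>
     norm (Phi \<phi> (reflection v l)) * ((norm v * norm l) ^ d * (1 + ln (norm v * norm l)) ^ M) \<le> C"
    using Schwartz_bound[OF n d \<phi>] by blast
  obtain K1 where K1: "K1 \<ge> 1" "\<And>x. norm (matrix_inv g *v x) \<le> K1 * norm x" using vec_mult_norm_bound by metis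
  obtain K2 where K2: "K2 \<ge> 1" "\<And>x. norm (x v* g) \<le> K2 * norm x" using vec_mult_norm_bound by metis
  define K where "K = K1 * K2"
  have K: "K \<ge> 1" using K1 K2 mult_mono[of 1 K1 1 K2] by (simp add: K_def)
  let ?c = "K ^ d * (1 + ln K) ^ M"
  have c0: "?c \<ge> 0" using K by simp
  have main: "norm (Phi \<phi> (conj_by g (reflection v l))) * ((norm v * norm l) ^ d * (1 + ln (norm v * norm l)) ^ M) \<le> ?c * C"
    if lv: "l \<bullet> v = 1" for v l
  proof -
    let ?v = "g *v v" and ?l = "l v* matrix_inv g"
    have lv': "?l \<bullet> ?v = 1" using lv by (simp add: inner_dual_pairing[OF g])
    have r1: "norm v * norm l \<ge> 1" "norm ?v * norm ?l \<ge> 1"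
      using norm_cauchy_schwarz[of l v] norm_cauchy_schwarz[of ?l ?v] lv lv' by (simp_all add: mult.commute)
    have "norm v \<le> K1 * norm ?v" using K1(2)[of ?v] by (simp add: GG_cancel[OF g])
    moreover have "norm l \<le> K2 * norm ?l" using K2(2)[of ?l] GG_inverse(2)[OF g] by (simp add: vec_mult_assoc)
    ultimately have "norm v * norm l \<le> (K1 * norm ?v) * (K2 * norm ?l)"
      using K1(1) by (intro mult_mono) auto
    then have "norm v * norm l \<le> K * (norm ?v * norm ?l)" by (simp add: K_def mult_ac)
    then have "(norm v * norm l) ^ d * (1 + ln (norm v * norm l)) ^ M
        \<le> (K * (norm ?v * norm ?l)) ^ d * (1 + ln (K * (norm ?v * norm ?l))) ^ M"
      by (intro power_log_mono r1)
    also have "\<dots> \<le> ?c * ((norm ?v * norm ?l) ^ d * (1 + ln (norm ?v * norm ?l)) ^ M)"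
      by (rule power_log_submult[OF K r1(2)])
    finally have "norm (Phi \<phi> (reflection ?v ?l)) * ((norm v * norm l) ^ d * (1 + ln (norm v * norm l)) ^ M)
       \<le> norm (Phi \<phi> (reflection ?v ?l)) * (?c * ((norm ?v * norm ?l) ^ d * (1 + ln (norm ?v * norm ?l)) ^ M))"
      by (intro mult_left_mono) auto
    also have "\<dots> = ?c * (norm (Phi \<phi> (reflection ?v ?l)) * ((norm ?v * norm ?l) ^ d * (1 + ln (norm ?v * norm ?l)) ^ M))"
      by simp
    also have "\<dots> \<le> ?c * C" by (intro mult_left_mono C lv' c0)
    finally show ?thesis by (simp add: conj_by_refl[OF g])
  qed
  show ?thesis
  proof (rule that[of "max 0 (?c * C)"])
    show "norm (Phi \<phi> (conj_by g (reflection v l))) * ((norm v * norm l) ^ d * (1 + ln (norm v * norm l)) ^ M)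
       \<le> max 0 (?c * C)" if "l \<bullet> v = 1" for v l using main[OF that] by linarith
  qed simp
qed

text \<open>Its reciprocal is integrable over the line by virtue of the squared logarithm; one power
  of |s| for each coordinate is what the decay provides. Truncation at 1 keeps the weight at least
  1.\<close>

definition log_weight :: "real \<Rightarrow> real" where
  "log_weight s = max 1 \<bar>s\<bar> * (1 + ln (max 1 \<bar>s\<bar>)) ^ 2"

lemma log_weight_ge_1: "log_weight s \<ge> 1"
proof -
  have "1 * 1 \<le> max 1 \<bar>s\<bar> * (1 + ln (max 1 \<bar>s\<bar>)) ^ 2"
    by (intro mult_mono one_le_power) auto
  then show ?thesis by (simp add: log_weight_def)
qed

text \<open>On \<open>{1..}\<close> the reciprocal has the antiderivative - 1 / (1 + ln s). The
  negative half line follows by reflection, and \<open>{-1..1}\<close> contributes at most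
  2.\<close>

lemma nn_integral_log_weight_finite: "(\<integral>\<^sup>+s. ennreal (1 / log_weight s) \<partial>lborel) < \<infinity>"
proof -
  let ?f = "\<lambda>s::real. 1 / (s * (1 + ln s)\<^sup>2)"
  have "(\<integral>\<^sup>+s. ennreal (?f s) * indicator {1..} s \<partial>lborel) = ennreal (0 - (- 1 / (1 + ln 1)))"
  proof (rule nn_integral_FTC_atLeast[where F = "\<lambda>s. - 1 / (1 + ln s)"])
    show "?f \<in> borel_measurable borel" by measurable
    show "DERIV (\<lambda>s. - 1 / (1 + ln s)) s :> ?f s" if "1 \<le> s" for s
    proof -
      have "1 + ln s > 0" using that by (simp add: add_pos_nonneg)
      then show ?thesis using that
        by (auto intro!: derivative_eq_intros simp: power2_eq_square field_simps)
    qed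
    show "0 \<le> ?f s" if "1 \<le> s" for s using that by simp
    show "((\<lambda>s::real. - 1 / (1 + ln s)) \<longlongrightarrow> 0) at_top"
      by (intro tendsto_divide_0[OF tendsto_const] filterlim_at_top_imp_at_infinity
          filterlim_tendsto_add_at_top[OF tendsto_const ln_at_top])
  qed
  then have I: "(\<integral>\<^sup>+s. ennreal (?f s) * indicator {1..} s \<partial>lborel) < \<infinity>" by simp
  have I': "(\<integral>\<^sup>+s. ennreal (?f (- s)) * indicator {1..} (- s) \<partial>lborel) < \<infinity>"
  proof -
    have "(\<integral>\<^sup>+s. ennreal (?f s) * indicator {1..} s \<partial>lborel)
        = (\<integral>\<^sup>+s. ennreal (?f s) * indicator {1..} s \<partial>distr lborel borel uminus)" by (simp add: lborel_distr_uminus)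
    also have "\<dots> = (\<integral>\<^sup>+s. ennreal (?f (- s)) * indicator {1..} (- s) \<partial>lborel)"
      by (subst nn_integral_distr) auto
    finally show ?thesis using I by simp
  qed
  have "(\<integral>\<^sup>+s. ennreal (1 / log_weight s) \<partial>lborel) \<le> (\<integral>\<^sup>+s. indicator {-1..1} s +
      (ennreal (?f s) * indicator {1..} s + ennreal (?f (- s)) * indicator {1..} (- s)) \<partial>lborel)"
  proof (rule nn_integral_mono)
    fix s :: real
    consider "\<bar>s\<bar> \<le> 1" | "s > 1" | "s < -1" by linarith
    then show "ennreal (1 / log_weight s) \<le> indicator {-1..1} s +
      (ennreal (?f s) * indicator {1..} s + ennreal (?f (- s)) * indicator {1..} (- s))"
    proof cases
      case 1
      then have "indicator {-1..1} s = (1::ennreal)" by (auto simp: indicator_def abs_le_iff)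
      moreover have "ennreal (1 / log_weight s) \<le> 1" using log_weight_ge_1[of s] by (simp add: ennreal_le_1)
      ultimately show ?thesis by (simp add: add_increasing2)
    next
      case 2
      then show ?thesis by (simp add: log_weight_def max_def)
    next
      case 3
      then show ?thesis by (simp add: log_weight_def max_def)
    qed
  qed
  also have "\<dots> = 2 + ((\<integral>\<^sup>+s. ennreal (?f s) * indicator {1..} s \<partial>lborel)
      + (\<integral>\<^sup>+s. ennreal (?f (- s)) * indicator {1..} (- s) \<partial>lborel))"
    by (subst nn_integral_add; (subst nn_integral_add)?; simp)
  also have "\<dots> < \<infinity>" using I I' by (simp add: ennreal_add_less_top)
  finally show ?thesis .
qed

definition weight :: "'n::finite \<Rightarrow> (real, 'n) vec \<Rightarrow> real" where
  "weight k z = (\<Prod>j\<in>-{k}. 1 / log_weight (z $ j))"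

lemma measurable_log_weight [measurable]: "log_weight \<in> borel_measurable borel"
  unfolding log_weight_def[abs_def] by measurable

lemma weight_nonneg: "weight k z \<ge> 0"
  unfolding weight_def using log_weight_ge_1 by (intro prod_nonneg) (auto intro!: divide_nonneg_nonneg order.trans[OF zero_le_one])

lemma measurable_weight [measurable]: "weight k \<in> borel_measurable borel"
  unfolding weight_def[abs_def] by measurable

lemma integrable_weight:
  fixes k :: "'a::finite"
  shows "integrable (slab_measure k) (weight k)"
proof (rule integrableI_nonneg)
  show "weight k \<in> borel_measurable (slab_measure k)" by measurable
  have qf0: "1 / log_weight x \<ge> 0" for x using log_weight_ge_1[of x] by simp
  have inj: "inj (\<lambda>j::'a. axis j (1::real))" by (auto simp: inj_def axis_eq_axis)
  have B: "(Basis :: (real^'a) set) = (\<lambda>j. axis j 1) ` UNIV" by (auto simp: Basis_vec_def)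
  have "(\<integral>\<^sup>+z. ennreal (weight k z) \<partial>slab_measure k)
      = (\<integral>\<^sup>+z. indicator (slab k) z * ennreal (weight k z) \<partial>lborel)"
    by (rule nn_integral_slab_measure) measurable
  also have "\<dots> \<le> (\<integral>\<^sup>+z. (\<Prod>b\<in>Basis. ennreal (1 / log_weight ((z :: real^'a) \<bullet> b))) \<partial>lborel)"
  proof (rule nn_integral_mono)
    fix z :: "real^'a"
    have "(\<Prod>b\<in>Basis. ennreal (1 / log_weight (z \<bullet> b))) = (\<Prod>j\<in>UNIV. ennreal (1 / log_weight (z $ j)))"
      unfolding B by (subst prod.reindex[OF inj]) (simp add: inner_axis)
    also have "\<dots> = ennreal (\<Prod>j\<in>UNIV. 1 / log_weight (z $ j))" by (rule prod_ennreal) (rule qf0)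
    also have "(\<Prod>j\<in>UNIV. 1 / log_weight (z $ j)) = 1 / log_weight (z $ k) * weight k z"
      unfolding weight_def by (subst prod.remove[of UNIV k]) (auto simp: Compl_eq_Diff_UNIV)
    finally have eq: "(\<Prod>b\<in>Basis. ennreal (1 / log_weight (z \<bullet> b))) = ennreal (1 / log_weight (z $ k) * weight k z)" .
    show "indicator (slab k) z * ennreal (weight k z) \<le> (\<Prod>b\<in>Basis. ennreal (1 / log_weight (z \<bullet> b)))"
    proof (cases "z \<in> slab k")
      case True
      \<comment> \<open>On the slab the missing factor at k is 1, so the product may be extended
        over all coordinates and integrated factor by factor.\<close>
      then have "max 1 \<bar>z $ k\<bar> = 1" by (auto simp: slab_def max_def)
      then have "log_weight (z $ k) = 1" by (simp add: log_weight_def)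
      with True show ?thesis unfolding eq by simp
    qed simp
  qed
  also have "\<dots> = (\<Prod>b\<in>(Basis :: (real^'a) set). (\<integral>\<^sup>+s. ennreal (1 / log_weight s) \<partial>lborel))"
    by (rule nn_integral_lborel_prod) auto
  also have "\<dots> < \<infinity>"
    using nn_integral_log_weight_finite by (simp add: power_less_top_ennreal)
  finally show "(\<integral>\<^sup>+z. ennreal (weight k z) \<partial>slab_measure k) < \<infinity>" .
qed (simp add: weight_nonneg)

lemma AE_slab_nonzero:
  fixes k l :: "'a::finite"
  shows "AE s in slab_measure k. s $ l \<noteq> 0"
proof -
  have "negligible {x::real^'a. x \<bullet> axis l 1 = 0}"
    by (rule negligible_standard_hyperplane) (auto simp: Basis_vec_def)
  then have "{x::real^'a. x $ l = 0} \<in> null_sets lebesgue" by (simp add: negligible_iff_null_sets inner_axis)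
  moreover have "{x::real^'a. x $ l = 0} \<in> sets borel"
    by (intro borel_closed closed_Collect_eq continuous_intros)
  ultimately have "{x::real^'a. x $ l = 0} \<in> null_sets lborel" by (simp add: null_sets_completion_iff)
  then have "AE s in (lborel :: (real^'a) measure). s $ l \<noteq> 0" using AE_not_in by fastforce
  then show ?thesis unfolding slab_measure_def by (subst AE_density) (auto elim: eventually_mono)
qed

lemma prod_log_weight_le:
  assumes a: "a \<ge> 1" and s: "\<And>j. j \<in> J \<Longrightarrow> \<bar>s j\<bar> \<le> a" and J: "card J = d"
  shows "(\<Prod>j\<in>J. log_weight (s j)) \<le> a ^ d * (1 + ln a) ^ (2 * d)"
proof -
  have "log_weight (s j) \<le> a * (1 + ln a) ^ 2" if "j \<in> J" for j
    unfolding log_weight_def using s[OF that] a by (intro mult_mono power_mono) auto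
  then have "(\<Prod>j\<in>J. log_weight (s j)) \<le> (\<Prod>j\<in>J. a * (1 + ln a) ^ 2)"
    by (intro prod_mono) (auto intro: order.trans[OF zero_le_one log_weight_ge_1])
  also have "\<dots> = a ^ d * (1 + ln a) ^ (2 * d)" by (simp add: J power_mult_distrib power_mult)
  finally show ?thesis .
qed

section \<open>The limit to rank zero\<close>

text \<open>Each coordinate below \<open>k\<close> is controlled by \<open>a\<close> and each one above by \<open>b\<close>; as there are equally
  many of both kinds, the decay in \<open>a b\<close> distributes over all coordinates.\<close>

lemma weight_bound:
  fixes k :: "'n::{finite,linorder}"
  assumes d: "card {j. j < k} = d" "card {j. k < j} = d"
    and ab: "a \<ge> 1" "b \<ge> 1" "a * b = 2 * r" and r: "r \<ge> 1"
    and s: "\<And>j. j < k \<Longrightarrow> \<bar>s $ j\<bar> \<le> a" "\<And>j. k < j \<Longrightarrow> \<bar>s $ j\<bar> \<le> b"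
    and x: "x * (r ^ d * (1 + ln r) ^ (4 * d)) \<le> C" "x \<ge> 0"
  shows "x \<le> (2 ^ d * (1 + ln 2) ^ (4 * d)) * C * weight k s"
proof -
  \<comment> \<open>The price, by \<open>power_log_submult\<close>, of having a b equal to 2 r
    instead of r.\<close>
  let ?c = "2 ^ d * (1 + ln 2) ^ (4 * d) :: real"
  let ?Q = "\<Prod>j\<in>-{k}. log_weight (s $ j)"
  have Q: "?Q > 0" by (intro prod_pos) (auto intro: less_le_trans[OF zero_less_one log_weight_ge_1])
  have U: "-{k} = {j. j < k} \<union> {j. k < j}" by auto
  have "?Q = (\<Prod>j\<in>{j. j < k}. log_weight (s $ j)) * (\<Prod>j\<in>{j. k < j}. log_weight (s $ j))"
    unfolding U by (rule prod.union_disjoint) auto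
  also have "\<dots> \<le> (a ^ d * (1 + ln a) ^ (2 * d)) * (b ^ d * (1 + ln b) ^ (2 * d))"
  proof (rule mult_mono)
    show "(\<Prod>j\<in>{j. j < k}. log_weight (s $ j)) \<le> a ^ d * (1 + ln a) ^ (2 * d)"
      by (rule prod_log_weight_le[OF ab(1) _ d(1)]) (use s(1) in auto)
    show "(\<Prod>j\<in>{j. k < j}. log_weight (s $ j)) \<le> b ^ d * (1 + ln b) ^ (2 * d)"
      by (rule prod_log_weight_le[OF ab(2) _ d(2)]) (use s(2) in auto)
    show "0 \<le> a ^ d * (1 + ln a) ^ (2 * d)" using ab(1) by simp
    show "0 \<le> (\<Prod>j\<in>{j. k < j}. log_weight (s $ j))"
      by (intro prod_nonneg) (auto intro: order.trans[OF zero_le_one log_weight_ge_1])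
  qed
  \<comment> \<open>Both logarithms are enlarged to that of a b, so that the exponents 2 d and 2 d
    add up to the 4 d of the hypothesis on x.\<close>
  also have "\<dots> \<le> (a ^ d * (1 + ln (a * b)) ^ (2 * d)) * (b ^ d * (1 + ln (a * b)) ^ (2 * d))"
  proof -
    have "ln (a * b) = ln a + ln b" using ab(1,2) by (simp add: ln_mult)
    moreover have "ln a \<ge> 0" "ln b \<ge> 0" using ab(1,2) by simp_all
    ultimately have "(1 + ln a) ^ (2 * d) \<le> (1 + ln (a * b)) ^ (2 * d)"
      "(1 + ln b) ^ (2 * d) \<le> (1 + ln (a * b)) ^ (2 * d)" "(1 + ln (a * b)) ^ (2 * d) \<ge> 0"
      by (auto intro!: power_mono)
    then show ?thesis using ab(1,2) \<open>ln b \<ge> 0\<close> by (intro mult_mono mult_nonneg_nonneg) auto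
  qed
  also have "\<dots> = (a * b) ^ d * (1 + ln (a * b)) ^ (4 * d)"
    by (simp add: power_mult_distrib power_add[symmetric] mult_ac)
  also have "\<dots> = (2 * r) ^ d * (1 + ln (2 * r)) ^ (4 * d)" by (simp only: ab(3))
  also have "\<dots> \<le> ?c * (r ^ d * (1 + ln r) ^ (4 * d))" by (rule power_log_submult) (use r in auto)
  finally have "x * ?Q \<le> x * (?c * (r ^ d * (1 + ln r) ^ (4 * d)))" by (intro mult_left_mono x(2))
  also have "\<dots> = ?c * (x * (r ^ d * (1 + ln r) ^ (4 * d)))" by simp
  also have "\<dots> \<le> ?c * C" by (intro mult_left_mono x(1)) auto
  finally have "x * ?Q \<le> ?c * C" .
  then have "x \<le> ?c * C / ?Q" using Q by (simp add: pos_le_divide_eq)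
  also have "\<dots> = ?c * C * weight k s" by (simp add: weight_def prod_dividef)
  finally show ?thesis .
qed

lemma orbit_form_inner_orbit_vec: "l < k \<Longrightarrow> orbit_form l l k e 0 z \<bullet> orbit_vec k z = 1"
  by (auto simp: orbit_form_def orbit_vec_def inner_add_left inner_add_right inner_axis_axis_real inner_axis_left inner_axis_right
      upper_part_inner_lower_part lower_part_component upper_part_component axis_component)

text \<open>For l < k this transvection is lower triangular. So a base point q of rank zero type
  yields base points \<open>q ** trv k l e\<close> of rank one type, for varying parabolic
  subgroups, which tend to q as e tends to 0.\<close>

lemma conj_by_trv_flag_refl_0: "l \<noteq> k \<Longrightarrow> conj_by (trv k l e) (flag_refl l k e) = flag_refl l k 0"
proof -
  assume "l \<noteq> k"
  then have "trv k l e *v axis k 1 = axis k 1" "(axis k 1 + axis l e) v* matrix_inv (trv k l e) = axis k 1 + axis l 0"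
    by (auto simp: trv_mult_vec matrix_inv_trv vec_mult_trv vec_eq_iff axis_component)
  then show ?thesis using \<open>l \<noteq> k\<close> by (simp add: flag_refl_def conj_by_refl[OF trv_in_GG])
qed

text \<open>The limit \<open>e \<rightarrow> 0\<close>. Where \<open>\<bar>1 - e z\<^sub>l\<bar> \<ge> 1/2\<close> the integrands are dominated. On the remaining
  slab around \<open>z\<^sub>l = 1/e\<close> a volume preserving change of variables restores the
  domination, and there the integrands tend to zero.\<close>

lemma slab_integral_limit:
  fixes \<phi> :: "'n::{finite,linorder} mat \<Rightarrow> complex"
  assumes n: "CARD('n) \<ge> 3" and \<phi>: "\<phi> \<in> Schwartz"
    and d: "card {j. j < k} = d" "card {j. k < j} = d" and adj: "adjacent l k"
    and q: "q \<in> GG" and R: "conj_by q (flag_refl l k 0) = Smat" and g: "g \<in> GG"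
    and zero: "\<And>e. e \<noteq> 0 \<Longrightarrow>
      (\<integral>w. Phi \<phi> (conj_by g (reflection (orbit_vec k w) (orbit_form l l k e 0 w))) \<partial>slab_measure k) = 0"
  shows "(\<integral>w. Phi \<phi> (conj_by g (reflection (orbit_vec k w) (orbit_form l l k 0 0 w))) \<partial>slab_measure k) = 0"
proof -
  have n2: "CARD('n) \<ge> 2" using n by simp
  have lk': "l < k" "l \<noteq> k" using adj by auto
  have "card (UNIV :: 'n set) = card (insert k ({j. j < k} \<union> {j. k < j}))"
    by (rule arg_cong[where f = card]) auto
  also have "\<dots> = Suc (card ({j. j < k} \<union> {j. k < j}))" by (rule card_insert_disjoint) auto
  also have "card ({j. j < k} \<union> {j. k < j}) = d + d" unfolding d[symmetric]
    by (subst card_Un_disjoint) (auto simp: d)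
  also have "Suc (d + d) = 2 * d + 1" by simp
  finally have N: "CARD('n) = 2 * d + 1" .
  have d1: "d \<ge> 1" using N n by simp
  have inv: "\<And>g h. g \<in> GG \<Longrightarrow> h \<in> HH \<Longrightarrow> \<phi> (g ** h) = \<phi> g" using \<phi> by (auto simp: Schwartz_def)
  have cont: "continuous_on GG \<phi>" using \<phi> by (intro smooth_on_G_imp_continuous) (auto simp: Schwartz_def)
  obtain C where C: "C \<ge> 0" "\<And>v l. l \<bullet> v = 1 \<Longrightarrow>
     norm (Phi \<phi> (conj_by g (reflection v l))) * ((norm v * norm l) ^ d * (1 + ln (norm v * norm l)) ^ (4 * d)) \<le> C"
    using Schwartz_bound_conj[OF n N \<phi> g] by blast
  define C' where "C' = (2 ^ d * (1 + ln 2) ^ (4 * d)) * C"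
  define F where "F e z = Phi \<phi> (conj_by g (reflection (orbit_vec k z) (orbit_form l l k e 0 z)))" for e z
  define rr where "rr e z = norm (orbit_vec k z) * norm (orbit_form l l k e 0 z)" for e z
  have rr1: "rr e z \<ge> 1" for e z
    using norm_cauchy_schwarz[of "orbit_form l l k e 0 z" "orbit_vec k z"] orbit_form_inner_orbit_vec[OF lk'(1), of e z] by (simp add: rr_def mult.commute)
  have FC: "norm (F e z) * (rr e z ^ d * (1 + ln (rr e z)) ^ (4 * d)) \<le> C" for e z
    unfolding F_def rr_def by (rule C(2)) (rule orbit_form_inner_orbit_vec[OF lk'(1)])
  have dom: "norm (F e z) \<le> C' * weight k s"
    if "a \<ge> 1" "b \<ge> 1" "a * b = 2 * rr e z" "\<And>j. j < k \<Longrightarrow> \<bar>s $ j\<bar> \<le> a" "\<And>j. k < j \<Longrightarrow> \<bar>s $ j\<bar> \<le> b" for a b e z s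
    unfolding C'_def by (rule weight_bound[OF d that(1-3) rr1 that(4,5) FC]) auto
  have orbit_vec_le: "\<bar>z $ j\<bar> \<le> norm (orbit_vec k z)" if "j < k" for j z
    using component_le_norm_cart[of "orbit_vec k z" j] that by (simp add: orbit_vec_def axis_component lower_part_component split: if_splits)
  have orbit_vec_1: "1 \<le> norm (orbit_vec k z)" for z
    using component_le_norm_cart[of "orbit_vec k z" k] by (simp add: orbit_vec_def axis_component lower_part_component)
  have orbit_form_le: "\<bar>z $ j\<bar> \<le> norm (orbit_form l l k e 0 z)" if "k < j" for j e z
  proof -
    have "orbit_form l l k e 0 z $ j = z $ j" using that lk' by (auto simp: orbit_form_def axis_component upper_part_component)
    then show ?thesis using component_le_norm_cart[of "orbit_form l l k e 0 z" j] by simp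
  qed
  have orbit_form_k: "\<bar>1 - e * z $ l\<bar> \<le> norm (orbit_form l l k e 0 z)" for e z
  proof -
    have "orbit_form l l k e 0 z $ k = 1 - e * z $ l" using lk' by (auto simp: orbit_form_def axis_component upper_part_component)
    then show ?thesis using component_le_norm_cart[of "orbit_form l l k e 0 z" k] by simp
  qed
  have orbit_form_l: "\<bar>e\<bar> \<le> norm (orbit_form l l k e 0 z)" for e z
  proof -
    have "orbit_form l l k e 0 z $ l = e" using lk' by (auto simp: orbit_form_def axis_component upper_part_component)
    then show ?thesis using component_le_norm_cart[of "orbit_form l l k e 0 z" l] by simp
  qed
  \<comment> \<open>The factor 2 in the bound for the upper coordinates ensures b \<ge> 1, since the
    entry of the form at k has absolute value at least 1/2 here.\<close>
  have dom1: "norm (F e z) \<le> C' * weight k z" if "\<bar>1 - e * z $ l\<bar> \<ge> 1/2" for e z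
  proof (rule dom[of "norm (orbit_vec k z)" "2 * norm (orbit_form l l k e 0 z)"])
    show "\<bar>z $ j\<bar> \<le> 2 * norm (orbit_form l l k e 0 z)" if "k < j" for j using orbit_form_le[OF that, of z e] norm_ge_zero by linarith
    show "1 \<le> 2 * norm (orbit_form l l k e 0 z)" using orbit_form_k[of e z] that by linarith
  qed (simp_all add: orbit_vec_1 orbit_vec_le rr_def)
  define \<epsilon> where "\<epsilon> i = inverse (real (Suc i))" for i
  have e0: "\<epsilon> i > 0" for i by (simp add: \<epsilon>_def)
  have elim: "\<epsilon> \<longlonglongrightarrow> 0" unfolding \<epsilon>_def by (rule LIMSEQ_inverse_real_of_nat)
  \<comment> \<open>The substitution \<open>A i\<close> is z_l = (1 - s_l) / \<epsilon>, z_j = s_j /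
    \<epsilon> for the other j < k, and z_j = \<epsilon> s_j for j > k. It turns 1 - \<epsilon> z_l
    into s_l, and its Jacobian has absolute value 1 because there are d coordinates on each side of
    k.\<close>
  define tt where "tt i = (\<chi> j. if j = l then 1 / \<epsilon> i else (0 :: real))" for i
  define cc where "cc i = (\<chi> j. if j = l then - 1 / \<epsilon> i else if j < k then 1 / \<epsilon> i else if j = k then 1 else \<epsilon> i)" for i
  define A where "A i s = (\<chi> j. tt i $ j + cc i $ j * s $ j)" for i and s :: "(real, 'n) vec"
  have A_l: "A i s $ l = (1 - s $ l) / \<epsilon> i" for i s by (simp add: A_def tt_def cc_def diff_divide_distrib)
  have A_lower_part: "A i s $ j = s $ j / \<epsilon> i" if "j < k" "j \<noteq> l" for i s j using that by (simp add: A_def tt_def cc_def)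
  have A_k: "A i s $ k = s $ k" for i s using lk' by (simp add: A_def tt_def cc_def)
  have A_upper_part: "A i s $ j = \<epsilon> i * s $ j" if "k < j" for i s j
  proof -
    have "j \<noteq> l" "\<not> j < k" "j \<noteq> k" using that lk'(1) by auto
    then show ?thesis by (simp add: A_def tt_def cc_def)
  qed
  have A_meas [measurable]: "A i \<in> borel_measurable borel" for i
    unfolding A_def[abs_def] by (intro measurable_vec_lambda) measurable
  have A_slab: "distr (slab_measure k) borel (A i) = slab_measure k" for i
  proof (rule distr_slab_measure[OF A_meas])
    have "(\<Prod>j\<in>UNIV. \<bar>cc i $ j\<bar>) = (\<Prod>j\<in>insert k ({j. j < k} \<union> {j. k < j}). \<bar>cc i $ j\<bar>)"
      by (rule prod.cong) auto
    also have "\<dots> = \<bar>cc i $ k\<bar> * ((\<Prod>j\<in>{j. j < k}. \<bar>cc i $ j\<bar>) * (\<Prod>j\<in>{j. k < j}. \<bar>cc i $ j\<bar>))"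
    proof -
      have "(\<Prod>j\<in>{j. j < k} \<union> {j. k < j}. \<bar>cc i $ j\<bar>)
          = (\<Prod>j\<in>{j. j < k}. \<bar>cc i $ j\<bar>) * (\<Prod>j\<in>{j. k < j}. \<bar>cc i $ j\<bar>)"
        by (rule prod.union_disjoint) auto
      then show ?thesis by (subst prod.insert) auto
    qed
    also have "(\<Prod>j\<in>{j. j < k}. \<bar>cc i $ j\<bar>) = (1 / \<epsilon> i) ^ d"
      using e0[of i] d(1) by (simp add: cc_def if_distrib[of abs] cong: if_cong)
    also have "(\<Prod>j\<in>{j. k < j}. \<bar>cc i $ j\<bar>) = (\<Prod>j\<in>{j. k < j}. \<epsilon> i)"
      using e0[of i] lk'(1) by (intro prod.cong) (auto simp: cc_def)
    also have "\<dots> = \<epsilon> i ^ d" using d(2) by simp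
    also have "\<bar>cc i $ k\<bar> * ((1 / \<epsilon> i) ^ d * \<epsilon> i ^ d) = 1"
      using e0[of i] lk' by (simp add: cc_def power_mult_distrib[symmetric])
    finally have p: "(\<Prod>j\<in>UNIV. \<bar>cc i $ j\<bar>) = 1" .
    have "cc i $ j \<noteq> 0" for j using e0[of i] by (simp add: cc_def)
    from lborel_diag_affine[OF this p] show "distr lborel borel (A i) = lborel" unfolding A_def[abs_def] .
  qed (rule A_k)
  \<comment> \<open>After the substitution the norms of vector and form, scaled by 2 \<epsilon> and
    1 / \<epsilon>, take the roles of a and b. Their product is still 2 r. The first is at least 1
    through the large entry z_l, the second through the entry \<epsilon> of the form at l.\<close>
  have a_b: "1 \<le> 2 * \<epsilon> i * norm (orbit_vec k (A i s))" "1 \<le> norm (orbit_form l l k (\<epsilon> i) 0 (A i s)) / \<epsilon> i"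
    "\<bar>s $ l\<bar> / \<epsilon> i \<le> norm (orbit_form l l k (\<epsilon> i) 0 (A i s)) / \<epsilon> i" if s: "\<bar>s $ l\<bar> < 1/2" for i s
  proof -
    have "(1 - s $ l) / \<epsilon> i \<le> \<bar>A i s $ l\<bar>" unfolding A_l by (rule abs_ge_self)
    then have "(1 - s $ l) / \<epsilon> i \<le> norm (orbit_vec k (A i s))" using orbit_vec_le[OF lk'(1), of "A i s"] by linarith
    then have "1 - s $ l \<le> \<epsilon> i * norm (orbit_vec k (A i s))" using e0[of i] by (simp add: field_simps)
    then show "1 \<le> 2 * \<epsilon> i * norm (orbit_vec k (A i s))" using s by linarith
    show "1 \<le> norm (orbit_form l l k (\<epsilon> i) 0 (A i s)) / \<epsilon> i" using orbit_form_l[of "\<epsilon> i" "A i s"] e0[of i] by simp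
    show "\<bar>s $ l\<bar> / \<epsilon> i \<le> norm (orbit_form l l k (\<epsilon> i) 0 (A i s)) / \<epsilon> i"
      using orbit_form_k[of "\<epsilon> i" "A i s"] e0[of i] by (simp add: A_l divide_right_mono)
  qed
  have ab_rr: "(2 * \<epsilon> i * norm (orbit_vec k (A i s))) * (norm (orbit_form l l k (\<epsilon> i) 0 (A i s)) / \<epsilon> i) = 2 * rr (\<epsilon> i) (A i s)" for i s
    using e0[of i] by (simp add: rr_def)
  have dom2: "norm (F (\<epsilon> i) (A i s)) \<le> C' * weight k s" if s: "\<bar>s $ l\<bar> < 1/2" for i s
  proof (rule dom[OF a_b(1,2)[OF s] ab_rr])
    fix j assume j: "j < k"
    show "\<bar>s $ j\<bar> \<le> 2 * \<epsilon> i * norm (orbit_vec k (A i s))"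
    proof (cases "j = l")
      case True
      show ?thesis unfolding True using a_b(1)[OF s, of i] s by linarith
    next
      case False
      have "\<bar>s $ j\<bar> / \<epsilon> i \<le> norm (orbit_vec k (A i s))" using orbit_vec_le[OF j, of "A i s"] e0[of i] by (simp add: A_lower_part[OF j False])
      then have "\<bar>s $ j\<bar> \<le> \<epsilon> i * norm (orbit_vec k (A i s))" using e0[of i] by (simp add: field_simps)
      then show ?thesis by linarith
    qed
  next
    fix j assume j: "k < j"
    show "\<bar>s $ j\<bar> \<le> norm (orbit_form l l k (\<epsilon> i) 0 (A i s)) / \<epsilon> i"
      using orbit_form_le[OF j, of "A i s" "\<epsilon> i"] e0[of i] by (simp add: A_upper_part[OF j] abs_mult field_simps)
  qed
  have F_meas [measurable]: "F e \<in> borel_measurable borel" for e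
  proof -
    interpret orbit l l k e 0 by unfold_locales (use adj in auto)
    have t: "trv k l e \<in> GG" by (rule trv_in_GG) (use lk' in auto)
    have "conj_by (q ** trv k l e) (flag_refl l k e) = Smat"
      using q t R by (simp add: conj_by_conj_by[symmetric] conj_by_trv_flag_refl_0[OF lk'(2)])
    from measurable_orbit[OF n2 mult_in_GG[OF q t] this inv cont g] show ?thesis by (simp add: F_def[abs_def])
  qed
  have F_lim: "(\<lambda>i. F (\<epsilon> i) z) \<longlonglongrightarrow> F 0 z" for z
  proof -
    interpret orbit l l k 0 0 by unfold_locales (use adj in auto)
    let ?s = "orbit_rep z"
    have sG: "?s \<in> GG" using orbit_rep_UU UU_subset_GG by blast
    have tG: "trv k l e \<in> GG" for e by (rule trv_in_GG) (use lk' in auto)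
    have qi: "matrix_inv q \<in> GG" using GG_inverse[OF q] by simp
    \<comment> \<open>A representative in G of the orbit point with parameter e, continuous in e:
      \<open>orbit_rep\<close> is kept at e = 0 and only the base point is deformed.\<close>
    let ?x = "\<lambda>e. g ** ?s ** trv k l (- e) ** matrix_inv q"
    have xG: "?x e \<in> GG" for e using g sG tG qi mult_in_GG by blast
    have "F e z = \<phi> (?x e)" for e
    proof -
      have "orbit_form l l k e 0 z v* ?s = axis k 1 + axis l e"
      proof -
        have "orbit_form l l k e 0 z = orbit_form l l k 0 0 z + (axis l e - axis k (e * z $ l))"
          using lk' by (auto simp: orbit_form_def vec_eq_iff axis_component)
        moreover have "orbit_form l l k 0 0 z v* ?s = axis k 1"
        proof -
          have ax: "axis k 1 + axis l 0 = (axis k 1 :: (real, 'n) vec)" by (simp add: vec_eq_iff axis_component)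
          have "orbit_form l l k 0 0 z = axis k 1 v* matrix_inv ?s" using lam_orbit_rep[of z] unfolding lam_def ax by simp
          then show ?thesis by (simp add: vec_mult_assoc GG_inverse[OF sG])
        qed
        moreover have "(axis l e - axis k (e * z $ l)) v* ?s = axis l e"
        proof -
          have "(axis l e - axis k (e * z $ l)) \<bullet> lower_part k z = e * z $ l"
            using lk' by (simp add: inner_diff_left inner_axis_left lower_part_component)
          then have "(axis l e - axis k (e * z $ l)) v* (mat 1 + outer (lower_part k z) (axis k 1)) = axis l e"
            by (simp add: vec_mult_plus_outer vec_eq_iff axis_component)
          moreover have "axis l e v* (mat 1 - outer piv (upper_part k z)) = axis l e"
            using lk' by (simp add: vec_mult_minus_outer piv_def inner_axis_axis_real)
          ultimately show ?thesis by (simp add: orbit_rep_def vec_mult_assoc[symmetric])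
        qed
        moreover have "(x + y) v* ?s = x v* ?s + y v* ?s" for x y
          by (simp add: vec_eq_iff vector_matrix_mult_def distrib_right sum.distrib)
        ultimately show ?thesis by simp
      qed
      then have "(axis k 1 + axis l e) v* matrix_inv ?s = orbit_form l l k e 0 z"
        by (metis vec_mult_assoc GG_inverse(1)[OF sG] vec_mult_mat1)
      then have 1: "conj_by ?s (flag_refl l k e) = reflection (orbit_vec k z) (orbit_form l l k e 0 z)"
        by (simp add: flag_refl_def conj_by_refl[OF sG] orbit_rep_mult_axis)
      have "conj_by (trv k l (- e)) (flag_refl l k 0) = flag_refl l k e"
        using conj_by_inverse(2)[OF tG, of e "flag_refl l k e"] lk' by (simp add: matrix_inv_trv conj_by_trv_flag_refl_0)
      then have 2: "conj_by (g ** ?s) (conj_by (trv k l (- e)) (flag_refl l k 0)) = conj_by g (conj_by ?s (flag_refl l k e))"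
        using g sG by (simp add: conj_by_conj_by)
      have "conj_by (?x e) Smat = conj_by (g ** ?s) (conj_by (trv k l (- e)) (flag_refl l k 0))"
        using g sG tG qi q by (simp add: R[symmetric] conj_by_conj_by mult_in_GG GG_cancel)
      then have "conj_by (?x e) Smat = conj_by g (reflection (orbit_vec k z) (orbit_form l l k e 0 z))"
        by (simp only: 1 2)
      then show ?thesis using Phi_conj_by[OF n2 inv xG[of e]] by (simp add: F_def)
    qed
    moreover have "continuous_on UNIV (\<lambda>e. \<phi> (?x e))"
    proof (rule continuous_on_compose2[OF cont])
      have "continuous_on UNIV (\<lambda>e::real. trv k l (- e))"
      proof -
        have "continuous_on UNIV (\<lambda>e::real. trv k l (- e) $ i $ j)" for i j
          unfolding trv_component by (cases "i = k \<and> j = l") (auto intro!: continuous_intros)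
        then have "continuous_on UNIV (\<lambda>e::real. \<chi> i j. trv k l (- e) $ i $ j)"
          by (intro continuous_on_vec_lambda)
        then show ?thesis by simp
      qed
      then show "continuous_on UNIV ?x" by (intro continuous_intros)
    qed (use xG in auto)
    then have "isCont (\<lambda>e. \<phi> (?x e)) 0" by (simp add: continuous_on_eq_continuous_at)
    ultimately show ?thesis using isCont_tendsto_compose[OF _ elim, of "\<lambda>e. \<phi> (?x e)"] by simp
  qed
  \<comment> \<open>\<open>f1\<close> is the integrand where |1 - \<epsilon> z_l| \<ge> 1/2 and
    \<open>g2\<close> the rest, which the substitution turns into \<open>f2\<close>. Both
    \<open>f1\<close> and \<open>f2\<close> are dominated by the same integrable weight.\<close>
  define f1 where "f1 i z = (if \<bar>1 - \<epsilon> i * z $ l\<bar> \<ge> 1/2 then F (\<epsilon> i) z else 0)" for i z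
  define g2 where "g2 i z = (if \<bar>1 - \<epsilon> i * z $ l\<bar> \<ge> 1/2 then 0 else F (\<epsilon> i) z)" for i z
  define f2 where "f2 i s = g2 i (A i s)" for i s
  have f2: "f2 i s = (if \<bar>s $ l\<bar> < 1/2 then F (\<epsilon> i) (A i s) else 0)" for i s
    using e0[of i] by (auto simp: f2_def g2_def A_l)
  have [measurable]: "f1 i \<in> borel_measurable borel" "g2 i \<in> borel_measurable borel" for i
    unfolding f1_def[abs_def] g2_def[abs_def] by measurable
  have [measurable]: "f2 i \<in> borel_measurable borel" for i unfolding f2_def[abs_def] by measurable
  have C'0: "C' \<ge> 0" using C(1) by (simp add: C'_def)
  have W: "integrable (slab_measure k) (\<lambda>z. C' * weight k z)" by (intro integrable_mult_right integrable_weight)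
  have b1: "norm (f1 i z) \<le> C' * weight k z" for i z
    using dom1[of "\<epsilon> i" z] C'0 weight_nonneg[of k z] by (simp add: f1_def)
  have b2: "norm (f2 i s) \<le> C' * weight k s" for i s
    using dom2[of s i] C'0 weight_nonneg[of k s] by (simp add: f2)
  have i1: "integrable (slab_measure k) (f1 i)" for i
    by (rule Bochner_Integration.integrable_bound[OF W]) (use b1 order.trans[OF b1 abs_ge_self] in auto)
  have i2: "integrable (slab_measure k) (f2 i)" for i
    by (rule Bochner_Integration.integrable_bound[OF W]) (use b2 order.trans[OF b2 abs_ge_self] in auto)
  have ig2: "integrable (slab_measure k) (g2 i)" "(\<integral>z. g2 i z \<partial>slab_measure k) = (\<integral>s. f2 i s \<partial>slab_measure k)" for i
  proof -
    have m: "A i \<in> slab_measure k \<rightarrow>\<^sub>M borel" by measurable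
    have "integrable (distr (slab_measure k) borel (A i)) (g2 i)"
      using i2[of i] by (subst integrable_distr_eq[OF m]) (auto simp: f2_def[abs_def])
    then show "integrable (slab_measure k) (g2 i)" by (simp only: A_slab)
    have "(\<integral>z. g2 i z \<partial>distr (slab_measure k) borel (A i)) = (\<integral>s. f2 i s \<partial>slab_measure k)"
      unfolding f2_def by (rule integral_distr[OF m]) measurable
    then show "(\<integral>z. g2 i z \<partial>slab_measure k) = (\<integral>s. f2 i s \<partial>slab_measure k)" by (simp only: A_slab)
  qed
  have sum0: "(\<integral>z. f1 i z \<partial>slab_measure k) + (\<integral>s. f2 i s \<partial>slab_measure k) = 0" for i
  proof -
    have "(\<integral>z. f1 i z \<partial>slab_measure k) + (\<integral>z. g2 i z \<partial>slab_measure k) = (\<integral>z. f1 i z + g2 i z \<partial>slab_measure k)"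
      by (rule Bochner_Integration.integral_add[symmetric]) (rule i1 ig2)+
    also have "\<dots> = (\<integral>z. F (\<epsilon> i) z \<partial>slab_measure k)"
      by (intro Bochner_Integration.integral_cong) (auto simp: f1_def g2_def)
    also have "\<dots> = 0" using zero[of "\<epsilon> i"] e0[of i] by (simp add: F_def)
    finally show ?thesis by (simp add: ig2)
  qed
  have l1: "(\<lambda>i. \<integral>z. f1 i z \<partial>slab_measure k) \<longlonglongrightarrow> (\<integral>z. F 0 z \<partial>slab_measure k)"
  proof (rule integral_dominated_convergence[OF _ _ W])
    show "AE z in slab_measure k. (\<lambda>i. f1 i z) \<longlonglongrightarrow> F 0 z"
    proof (rule AE_I2)
      fix z
      have "(\<lambda>i. \<bar>1 - \<epsilon> i * z $ l\<bar>) \<longlonglongrightarrow> \<bar>1 - 0 * z $ l\<bar>" by (intro tendsto_intros elim)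
      then have "eventually (\<lambda>i. \<bar>1 - \<epsilon> i * z $ l\<bar> > 1/2) sequentially" by (rule order_tendstoD) simp
      then have "eventually (\<lambda>i. F (\<epsilon> i) z = f1 i z) sequentially" by eventually_elim (simp add: f1_def)
      with F_lim[of z] show "(\<lambda>i. f1 i z) \<longlonglongrightarrow> F 0 z" by (rule Lim_transform_eventually)
    qed
  qed (use b1 in auto)
  have l2: "(\<lambda>i. \<integral>s. f2 i s \<partial>slab_measure k) \<longlonglongrightarrow> (\<integral>s. 0 \<partial>slab_measure k)"
  proof (rule integral_dominated_convergence[OF _ _ W])
    show "AE s in slab_measure k. (\<lambda>i. f2 i s) \<longlonglongrightarrow> 0"
      using AE_slab_nonzero[of l k]
    proof eventually_elim
      fix s :: "(real, 'n) vec" assume s0: "s $ l \<noteq> 0"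
      show "(\<lambda>i. f2 i s) \<longlonglongrightarrow> 0"
      proof (cases "\<bar>s $ l\<bar> < 1/2")
        case True
        \<comment> \<open>Here r is at least |s_l| / (2 \<epsilon>), and since d \<ge> 1 the
          Schwartz bound provides at least one factor 1 / r.\<close>
        have "norm (f2 i s) \<le> 2 * C / \<bar>s $ l\<bar> * \<epsilon> i" for i
        proof -
          let ?r = "rr (\<epsilon> i) (A i s)"
          have "1 * (\<bar>s $ l\<bar> / \<epsilon> i) \<le> (2 * \<epsilon> i * norm (orbit_vec k (A i s))) * (norm (orbit_form l l k (\<epsilon> i) 0 (A i s)) / \<epsilon> i)"
            by (rule mult_mono[OF a_b(1)[OF True] a_b(3)[OF True]])
              (use order.trans[OF zero_le_one a_b(1)[OF True]] e0[of i] in auto)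
          then have r: "\<bar>s $ l\<bar> / (2 * \<epsilon> i) \<le> ?r" unfolding ab_rr by (simp add: field_simps)
          have "?r ^ 1 * 1 \<le> ?r ^ d * (1 + ln ?r) ^ (4 * d)"
            using rr1[of "\<epsilon> i" "A i s"] d1 by (intro mult_mono power_increasing one_le_power) auto
          then have "norm (f2 i s) * ?r \<le> norm (f2 i s) * (?r ^ d * (1 + ln ?r) ^ (4 * d))"
            by (intro mult_left_mono) auto
          also have "\<dots> \<le> C" using FC[of "\<epsilon> i" "A i s"] True by (simp add: f2)
          finally have "norm (f2 i s) * ?r \<le> C" .
          moreover have "norm (f2 i s) * (\<bar>s $ l\<bar> / (2 * \<epsilon> i)) \<le> norm (f2 i s) * ?r"
            using r by (intro mult_left_mono) auto
          ultimately have "norm (f2 i s) * (\<bar>s $ l\<bar> / (2 * \<epsilon> i)) \<le> C" by linarith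
          then show ?thesis
          proof -
            have p: "\<bar>s $ l\<bar> / (2 * \<epsilon> i) > 0" using s0 e0[of i] by simp
            have "norm (f2 i s) \<le> C / (\<bar>s $ l\<bar> / (2 * \<epsilon> i))"
              using \<open>norm (f2 i s) * (\<bar>s $ l\<bar> / (2 * \<epsilon> i)) \<le> C\<close> p by (simp only: pos_le_divide_eq)
            also have "\<dots> = 2 * C / \<bar>s $ l\<bar> * \<epsilon> i" by simp
            finally show ?thesis .
          qed
        qed
        then have "\<forall>\<^sub>F i in sequentially. norm (f2 i s) \<le> 2 * C / \<bar>s $ l\<bar> * \<epsilon> i"
          by (rule always_eventually[OF allI])
        then show ?thesis by (rule Lim_null_comparison[OF _ tendsto_mult_right_zero[OF elim]])
      qed (simp add: f2)
    qed
  qed (use b2 in auto)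
  have "(\<lambda>i. (\<integral>z. f1 i z \<partial>slab_measure k) + (\<integral>s. f2 i s \<partial>slab_measure k)) \<longlonglongrightarrow> (\<integral>z. F 0 z \<partial>slab_measure k) + 0"
    using tendsto_add[OF l1 l2] by simp
  then have "(\<integral>z. F 0 z \<partial>slab_measure k) = 0" unfolding sum0 by (simp add: LIMSEQ_const_iff)
  then show ?thesis by (simp add: F_def)
qed

section \<open>Equivalence of the vanishing conditions\<close>

theorem proposition3p3:
  fixes \<phi> :: "'n::{finite,linorder} mat \<Rightarrow> complex"
    and dn :: "'n mat set \<Rightarrow> 'n mat set measure"
  assumes "CARD('n) \<ge> 3"
    and "\<phi> \<in> Schwartz"
    and "\<And>P. h_compatible P \<Longrightarrow> invariant_measure P (dn P)"
  shows "let vanishes = (\<lambda>P g. horo_integral (dn P) \<phi> g = 0);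
             i = (\<forall>g\<in>GG. \<forall>P. h_compatible P \<longrightarrow> vanishes P g);
             ii = (\<forall>g\<in>GG. \<forall>P\<in>parab_P_h. vanishes P g);
             iii = (\<forall>g\<in>GG. \<forall>P\<in>parab_P_h \<inter> parab_P_star. vanishes P g);
             iv = (\<forall>C\<in>H_class ` (parab_P_h \<inter> parab_P_star). \<exists>P\<in>C. \<forall>g\<in>GG. vanishes P g)
         in (i \<longleftrightarrow> ii) \<and> (ii \<longleftrightarrow> iii) \<and> (iii \<longleftrightarrow> iv)"
proof -
  have n2: "CARD('n) \<ge> 2" using assms(1) by simp
  have inv: "\<And>g h. g \<in> GG \<Longrightarrow> h \<in> HH \<Longrightarrow> \<phi> (g ** h) = \<phi> g" using assms(2) by (auto simp: Schwartz_def)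
  have cont: "continuous_on GG \<phi>" using assms(2) by (intro smooth_on_G_imp_continuous) (auto simp: Schwartz_def)
  define van where "van = (\<lambda>P g. horo_integral (dn P) \<phi> g = 0)"
  define c1 where "c1 \<longleftrightarrow> (\<forall>g\<in>GG. \<forall>P. h_compatible P \<longrightarrow> van P g)"
  define c2 where "c2 \<longleftrightarrow> (\<forall>g\<in>GG. \<forall>P\<in>parab_P_h. van P g)"
  define c3 where "c3 \<longleftrightarrow> (\<forall>g\<in>GG. \<forall>P\<in>parab_P_h \<inter> parab_P_star. van P g)"
  define c4 where "c4 \<longleftrightarrow> (\<forall>C\<in>H_class ` (parab_P_h \<inter> parab_P_star). \<exists>P\<in>C. \<forall>g\<in>GG. van P g)"
  have "c2" if "c1" using that by (auto simp: c1_def c2_def parab_P_h_def)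
  moreover have "c3" if "c2" using that by (auto simp: c2_def c3_def)
  moreover have "c4" if "c3"
  proof -
    have "P \<in> H_class P" for P :: "'n mat set"
    proof -
      have "mat 1 \<in> (HH :: 'n mat set)" by (simp add: HH_iff[OF n2] mat1_in_GG)
      moreover have "P = conj_by (mat 1) ` P" by simp
      ultimately show ?thesis unfolding H_class_def by blast
    qed
    then show ?thesis using that unfolding c3_def c4_def by blast
  qed
  \<comment> \<open>The implications so far only restrict the set of parabolic subgroups; this one
    carries the content.\<close>
  moreover have "c1" if "c4"
  proof -
    \<comment> \<open>Passing to another member of the H-conjugacy class replaces q by
      \<open>h ** q\<close>, which is a base point of the same type. The resulting slab integrals do
      not involve the base point, so the representative supplied by (iv) suffices.\<close>
    have key: "(\<integral>w. Phi \<phi> (conj_by g (reflection (orbit_vec k w) (orbit_form l l k e 0 w))) \<partial>slab_measure k) = 0"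
      if q: "q \<in> GG" and R: "conj_by q (flag_refl l k e) = Smat" and e: "e \<noteq> 0" and adj: "adjacent l k"
        and anti: "\<And>i j. i < j \<Longrightarrow> rvec {l, k} $ j \<le> rvec {l, k} $ i" and g: "g \<in> GG" for q l k e g
    proof -
      interpret orbit l l k e 0 by unfold_locales (use adj in auto)
      have "conj_by q ` BB \<in> parab_P_h \<inter> parab_P_star"
        using flag_refl_in_parab_P_h[OF n2 q R e _ anti] adjacent_in_parab_P_star[OF n2 q R e adj] adj by blast
      then obtain P where P: "P \<in> H_class (conj_by q ` BB)" "\<forall>g\<in>GG. van P g"
        using \<open>c4\<close> unfolding c4_def by blast
      then obtain h where h: "h \<in> HH" "P = conj_by h ` conj_by q ` BB" by (auto simp: H_class_def)
      have hG: "h \<in> GG" "conj_by h Smat = Smat" using h(1) by (auto simp: HH_iff[OF n2])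
      have P': "P = conj_by (h ** q) ` BB" using h(2) hG(1) q by (simp add: conj_by_image_comp)
      have q': "h ** q \<in> GG" using hG(1) q mult_in_GG by blast
      have R': "conj_by (h ** q) (flag_refl l k e) = Smat" using hG q R by (simp add: conj_by_conj_by[symmetric])
      have "P \<in> parab_P_h" unfolding P' using flag_refl_in_parab_P_h[OF n2 q' R' e _ anti] adj by blast
      then have "h_compatible P" by (simp add: parab_P_h_def)
      from assms(3)[OF this] have \<mu>: "invariant_measure (conj_by (h ** q) ` BB) (dn P)" by (simp only: P')
      show ?thesis
        by (rule slab_integral_of_horo_integral[OF n2 q' R' \<mu> inv cont refl _ g])
          (use P(2) in \<open>auto simp: van_def\<close>)
    qed
    have "van P g" if P: "h_compatible P" and g: "g \<in> GG" for P g
    proof -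
      note dnP = assms(3)[OF P]
      show ?thesis
      proof (rule h_compatible_cases[OF n2 P], goal_cases swap sign)
        case (swap g0 v l a b)
        obtain q e where q: "q \<in> GG" "e \<noteq> 0" "conj_by q ` BB = conj_by g0 ` BB" "conj_by q (flag_refl a b e) = Smat"
          using swap_type_imp_flag_refl[OF swap(1,3,4)] .
        have Pq: "P = conj_by q ` BB" using swap(2) q(3) by simp
        have ab: "a < b" using swap(4) by (simp add: swap_type_def)
        note \<mu> = dnP[unfolded Pq]
        from antitone_rvec_cases[OF ab swap(5)] show ?thesis
        proof
          assume adj: "adjacent a b"
          interpret orbit a a b e 0 by unfold_locales (use adj in auto)
          have "horo_integral (dn (conj_by q ` BB)) \<phi> g = 0"
          proof (rule horo_integral_of_slab_integrals[OF n2 q(1,4) \<mu> inv cont _ g])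
            show "(\<integral>w. Phi \<phi> (conj_by g (reflection (orbit_vec b w) (orbit_form a a b e (e * 0) (put b w y)))) \<partial>slab_measure b) = 0"
              if "g \<in> GG" for g y
              unfolding coordinates_put(2)[OF refl] by (rule key[OF q(1,4,2) adj swap(5) that])
          qed
          then show ?thesis by (simp add: van_def Pq)
        next
          assume "\<exists>m. a < m \<and> m < b \<and> (\<forall>c. a < c \<and> c < b \<longrightarrow> c = m) \<and> card {j. j < m} = card {j. m < j}"
          then obtain m where m: "a < m" "m < b" "\<And>c. a < c \<and> c < b \<Longrightarrow> c = m" "card {j. j < m} = card {j. m < j}"
            by blast
          have t1: "e * (1 / e) = 1" using q(2) by simp
          interpret orbit a m b e "1 / e" by unfold_locales (use ab t1 m in blast)+
          have adj: "adjacent m b" using m(1,2) m(3) by (metis less_irrefl order.strict_trans)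
          \<comment> \<open>The middle index m has as many indices below it as above it, and b is
            one of those above. So the numbers below m and above b differ by one.\<close>
          have anti: "rvec {m, b} $ j \<le> rvec {m, b} $ i" if "i < j" for i j
            by (rule rvec_antitone[OF adj _ _ that]) (use m(4) card_less_pred(2)[OF adj] in auto)
          let ?c = "flip a m e 0"
          have c: "?c \<in> GG" by (rule flip_in_GG) (use m(1) in auto)
          have q': "q ** ?c \<in> GG" using q(1) c mult_in_GG by blast
          have R': "conj_by (q ** ?c) (flag_refl m b (- e)) = Smat"
            using q(1,4) c conj_by_flip_flag_refl[OF m(1,2)] by (simp add: conj_by_conj_by[symmetric])
          have "horo_integral (dn (conj_by q ` BB)) \<phi> g = 0"
          proof (rule horo_integral_of_slab_integrals[OF n2 q(1,4) \<mu> inv cont _ g])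
            show "(\<integral>w. Phi \<phi> (conj_by g (reflection (orbit_vec b w) (orbit_form a m b e (e * (1 / e)) (put b w y)))) \<partial>slab_measure b) = 0"
              if g: "g \<in> GG" for g y
              unfolding t1
            proof (rule slab_integral_flip[OF n2 q(1,4) inv cont g q(2) m(1-3)])
              show "(\<integral>w. Phi \<phi> (conj_by g (reflection (orbit_vec b w) (orbit_form m m b (- e) 0 w))) \<partial>slab_measure b) = 0"
                if "g \<in> GG" for g
                by (rule key[OF q' R' _ adj anti that]) (use q(2) in auto)
            qed
          qed
          then show ?thesis by (simp add: van_def Pq)
        qed
      next
        case (sign g0 v w k)
        note bal = strict_rvec_balanced[OF sign(5)]
        \<comment> \<open>If nothing were below k, balance would leave nothing above it either, and
          n would be 1.\<close>
        have "{j. j < k} \<noteq> {}"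
        proof
          assume empty: "{j. j < k} = {}"
          then have "{j. k < j} = {}" using bal by simp
          with empty have "UNIV = {k}" by (metis (mono_tags) UNIV_eq_I empty_iff insertI1 linorder_neqE mem_Collect_eq)
          then have "CARD('n) = 1" by (metis card_1_singleton_iff One_nat_def)
          then show False using assms(1) by simp
        qed
        then obtain l where adj: "adjacent l k" using exists_pred by blast
        have lk: "l \<noteq> k" using adj by auto
        have R: "conj_by g0 (flag_refl l k 0) = Smat" using sign(3) sign_type_imp_flag_refl[OF sign(4), of l] by simp
        have anti: "rvec {l, k} $ j \<le> rvec {l, k} $ i" if "i < j" for i j
          by (rule rvec_antitone[OF adj _ _ that]) (use bal card_less_pred(1)[OF adj] in auto)
        have slab: "(\<integral>w. Phi \<phi> (conj_by g (reflection (orbit_vec k w) (orbit_form l l k 0 0 w))) \<partial>slab_measure k) = 0"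
          if g: "g \<in> GG" for g
        proof (rule slab_integral_limit[OF assms(1,2) refl bal[symmetric] adj sign(1) R g])
          fix e :: real assume e: "e \<noteq> 0"
          \<comment> \<open>Every nonzero e deforms the rank zero base point into one for the
            adjacent pair l, k, to which \<open>key\<close> applies.\<close>
          have t: "trv k l e \<in> GG" by (rule trv_in_GG) (use lk in auto)
          have "conj_by (g0 ** trv k l e) (flag_refl l k e) = Smat"
            using sign(1) t R by (simp add: conj_by_conj_by[symmetric] conj_by_trv_flag_refl_0[OF lk])
          then show "(\<integral>w. Phi \<phi> (conj_by g (reflection (orbit_vec k w) (orbit_form l l k e 0 w))) \<partial>slab_measure k) = 0"
            by (rule key[OF mult_in_GG[OF sign(1) t] _ e adj anti g])
        qed
        interpret orbit l l k 0 0 by unfold_locales (use adj in auto)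
        have "horo_integral (dn (conj_by g0 ` BB)) \<phi> g = 0"
        proof (rule horo_integral_of_slab_integrals[OF n2 sign(1) R dnP[unfolded sign(2)] inv cont _ g])
          show "(\<integral>w. Phi \<phi> (conj_by g (reflection (orbit_vec k w) (orbit_form l l k 0 (0 * 0) (put k w y)))) \<partial>slab_measure k) = 0"
            if "g \<in> GG" for g y
            unfolding coordinates_put(2)[OF refl] by (rule slab[OF that])
        qed
        then show ?thesis by (simp add: van_def sign(2))
      qed
    qed
    then show ?thesis by (simp add: c1_def)
  qed
  ultimately have "(c1 \<longleftrightarrow> c2) \<and> (c2 \<longleftrightarrow> c3) \<and> (c3 \<longleftrightarrow> c4)" by blast
  then show ?thesis unfolding Let_def c1_def c2_def c3_def c4_def van_def .
qed

end
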